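(* Let $\omega,t_o>0$, $h=2\pi/t_o$, and let $\ell\ge2$ be an integer with $\frac{\omega}{\ell-1/2}<h<\frac{\omega}{\ell-1}$. Let $\Phi=\{\varphi_j:1\le j\le 2\ell-1\}\subset B_\omega$ and set $K_-=(0,\omega-(\ell-1)h)$, $K=(\omega-(\ell-1)h,-\omega+\ell h)$, $K_+=(-\omega+\ell h,h)$. If $E_{\Phi,t_o}=\{\tau_{nt_o}\varphi_j:n\in\mathbb Z,\ 1\le j\le 2\ell-1\}$ is a frame for $B_\omega$, then $$G_{\Phi,\Phi^*,t_o}=I_{2\ell-1}\quad\text{a.e. in }K_-\cup K_+,\qquad G_{\Phi,\Phi^*,t_o}=I_{2\ell-1}-P_W\quad\text{a.e. in }K,$$ where, for $x\in K$, $W(x)\in\mathbb C^{2\ell-1}$ is the cross product of the $2\ell-2$ vectors $\big(\widehat{\varphi_1}(x+jh),\dots,\widehat{\varphi_{2\ell-1}}(x+jh)\big)$, $j=-\ell+1,\dots,\ell-2$.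
   Context: Fourier transform: $\widehat f(\xi)=\frac1{\sqrt{2\pi}}\int f(t)e^{-it\xi}\,dt$. $B_\omega$ is the space of $f\in L^2(\mathbb R)$ whose Fourier transform is supported in $[-\omega,\omega]$. $\tau_af(x)=f(x+a)$. The family $E_{\Phi,t_o}$ is a frame for $B_\omega$ if there are constants $0<A\le B$ with $A\|f\|^2\le\sum_{j}\sum_{n\in\mathbb Z}|\langle f,\tau_{nt_o}\varphi_j\rangle|^2\le B\|f\|^2$ for all $f\in B_\omega$. In this case the frame operator $S f=\sum_j\sum_{n\in\mathbb Z}\langle f,\tau_{nt_o}\varphi_j\rangle\tau_{nt_o}\varphi_j$ is invertible on $B_\omega$, and the dual generators $\Phi^*=\{\varphi_j^*\}$ are $\varphi_j^*=S^{-1}\varphi_j$. The mixed Gramian $G_{\Phi,\Phi^*,t_o}$ is the $h$-periodic matrix-valued function with entries $\big(G_{\Phi,\Phi^*,t_o}\big)_{jk}(x)=h\sum_{m\in\mathbb Z}\widehat{\varphi_k^*}(x+mh)\,\overline{\widehat{\varphi_j}(x+mh)}$. $I_n$ is the $n\times n$ identity matrix; for $v\in\mathbb C^n$, $P_v$ is the orthogonal projection of $\mathbb C^n$ onto the span of $v$ (standard Hermitian inner product). Cross product: for $v_1,\dots,v_{n-1}\in\mathbb C^n$, the cross product is the vector in $\mathbb C^n$ whose $k$-th component is $(-1)^{k+1}$ times the determinant of the $(n-1)\times(n-1)$ matrix obtained by deleting the $k$-th column from the matrix with rows $v_1,\dots,v_{n-1}$ (no complex conjugation). *)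

theory Defs
  imports "HOL-Analysis.Analysis" "Jordan_Normal_Form.Determinant"
    "Jordan_Normal_Form.Conjugate"
begin

hide_const (open) Finite_Cartesian_Product.vec Finite_Cartesian_Product.mat
  Determinants.det Finite_Cartesian_Product.row
hide_type (open) Finite_Cartesian_Product.vec
unbundle no vec_syntax

text \<open>
  Elements of $L^2(R)$ are represented by Borel functions; every class modulo null sets has such
  a representative, and equality in $L^2$ is equality almost everywhere.  Operations whose value
  is only determined modulo null sets (the Fourier-Plancherel transform, the frame operator and
  its inverse) are given by a choice of a representative.
\<close>

definition L2_space :: "(real \<Rightarrow> complex) set" where
  "L2_space = {f \<in> borel_measurable lborel. integrable lborel (\<lambda>x. (cmod (f x))\<^sup>2)}"

definition L2_inner :: "(real \<Rightarrow> complex) \<Rightarrow> (real \<Rightarrow> complex) \<Rightarrow> complex" where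
  "L2_inner f g = (LINT x|lborel. f x * cnj (g x))"

definition L2_norm :: "(real \<Rightarrow> complex) \<Rightarrow> real" where
  "L2_norm f = sqrt (LINT x|lborel. (cmod (f x))\<^sup>2)"

text \<open>The distance is measured by an \<open>ennreal\<close>-valued integral because the Bochner integral of
  a non-integrable function is \<open>0\<close>.\<close>

definition L2_tendsto ::
    "('i \<Rightarrow> real \<Rightarrow> complex) \<Rightarrow> (real \<Rightarrow> complex) \<Rightarrow> 'i filter \<Rightarrow> bool" where
  "L2_tendsto u f F \<longleftrightarrow>
     ((\<lambda>i. \<integral>\<^sup>+ x. ennreal ((cmod (u i x - f x))\<^sup>2) \<partial>lborel) \<longlongrightarrow> 0) F"

text \<open>For $f$ in $L^2$ the Fourier integral need not converge absolutely, so it is read in the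
  sense of Plancherel: as the $L^2$ limit of the integrals over $[-R,R]$ for $R$ to infinity.\<close>

definition fourier_truncated :: "(real \<Rightarrow> complex) \<Rightarrow> real \<Rightarrow> real \<Rightarrow> complex" where
  "fourier_truncated f R \<xi> =
     complex_of_real (1 / sqrt (2 * pi)) *
       (LINT t:{-R..R}|lborel. f t * exp (- \<i> * complex_of_real (t * \<xi>)))"

definition fourier :: "(real \<Rightarrow> complex) \<Rightarrow> real \<Rightarrow> complex" where
  "fourier f = (SOME g. g \<in> L2_space \<and> L2_tendsto (fourier_truncated f) g at_top)"

definition bandlimited :: "real \<Rightarrow> (real \<Rightarrow> complex) set" where
  "bandlimited \<omega> =
     {f \<in> L2_space. AE \<xi> in lborel. \<xi> \<notin> {-\<omega>..\<omega>} \<longrightarrow> fourier f \<xi> = 0}"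

definition translate :: "real \<Rightarrow> (real \<Rightarrow> complex) \<Rightarrow> real \<Rightarrow> complex" where
  "translate a f = (\<lambda>x. f (x + a))"

text \<open>Without the explicit summability condition a divergent sum would be read as \<open>0\<close>.\<close>

definition is_frame ::
    "(real \<Rightarrow> complex) set \<Rightarrow> 'i set \<Rightarrow> ('i \<Rightarrow> real \<Rightarrow> complex) \<Rightarrow> bool" where
  "is_frame V I e \<longleftrightarrow>
     (\<exists>A B. 0 < A \<and> A \<le> B \<and>
       (\<forall>f\<in>V. (\<lambda>i. (cmod (L2_inner f (e i)))\<^sup>2) summable_on I \<and>
          A * (L2_norm f)\<^sup>2 \<le> (\<Sum>\<^sub>\<infinity>i\<in>I. (cmod (L2_inner f (e i)))\<^sup>2) \<and>
          (\<Sum>\<^sub>\<infinity>i\<in>I. (cmod (L2_inner f (e i)))\<^sup>2) \<le> B * (L2_norm f)\<^sup>2))"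

text \<open>The series converges unconditionally in $L^2$, hence the limit along finite subsets.\<close>

definition frame_operator ::
    "'i set \<Rightarrow> ('i \<Rightarrow> real \<Rightarrow> complex) \<Rightarrow> (real \<Rightarrow> complex) \<Rightarrow> real \<Rightarrow> complex" where
  "frame_operator I e f =
     (SOME g. g \<in> L2_space \<and>
        L2_tendsto (\<lambda>F x. \<Sum>i\<in>F. L2_inner f (e i) * e i x) g (finite_subsets_at_top I))"

definition frame_operator_inv ::
    "(real \<Rightarrow> complex) set \<Rightarrow> 'i set \<Rightarrow> ('i \<Rightarrow> real \<Rightarrow> complex) \<Rightarrow>
       (real \<Rightarrow> complex) \<Rightarrow> real \<Rightarrow> complex" where
  "frame_operator_inv V I e g =
     (SOME f. f \<in> V \<and> (AE x in lborel. frame_operator I e f x = g x))"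

text \<open>The system of translates of \<open>\<Phi> 1, \<dots>, \<Phi> N\<close>, as a family indexed by pairs \<open>(j, n)\<close>.\<close>

definition shift_index :: "nat \<Rightarrow> (nat \<times> int) set" where
  "shift_index N = {1..N} \<times> UNIV"

definition shift_system ::
    "real \<Rightarrow> (nat \<Rightarrow> real \<Rightarrow> complex) \<Rightarrow> nat \<times> int \<Rightarrow> real \<Rightarrow> complex" where
  "shift_system t\<^sub>o \<Phi> = (\<lambda>(j, n). translate (of_int n * t\<^sub>o) (\<Phi> j))"

definition dual_generator ::
    "real \<Rightarrow> real \<Rightarrow> nat \<Rightarrow> (nat \<Rightarrow> real \<Rightarrow> complex) \<Rightarrow> nat \<Rightarrow> real \<Rightarrow> complex" where
  "dual_generator \<omega> t\<^sub>o N \<Phi> j =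
     frame_operator_inv (bandlimited \<omega>) (shift_index N) (shift_system t\<^sub>o \<Phi>) (\<Phi> j)"

text \<open>Matrix and vector positions are counted from \<open>0\<close>, the generators from \<open>1\<close>.\<close>

definition mixed_gramian ::
    "nat \<Rightarrow> real \<Rightarrow> (nat \<Rightarrow> real \<Rightarrow> complex) \<Rightarrow> (nat \<Rightarrow> real \<Rightarrow> complex) \<Rightarrow>
       real \<Rightarrow> complex Matrix.mat" where
  "mixed_gramian N t\<^sub>o \<Phi> \<Psi> x =
     (let h = 2 * pi / t\<^sub>o in
      Matrix.mat N N (\<lambda>(j, k). complex_of_real h *
        (\<Sum>\<^sub>\<infinity>m\<in>(UNIV :: int set).
           fourier (\<Psi> (k + 1)) (x + of_int m * h) * cnj (fourier (\<Phi> (j + 1)) (x + of_int m * h)))))"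

definition fourier_vec ::
    "nat \<Rightarrow> (nat \<Rightarrow> real \<Rightarrow> complex) \<Rightarrow> real \<Rightarrow> complex Matrix.vec" where
  "fourier_vec N \<Phi> \<xi> = Matrix.vec N (\<lambda>i. fourier (\<Phi> (i + 1)) \<xi>)"

text \<open>Counting from \<open>0\<close> turns the sign $(-1)^{k+1}$ into \<open>(- 1) ^ k\<close>.\<close>

definition cross_product :: "complex Matrix.vec list \<Rightarrow> complex Matrix.vec" where
  "cross_product vs =
     (let m = length vs in
      Matrix.vec (m + 1) (\<lambda>k. (- 1) ^ k *
        Determinant.det (Matrix.mat m m (\<lambda>(i, j). vec_index (vs ! i) (if j < k then j else j + 1)))))"

definition is_orth_projection :: "complex Matrix.vec \<Rightarrow> complex Matrix.mat \<Rightarrow> bool" where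
  "is_orth_projection v P \<longleftrightarrow>
     P \<in> carrier_mat (dim_vec v) (dim_vec v) \<and>
     (\<forall>u\<in>carrier_vec (dim_vec v).
        (\<exists>c. P *\<^sub>v u = c \<cdot>\<^sub>v v) \<and> (u - P *\<^sub>v u) \<bullet>c v = 0)"

definition orth_projection :: "complex Matrix.vec \<Rightarrow> complex Matrix.mat" where
  "orth_projection v = (THE P. is_orth_projection v P)"

lemma cscalar_prod_minus_smult:
  assumes u: "u \<in> carrier_vec n"
    and v: "(v::complex Matrix.vec) \<in> carrier_vec n"
  shows "(u - c \<cdot>\<^sub>v v) \<bullet>c v = u \<bullet>c v - c * (v \<bullet>c v)"
proof -
  have cv: "conjugate v \<in> carrier_vec n" using v by simp
  have "(u - c \<cdot>\<^sub>v v) \<bullet>c v = u \<bullet>c v - (c \<cdot>\<^sub>v v) \<bullet>c v"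
    by (rule minus_scalar_prod_distrib[OF u _ cv]) (use v in simp)
  also have "(c \<cdot>\<^sub>v v) \<bullet>c v = c * (v \<bullet>c v)"
    by (rule smult_scalar_prod_distrib[OF v cv])
  finally show ?thesis .
qed

lemma index_mat_unit_vec:
  fixes A :: "complex Matrix.mat"
  assumes ij: "i < n" "j < n" and "A \<in> carrier_mat n n"
  shows "A $$ (i, j) = vec_index (A *\<^sub>v unit_vec n j) i"
proof -
  have "vec_index (A *\<^sub>v unit_vec n j) i = scalar_prod (Matrix.row A i) (unit_vec n j)"
    using assms by (intro index_mult_mat_vec) auto
  also have "\<dots> = vec_index (Matrix.row A i) j" by (rule scalar_prod_right_unit[OF ij(2)])
  also have "\<dots> = A $$ (i, j)" using assms by simp
  finally show ?thesis by simp
qed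

lemma rank_one_mult_vec:
  fixes u v :: "complex Matrix.vec"
  assumes u: "u \<in> carrier_vec (dim_vec v)"
  shows "Matrix.mat (dim_vec v) (dim_vec v)
      (\<lambda>(i, j). vec_index v i * cnj (vec_index v j) / (v \<bullet>c v)) *\<^sub>v u =
      ((u \<bullet>c v) / (v \<bullet>c v)) \<cdot>\<^sub>v v"
  (is "?P *\<^sub>v u = (_ / ?s) \<cdot>\<^sub>v v")
proof (rule eq_vecI)
  fix i assume "i < dim_vec (((u \<bullet>c v) / ?s) \<cdot>\<^sub>v v)"
  then have i: "i < dim_vec v" by simp
  have "vec_index (?P *\<^sub>v u) i = scalar_prod (Matrix.row ?P i) u" using i by (intro index_mult_mat_vec) simp
  also have "\<dots> = (\<Sum>j\<in>{0..<dim_vec v}. vec_index v i * cnj (vec_index v j) / ?s * vec_index u j)"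
    unfolding scalar_prod_def using u i by (intro sum.cong) auto
  also have "\<dots> = (\<Sum>j\<in>{0..<dim_vec v}. vec_index u j * cnj (vec_index v j)) / ?s * vec_index v i"
    unfolding sum_divide_distrib sum_distrib_right by (intro sum.cong) auto
  also have "(\<Sum>j\<in>{0..<dim_vec v}. vec_index u j * cnj (vec_index v j)) = u \<bullet>c v"
    unfolding scalar_prod_def[of u] by (intro sum.cong) auto
  finally show "vec_index (?P *\<^sub>v u) i = vec_index (((u \<bullet>c v) / ?s) \<cdot>\<^sub>v v) i" using i by simp
qed simp

lemma is_orth_projection_unique:
  assumes P: "is_orth_projection v P" and Q: "is_orth_projection v Q"
  shows "P = Q"
proof -
  let ?n = "dim_vec v"
  have v: "v \<in> carrier_vec ?n" by (rule carrier_vecI) (rule refl)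
  have Pc: "P \<in> carrier_mat ?n ?n" and Qc: "Q \<in> carrier_mat ?n ?n"
    using P Q unfolding is_orth_projection_def by blast+
  have eq: "P *\<^sub>v u = Q *\<^sub>v u" if u: "u \<in> carrier_vec ?n" for u
  proof -
    obtain a where a: "P *\<^sub>v u = a \<cdot>\<^sub>v v"
      using P u unfolding is_orth_projection_def by blast
    obtain b where b: "Q *\<^sub>v u = b \<cdot>\<^sub>v v"
      using Q u unfolding is_orth_projection_def by blast
    have "(u - a \<cdot>\<^sub>v v) \<bullet>c v = 0"
      using P u unfolding is_orth_projection_def by (metis a)
    moreover have "(u - b \<cdot>\<^sub>v v) \<bullet>c v = 0"
      using Q u unfolding is_orth_projection_def by (metis b)
    ultimately have "(a - b) * (v \<bullet>c v) = 0"
      unfolding cscalar_prod_minus_smult[OF u v] left_diff_distrib by (metis diff_eq_diff_eq diff_self)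
    then have "a = b \<or> v = 0\<^sub>v ?n"
      unfolding mult_eq_0_iff conjugate_square_eq_0_vec[OF v] right_minus_eq .
    then show ?thesis
    proof
      assume v0: "v = 0\<^sub>v ?n"
      have "c \<cdot>\<^sub>v 0\<^sub>v ?n = (0\<^sub>v ?n :: complex Matrix.vec)" for c
        by (rule eq_vecI) simp_all
      then show ?thesis using a b v0 by metis
    qed (use a b in metis)
  qed
  show ?thesis
  proof (rule eq_matI)
    fix i j assume "i < dim_row Q" and "j < dim_col Q"
    then have ij: "i < ?n" "j < ?n" using Qc by auto
    show "P $$ (i, j) = Q $$ (i, j)"
      unfolding index_mat_unit_vec[OF ij Pc] index_mat_unit_vec[OF ij Qc]
        eq[OF unit_vec_carrier] by (rule refl)
  qed (use Pc Qc in auto)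
qed

lemma is_orth_projection_rank_one:
  "is_orth_projection v
     (Matrix.mat (dim_vec v) (dim_vec v)
       (\<lambda>(i, j). vec_index v i * cnj (vec_index v j) / (v \<bullet>c v)))"
  (is "is_orth_projection v ?P")
proof -
  have v: "v \<in> carrier_vec (dim_vec v)" by (rule carrier_vecI) (rule refl)
  have "(u - ((u \<bullet>c v) / (v \<bullet>c v)) \<cdot>\<^sub>v v) \<bullet>c v = 0" if u: "u \<in> carrier_vec (dim_vec v)" for u
  proof (cases "v \<bullet>c v = 0")
    case True
    then have "conjugate v = 0\<^sub>v (dim_vec v)"
      unfolding conjugate_square_eq_0_vec[OF v] by (metis conjugate_zero_vec)
    then have "u \<bullet>c v = 0" using scalar_prod_right_zero[OF u] by metis
    then show ?thesis unfolding cscalar_prod_minus_smult[OF u v] True by simp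
  next
    case False
    then show ?thesis unfolding cscalar_prod_minus_smult[OF u v] by (simp del: conjugate_square_eq_0_vec)
  qed
  then show ?thesis
    unfolding is_orth_projection_def
    by (intro conjI ballI exI) (simp_all only: rank_one_mult_vec mat_carrier)
qed

lemma is_orth_projection_orth_projection: "is_orth_projection v (orth_projection v)"
  unfolding orth_projection_def
  using theI[where P = "is_orth_projection v", OF is_orth_projection_rank_one]
    is_orth_projection_unique[OF _ is_orth_projection_rank_one] by blast

end

theory Submission
  imports Defs
begin

text \<open>
  On the Fourier side translation by \<open>t\<^sub>o\<close> becomes multiplication by an \<open>h\<close>-periodic exponential, so
  inner products with the translates of \<open>\<phi>\<^sub>j\<close> are the Fourier coefficients of an \<open>h\<close>-periodic function,
  and everything decouples into finite dimensional problems indexed by \<open>x \<in> [0, h)\<close>.  Let \<open>M(x)\<close> be the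
  number of points \<open>x + m h\<close> in \<open>[-\<omega>, \<omega>]\<close> and \<open>V(x)\<close> the \<open>M(x) \<times> N\<close> matrix of the values of the \<open>N = 2 l - 1\<close>
  transforms at these points.  On the fiber over \<open>x\<close> the frame operator is \<open>h V V\<^sup>*\<close>, and the frame
  inequalities say that it is bounded above and below, uniformly for almost every \<open>x\<close>.  Hence the
  dual generators have the fibers \<open>(h V V\<^sup>*)\<^sup>-\<^sup>1 V\<close>, and the mixed Gramian is
  \<open>G = V\<^sup>* (V V\<^sup>*)\<^sup>-\<^sup>1 V\<close>, the orthogonal projection onto the orthogonal complement of
  the kernel of \<open>V\<close>.

  The conditions on \<open>h\<close> make \<open>M(x) = N\<close> on \<open>K\<^sub>-\<close> and \<open>K\<^sub>+\<close>, so there \<open>V\<close> is invertible and \<open>G = 1\<close>, while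
  \<open>M(x) = N - 1\<close> on \<open>K\<close>, so there the kernel is a line.  The cross product of the rows of \<open>V\<close> lies in this
  line, and it is nonzero because the rows are independent.  The proof below does not compute \<open>G\<close> from
  the formula; it uses the two relations \<open>V G = V\<close> (the frame operator maps the dual generator to the
  generator) and \<open>W\<^sup>* G = 0\<close> for \<open>V W = 0\<close> (the columns of \<open>G\<close> are combinations of the columns of \<open>V\<^sup>*\<close>).
  The first determines \<open>G\<close> where \<open>V\<close> is invertible (\<open>one_mat_if_acts_trivially\<close>), both together do so
  where the kernel is a line (\<open>orth_projection_onto_corank_one_kernel\<close>).

  The analytic part is the Plancherel theory that justifies the passage to the fibers.  Parseval's
  identity for Fourier series (\<open>Fourier_series_Parseval\<close>) rests on the Stone-Weierstrass theorem.
  Integrated over the modulation parameter it yields Plancherel's identity for functions of bounded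
  support (\<open>Plancherel_bounded_support\<close>), and completeness of the space of square integrable functions
  extends the transform to all of them.  The inversion formulas identify \<open>bandlimited \<omega>\<close> with the square
  integrable functions vanishing off \<open>[-\<omega>, \<omega>]\<close> (\<open>bandlimited_eq_inv_fourier\<close>, \<open>fourier_inv_fourier\<close>).
  Parseval's identity also turns the frame inequalities into inequalities for almost every fiber
  (\<open>frame_of_translates_fibers\<close>, \<open>fiberwise_lower_bound\<close>) and identifies the frame operator with its
  fiberwise version (\<open>frame_operator_eq_inv_fourier\<close>).
\<close>

section \<open>Square integrable functions\<close>

lemma borel_measurable_cnj [measurable (raw)]:
  "f \<in> borel_measurable M \<Longrightarrow> (\<lambda>x. cnj (f x)) \<in> borel_measurable M"
  by (rule borel_measurable_continuous_on[where f = cnj]) (intro continuous_intros)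

definition sqnorm :: "(real \<Rightarrow> complex) \<Rightarrow> real" where
  "sqnorm f = (LINT x|lborel. (cmod (f x))\<^sup>2)"

lemma L2_norm_power2: "(L2_norm f)\<^sup>2 = sqnorm f"
  unfolding L2_norm_def sqnorm_def by (simp add: integral_nonneg_AE)

lemma sqnorm_nonneg [simp]: "0 \<le> sqnorm f"
  unfolding sqnorm_def by (simp add: integral_nonneg_AE)

lemma L2_space_measurable [measurable_dest]: "f \<in> L2_space \<Longrightarrow> f \<in> borel_measurable borel"
  by (simp add: L2_space_def)

lemma L2_space_integrable: "f \<in> L2_space \<Longrightarrow> integrable lborel (\<lambda>x. (cmod (f x))\<^sup>2)"
  by (simp add: L2_space_def)

lemma L2_spaceI:
  "f \<in> borel_measurable borel \<Longrightarrow> integrable lborel (\<lambda>x. (cmod (f x))\<^sup>2) \<Longrightarrow> f \<in> L2_space"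
  by (simp add: L2_space_def)

lemma L2_space_nn_integralI:
  assumes [measurable]: "f \<in> borel_measurable borel"
    and "(\<integral>\<^sup>+x. ennreal ((cmod (f x))\<^sup>2) \<partial>lborel) < \<infinity>"
  shows "f \<in> L2_space"
  by (rule L2_spaceI) (use assms in \<open>auto simp: integrable_iff_bounded\<close>)

lemma nn_integral_sqnorm:
  "f \<in> L2_space \<Longrightarrow> (\<integral>\<^sup>+x. ennreal ((cmod (f x))\<^sup>2) \<partial>lborel) = ennreal (sqnorm f)"
  unfolding sqnorm_def by (rule nn_integral_eq_integral) (auto simp: L2_space_def)

lemma sqnorm_cong_AE:
  assumes [measurable]: "f \<in> borel_measurable borel" "g \<in> borel_measurable borel"
    and "AE x in lborel. f x = g x"
  shows "sqnorm f = sqnorm g"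
  unfolding sqnorm_def by (rule integral_cong_AE) (use assms(3) in auto)

lemma L2_space_bounded_mult:
  assumes f: "f \<in> L2_space" and [measurable]: "b \<in> borel_measurable borel"
    and b: "\<And>x. cmod (b x) \<le> C"
  shows "(\<lambda>x. b x * f x) \<in> L2_space" and "sqnorm (\<lambda>x. b x * f x) \<le> C\<^sup>2 * sqnorm f"
proof -
  note [measurable] = L2_space_measurable[OF f]
  have le: "(cmod (b x * f x))\<^sup>2 \<le> C\<^sup>2 * (cmod (f x))\<^sup>2" for x
    by (simp add: norm_mult power_mult_distrib mult_right_mono power_mono b)
  have int: "integrable lborel (\<lambda>x. C\<^sup>2 * (cmod (f x))\<^sup>2)"
    using L2_space_integrable[OF f] by simp
  show *: "(\<lambda>x. b x * f x) \<in> L2_space"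
  proof (rule L2_spaceI)
    show "integrable lborel (\<lambda>x. (cmod (b x * f x))\<^sup>2)"
      by (rule Bochner_Integration.integrable_bound[OF int])
        (auto intro!: AE_I2 le order_trans[OF le])
  qed simp
  have "sqnorm (\<lambda>x. b x * f x) \<le> (LINT x|lborel. C\<^sup>2 * (cmod (f x))\<^sup>2)"
    unfolding sqnorm_def by (rule integral_mono[OF L2_space_integrable[OF *] int le])
  then show "sqnorm (\<lambda>x. b x * f x) \<le> C\<^sup>2 * sqnorm f"
    unfolding sqnorm_def by simp
qed

lemma L2_space_scale [intro]: "f \<in> L2_space \<Longrightarrow> (\<lambda>x. c * f x) \<in> L2_space"
  by (rule L2_space_bounded_mult(1)[where C = "cmod c"]) auto

lemma sqnorm_scale: "sqnorm (\<lambda>x. c * f x) = (cmod c)\<^sup>2 * sqnorm f"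
  unfolding sqnorm_def by (simp add: norm_mult power_mult_distrib)

lemma cmod_add_power2_le: "(cmod (a + b))\<^sup>2 \<le> 2 * (cmod a)\<^sup>2 + 2 * (cmod b)\<^sup>2"
proof -
  have "(cmod (a + b))\<^sup>2 \<le> (cmod a + cmod b)\<^sup>2"
    by (simp add: norm_triangle_ineq power_mono)
  also have "\<dots> \<le> 2 * (cmod a)\<^sup>2 + 2 * (cmod b)\<^sup>2"
    using sum_squares_bound[of "cmod a" "cmod b"] by (simp add: power2_sum)
  finally show ?thesis .
qed

lemma L2_space_add_sqnorm:
  assumes f: "f \<in> L2_space" and g: "g \<in> L2_space"
  shows "(\<lambda>x. f x + g x) \<in> L2_space"
    and "sqnorm (\<lambda>x. f x + g x) \<le> 2 * sqnorm f + 2 * sqnorm g"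
proof -
  note [measurable] = L2_space_measurable[OF f] L2_space_measurable[OF g]
  have int: "integrable lborel (\<lambda>x. 2 * (cmod (f x))\<^sup>2 + 2 * (cmod (g x))\<^sup>2)"
    using L2_space_integrable[OF f] L2_space_integrable[OF g] by simp
  show *: "(\<lambda>x. f x + g x) \<in> L2_space"
    by (rule L2_spaceI, simp, rule Bochner_Integration.integrable_bound[OF int])
      (auto intro!: AE_I2 cmod_add_power2_le order_trans[OF cmod_add_power2_le])
  show "sqnorm (\<lambda>x. f x + g x) \<le> 2 * sqnorm f + 2 * sqnorm g"
    using integral_mono[OF L2_space_integrable[OF *] int cmod_add_power2_le]
      L2_space_integrable[OF f] L2_space_integrable[OF g]
    unfolding sqnorm_def by simp
qed

lemmas L2_space_add [intro] = L2_space_add_sqnorm(1)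
lemmas sqnorm_add_le = L2_space_add_sqnorm(2)

lemma L2_space_diff [intro]:
  assumes "f \<in> L2_space" and "g \<in> L2_space"
  shows "(\<lambda>x. f x - g x) \<in> L2_space"
  using L2_space_add[OF assms(1) L2_space_scale[OF assms(2), of "-1"]] by simp

lemma sqnorm_minus: "sqnorm (\<lambda>x. f x - g x) = sqnorm (\<lambda>x. g x - f x)"
  unfolding sqnorm_def by (simp add: norm_minus_commute)

lemma sqnorm_diff_triangle:
  assumes "f \<in> L2_space" and "g \<in> L2_space" and "k \<in> L2_space"
  shows "sqnorm (\<lambda>x. f x - k x) \<le> 2 * sqnorm (\<lambda>x. f x - g x) + 2 * sqnorm (\<lambda>x. g x - k x)"
  using sqnorm_add_le[OF L2_space_diff[OF assms(1,2)] L2_space_diff[OF assms(2,3)]] by simp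

lemma L2_space_zero [simp]: "(\<lambda>x. 0) \<in> L2_space"
  by (rule L2_spaceI) auto

lemma L2_space_sum [intro]:
  "(\<And>i. i \<in> A \<Longrightarrow> f i \<in> L2_space) \<Longrightarrow> (\<lambda>x. \<Sum>i\<in>A. f i x) \<in> L2_space"
  by (induction A rule: infinite_finite_induct) auto

lemma cmod_sum_power2_le:
  assumes "finite A"
  shows "(cmod (\<Sum>i\<in>A. z i))\<^sup>2 \<le> real (card A) * (\<Sum>i\<in>A. (cmod (z i))\<^sup>2)"
proof -
  have "(cmod (\<Sum>i\<in>A. z i))\<^sup>2 \<le> (\<Sum>i\<in>A. 1 * cmod (z i))\<^sup>2"
    by (simp add: norm_sum power_mono)
  also have "\<dots> \<le> (\<Sum>i\<in>A. 1\<^sup>2) * (\<Sum>i\<in>A. (cmod (z i))\<^sup>2)"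
    by (rule Cauchy_Schwarz_ineq_sum)
  finally show ?thesis by simp
qed

lemma sqnorm_sum_le:
  assumes "finite A" and "\<And>i. i \<in> A \<Longrightarrow> f i \<in> L2_space"
  shows "sqnorm (\<lambda>x. \<Sum>i\<in>A. f i x) \<le> real (card A) * (\<Sum>i\<in>A. sqnorm (f i))"
proof -
  have "sqnorm (\<lambda>x. \<Sum>i\<in>A. f i x) \<le>
      (LINT x|lborel. real (card A) * (\<Sum>i\<in>A. (cmod (f i x))\<^sup>2))"
    unfolding sqnorm_def
    using assms by (intro integral_mono cmod_sum_power2_le L2_space_integrable L2_space_sum)
      (auto intro!: L2_space_integrable)
  also have "\<dots> = real (card A) * (\<Sum>i\<in>A. sqnorm (f i))"
    unfolding sqnorm_def using assms
    by (subst Bochner_Integration.integral_mult_right_zero, subst Bochner_Integration.integral_sum)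
      (auto intro: L2_space_integrable)
  finally show ?thesis .
qed

lemma sqnorm_eq_0_imp_AE:
  assumes "f \<in> L2_space" and "sqnorm f = 0"
  shows "AE x in lborel. f x = 0"
  using integral_nonneg_eq_0_iff_AE[of lborel "\<lambda>x. (cmod (f x))\<^sup>2"] assms
  by (auto simp: sqnorm_def L2_space_integrable)

lemma sqnorm_diff_eq_0_imp_AE:
  assumes "f \<in> L2_space" and "g \<in> L2_space" and "sqnorm (\<lambda>x. f x - g x) = 0"
  shows "AE x in lborel. f x = g x"
  using sqnorm_eq_0_imp_AE[OF L2_space_diff[OF assms(1,2)] assms(3)] by auto

subsection \<open>The inner product\<close>

lemma L2_inner_integrable:
  assumes f: "f \<in> L2_space" and g: "g \<in> L2_space"
  shows "integrable lborel (\<lambda>x. f x * cnj (g x))"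
proof -
  note [measurable] = L2_space_measurable[OF f] L2_space_measurable[OF g]
  have int: "integrable lborel (\<lambda>x. (cmod (f x))\<^sup>2 + (cmod (g x))\<^sup>2)"
    using L2_space_integrable[OF f] L2_space_integrable[OF g] by simp
  have le: "norm (a * cnj b) \<le> norm ((cmod a)\<^sup>2 + (cmod b)\<^sup>2)" for a b
  proof -
    have "2 * (cmod a * cmod b) \<le> (cmod a)\<^sup>2 + (cmod b)\<^sup>2"
      using sum_squares_bound[of "cmod a" "cmod b"] by simp
    moreover have "0 \<le> cmod a * cmod b" by simp
    ultimately have "cmod a * cmod b \<le> (cmod a)\<^sup>2 + (cmod b)\<^sup>2" by linarith
    then show ?thesis by (simp add: norm_mult)
  qed
  show ?thesis
    by (rule Bochner_Integration.integrable_bound[OF int _ AE_I2[OF le]]) measurable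
qed

lemma L2_inner_cong_AE:
  assumes [measurable]: "f \<in> borel_measurable borel" "f' \<in> borel_measurable borel"
      "g \<in> borel_measurable borel" "g' \<in> borel_measurable borel"
    and "AE x in lborel. f x = f' x" and "AE x in lborel. g x = g' x"
  shows "L2_inner f g = L2_inner f' g'"
  unfolding L2_inner_def by (rule integral_cong_AE) (use assms(5,6) in auto)

lemma L2_inner_self: "L2_inner f f = complex_of_real (sqnorm f)"
  unfolding L2_inner_def sqnorm_def integral_complex_of_real[symmetric] complex_norm_square
  by (rule refl)

lemma L2_inner_commute: "L2_inner g f = cnj (L2_inner f g)"
  using Bochner_Integration.integral_cnj[of lborel "\<lambda>x. f x * cnj (g x)"]
  unfolding L2_inner_def by (simp add: mult.commute)

lemma L2_inner_diff_left:
  assumes "f \<in> L2_space" "g \<in> L2_space" "k \<in> L2_space"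
  shows "L2_inner (\<lambda>x. f x - g x) k = L2_inner f k - L2_inner g k"
  unfolding L2_inner_def using assms
  by (simp add: left_diff_distrib L2_inner_integrable)

lemma L2_inner_scale_left: "L2_inner (\<lambda>x. c * f x) g = c * L2_inner f g"
  unfolding L2_inner_def by (simp add: mult.assoc)

lemma L2_inner_diff_right:
  assumes "f \<in> L2_space" "g \<in> L2_space" "k \<in> L2_space"
  shows "L2_inner k (\<lambda>x. f x - g x) = L2_inner k f - L2_inner k g"
  unfolding L2_inner_commute[of k] L2_inner_diff_left[OF assms] by simp

lemma L2_inner_sum_left:
  assumes "\<And>i. i \<in> A \<Longrightarrow> f i \<in> L2_space" "k \<in> L2_space"
  shows "L2_inner (\<lambda>x. \<Sum>i\<in>A. f i x) k = (\<Sum>i\<in>A. L2_inner (f i) k)"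
  unfolding L2_inner_def using assms
  by (simp add: sum_distrib_right L2_inner_integrable)

lemma sqnorm_diff:
  assumes f: "f \<in> L2_space" and g: "g \<in> L2_space"
  shows "sqnorm (\<lambda>x. f x - g x) = sqnorm f - 2 * Re (L2_inner f g) + sqnorm g"
proof -
  have "complex_of_real (sqnorm (\<lambda>x. f x - g x)) =
      L2_inner f f - L2_inner f g - (L2_inner g f - L2_inner g g)"
    unfolding L2_inner_self[symmetric] using f g
    by (simp add: L2_inner_diff_left L2_inner_diff_right L2_space_diff algebra_simps)
  then have "Re (complex_of_real (sqnorm (\<lambda>x. f x - g x))) =
      Re (L2_inner f f - L2_inner f g - (L2_inner g f - L2_inner g g))" by simp
  then show ?thesis
    by (simp add: L2_inner_self L2_inner_commute[of g f])
qed

text \<open>The equality case of the Cauchy-Schwarz inequality for functions of equal norm.  It is the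
  device by which both inversion formulas of the Fourier transform are derived.\<close>

lemma L2_eq_if_inner_eq:
  assumes f: "f \<in> L2_space" and g: "g \<in> L2_space"
    and "L2_inner f g = complex_of_real (sqnorm g)" and "sqnorm f = sqnorm g"
  shows "AE x in lborel. f x = g x"
  by (rule sqnorm_diff_eq_0_imp_AE[OF f g]) (simp add: sqnorm_diff[OF f g] assms)

lemma L2_Cauchy_Schwarz:
  assumes f: "f \<in> L2_space" and g: "g \<in> L2_space"
  shows "(cmod (L2_inner f g))\<^sup>2 \<le> sqnorm f * sqnorm g"
proof -
  define z where "z = L2_inner f g"
  have *: "0 \<le> sqnorm f - 2 * (s * (cmod z)\<^sup>2) + (s * cmod z)\<^sup>2 * sqnorm g" for s :: real
  proof -
    have "0 \<le> sqnorm (\<lambda>x. f x - (complex_of_real s * z) * g x)" by simp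
    also have "\<dots> = sqnorm f - 2 * Re (L2_inner f (\<lambda>x. (complex_of_real s * z) * g x)) +
        (cmod (complex_of_real s * z))\<^sup>2 * sqnorm g"
      unfolding sqnorm_scale[symmetric] by (rule sqnorm_diff) (use f g in auto)
    also have "L2_inner f (\<lambda>x. (complex_of_real s * z) * g x) = cnj (complex_of_real s * z) * z"
      unfolding L2_inner_commute[of f "\<lambda>x. (complex_of_real s * z) * g x"] L2_inner_scale_left
      by (simp add: L2_inner_commute[of g f] z_def)
    also have "Re (cnj (complex_of_real s * z) * z) = s * (cmod z)\<^sup>2"
      by (simp add: cmod_power2) (simp add: power2_eq_square algebra_simps)
    finally show ?thesis by (simp add: norm_mult power_mult_distrib)
  qed
  show ?thesis
  proof (cases "sqnorm g = 0 \<or> z = 0")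
    case False
    then have g0: "sqnorm g > 0" using sqnorm_nonneg[of g] by linarith
    have "0 \<le> sqnorm f - (cmod z)\<^sup>2 / sqnorm g"
      using *[of "1 / sqnorm g"] g0 by (simp add: field_simps power2_eq_square)
    then show ?thesis using g0 by (simp add: z_def field_simps)
  next
    case True
    moreover have "z = 0" if g0: "sqnorm g = 0"
    proof (rule ccontr)
      assume "z \<noteq> 0"
      then have "0 < (cmod z)\<^sup>2" by simp
      then show False
        using *[of "(sqnorm f + 1) / (cmod z)\<^sup>2"] g0 sqnorm_nonneg[of f] by simp
    qed
    ultimately show ?thesis unfolding z_def[symmetric] by auto
  qed
qed

text \<open>For square integrable functions the extended integral in \<open>L2_tendsto\<close> is finite, so that
  convergence can be studied with real-valued estimates.\<close>

lemma L2_tendsto_iff_sqnorm: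
  assumes u: "\<forall>\<^sub>F i in F. u i \<in> L2_space" and f: "f \<in> L2_space"
  shows "L2_tendsto u f F \<longleftrightarrow> ((\<lambda>i. sqnorm (\<lambda>x. u i x - f x)) \<longlongrightarrow> 0) F"
proof -
  have "L2_tendsto u f F \<longleftrightarrow> ((\<lambda>i. ennreal (sqnorm (\<lambda>x. u i x - f x))) \<longlongrightarrow> ennreal 0) F"
    unfolding L2_tendsto_def ennreal_0
    by (rule tendsto_cong, use u in eventually_elim) (simp add: f nn_integral_sqnorm L2_space_diff)
  also have "\<dots> \<longleftrightarrow> ((\<lambda>i. sqnorm (\<lambda>x. u i x - f x)) \<longlongrightarrow> 0) F"
    by (rule tendsto_ennreal_iff) auto
  finally show ?thesis .
qed

lemma L2_inner_tendsto:
  assumes u: "\<And>i. u i \<in> L2_space" "f \<in> L2_space"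
    and v: "\<And>i. v i \<in> L2_space" "g \<in> L2_space"
    and cu: "((\<lambda>i. sqnorm (\<lambda>x. u i x - f x)) \<longlongrightarrow> 0) F"
    and cv: "((\<lambda>i. sqnorm (\<lambda>x. v i x - g x)) \<longlongrightarrow> 0) F"
  shows "((\<lambda>i. L2_inner (u i) (v i)) \<longlongrightarrow> L2_inner f g) F"
proof -
  let ?a = "\<lambda>i. sqnorm (\<lambda>x. u i x - f x)" and ?b = "\<lambda>i. sqnorm (\<lambda>x. v i x - g x)"
  have le: "norm (L2_inner (u i) (v i) - L2_inner f g) \<le>
      sqrt (?a i * (2 * ?b i + 2 * sqnorm g)) + sqrt (sqnorm f * ?b i)" for i
  proof -
    have "L2_inner (u i) (v i) - L2_inner f g =
        L2_inner (\<lambda>x. u i x - f x) (v i) + L2_inner f (\<lambda>x. v i x - g x)"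
      using u v by (simp add: L2_inner_diff_left L2_inner_diff_right)
    moreover have "cmod (L2_inner (\<lambda>x. u i x - f x) (v i)) \<le> sqrt (?a i * (2 * ?b i + 2 * sqnorm g))"
    proof (rule real_le_rsqrt)
      have "sqnorm (v i) \<le> 2 * ?b i + 2 * sqnorm g"
        using sqnorm_add_le[OF L2_space_diff[OF v] v(2)] by simp
      then show "(cmod (L2_inner (\<lambda>x. u i x - f x) (v i)))\<^sup>2 \<le> ?a i * (2 * ?b i + 2 * sqnorm g)"
        using L2_Cauchy_Schwarz[OF L2_space_diff[OF u] v(1)]
        by (meson mult_left_mono order_trans sqnorm_nonneg)
    qed
    moreover have "cmod (L2_inner f (\<lambda>x. v i x - g x)) \<le> sqrt (sqnorm f * ?b i)"
      by (rule real_le_rsqrt) (rule L2_Cauchy_Schwarz[OF u(2) L2_space_diff[OF v]])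
    ultimately show ?thesis
      by (metis (no_types, lifting) add_mono norm_triangle_le)
  qed
  have "((\<lambda>i. sqrt (?a i * (2 * ?b i + 2 * sqnorm g)) + sqrt (sqnorm f * ?b i)) \<longlongrightarrow>
      sqrt (0 * (2 * 0 + 2 * sqnorm g)) + sqrt (sqnorm f * 0)) F"
    by (intro tendsto_intros cu cv)
  then have lim: "((\<lambda>i. sqrt (?a i * (2 * ?b i + 2 * sqnorm g)) + sqrt (sqnorm f * ?b i)) \<longlongrightarrow> 0) F"
    by simp
  have "((\<lambda>i. L2_inner (u i) (v i) - L2_inner f g) \<longlongrightarrow> 0) F"
    by (rule Lim_null_comparison[OF _ lim]) (simp add: le)
  then show ?thesis by (simp add: LIM_zero_iff)
qed

lemma sqnorm_tendsto:
  assumes "\<And>i. u i \<in> L2_space" "f \<in> L2_space"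
    and "((\<lambda>i. sqnorm (\<lambda>x. u i x - f x)) \<longlongrightarrow> 0) F"
  shows "((\<lambda>i. sqnorm (u i)) \<longlongrightarrow> sqnorm f) F"
  using tendsto_Re[OF L2_inner_tendsto[OF assms(1,2,1,2) assms(3,3)]]
  by (simp add: L2_inner_self)

lemma L2_limit_unique:
  assumes u: "\<forall>\<^sub>F i in F. u i \<in> L2_space" and f: "f \<in> L2_space" and g: "g \<in> L2_space"
    and F: "F \<noteq> bot" and cf: "L2_tendsto u f F" and cg: "L2_tendsto u g F"
  shows "AE x in lborel. f x = g x"
proof (rule sqnorm_diff_eq_0_imp_AE[OF f g])
  have "((\<lambda>i. 2 * sqnorm (\<lambda>x. u i x - f x) + 2 * sqnorm (\<lambda>x. u i x - g x)) \<longlongrightarrow> 2 * 0 + 2 * 0) F"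
    using cf cg unfolding L2_tendsto_iff_sqnorm[OF u f] L2_tendsto_iff_sqnorm[OF u g]
    by (intro tendsto_intros)
  moreover have "\<forall>\<^sub>F i in F. sqnorm (\<lambda>x. f x - g x) \<le>
      2 * sqnorm (\<lambda>x. u i x - f x) + 2 * sqnorm (\<lambda>x. u i x - g x)"
    using u
  proof eventually_elim
    case (elim i)
    then show ?case using sqnorm_diff_triangle[OF f elim g] by (simp add: sqnorm_minus[of f])
  qed
  ultimately have "sqnorm (\<lambda>x. f x - g x) \<le> 2 * 0 + 2 * 0"
    using tendsto_le[OF F _ tendsto_const] by blast
  then show "sqnorm (\<lambda>x. f x - g x) = 0" using sqnorm_nonneg[of "\<lambda>x. f x - g x"] by linarith
qed

subsection \<open>Completeness\<close>

text \<open>Weighted by \<open>2 ^ n\<close> the integrals of the squared increments still have a finite sum, so at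
  almost every point the increments are dominated by a geometric sequence.\<close>

lemma fast_Cauchy_AE_convergent:
  fixes u :: "nat \<Rightarrow> real \<Rightarrow> complex"
  assumes u: "\<And>n. u n \<in> L2_space"
    and fast: "\<And>n. sqnorm (\<lambda>x. u (Suc n) x - u n x) \<le> (1/4) ^ n"
  shows "AE x in lborel. convergent (\<lambda>n. u n x)"
proof -
  note [measurable] = L2_space_measurable[OF u]
  let ?w = "\<lambda>n x. 2 ^ n * (cmod (u (Suc n) x - u n x))\<^sup>2"
  have "(\<integral>\<^sup>+x. (\<Sum>n. ennreal (?w n x)) \<partial>lborel) = (\<Sum>n. \<integral>\<^sup>+x. ennreal (?w n x) \<partial>lborel)"
    by (rule nn_integral_suminf) simp
  also have "\<dots> \<le> (\<Sum>n. ennreal ((1/2) ^ n))"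
  proof (intro suminf_le summableI)
    fix n
    have "(\<integral>\<^sup>+x. ennreal (?w n x) \<partial>lborel) =
        ennreal (2 ^ n) * (\<integral>\<^sup>+x. ennreal ((cmod (u (Suc n) x - u n x))\<^sup>2) \<partial>lborel)"
      by (subst nn_integral_cmult[symmetric]) (auto simp: ennreal_mult)
    also have "\<dots> = ennreal (2 ^ n * sqnorm (\<lambda>x. u (Suc n) x - u n x))"
      using u by (simp add: nn_integral_sqnorm L2_space_diff ennreal_mult)
    also have "\<dots> \<le> ennreal (2 ^ n * (1/4) ^ n)"
      by (intro ennreal_leI mult_left_mono fast) simp
    also have "2 ^ n * (1/4) ^ n = (1/2 :: real) ^ n"
      by (simp add: power_mult_distrib[symmetric])
    finally show "(\<integral>\<^sup>+x. ennreal (?w n x) \<partial>lborel) \<le> ennreal ((1/2) ^ n)" .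
  qed
  also have "\<dots> < \<infinity>"
    using geometric_sums[of "1/2 :: real"] by (subst suminf_ennreal_eq[of _ 2]) auto
  finally have "AE x in lborel. (\<Sum>n. ennreal (?w n x)) \<noteq> \<infinity>"
    by (intro nn_integral_PInf_AE) auto
  then show ?thesis
  proof (rule AE_mp, intro AE_I2 impI)
    fix x assume "(\<Sum>n. ennreal (?w n x)) \<noteq> \<infinity>"
    then have "summable (\<lambda>n. ?w n x)"
      by (intro summable_suminf_not_top) auto
    then have "?w n x \<le> suminf (\<lambda>n. ?w n x)" for n
      using sum_le_suminf[of "\<lambda>n. ?w n x" "{n}"] by simp
    then have b: "(cmod (u (Suc n) x - u n x))\<^sup>2 \<le> suminf (\<lambda>n. ?w n x) * (1/2) ^ n" for n
      by (simp add: field_simps)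
    let ?C = "sqrt (suminf (\<lambda>n. ?w n x))"
    have "norm (u (Suc n) x - u n x) \<le> ?C * (sqrt (1/2)) ^ n" for n
      using real_le_rsqrt[OF b[of n]] by (simp add: real_sqrt_mult real_sqrt_power)
    moreover have "summable (\<lambda>n. ?C * (sqrt (1/2)) ^ n)"
      by (intro summable_mult summable_geometric) simp
    ultimately have "summable (\<lambda>n. u (Suc n) x - u n x)"
      by (rule summable_comparison_test'[rotated])
    then have "convergent (\<lambda>n. u n x - u 0 x)"
      by (simp add: summable_iff_convergent sum_lessThan_telescope[of "\<lambda>n. u n x"])
    then obtain z where "(\<lambda>n. u n x - u 0 x) \<longlonglongrightarrow> z"
      unfolding convergent_def by blast
    then have "(\<lambda>n. u n x - u 0 x + u 0 x) \<longlonglongrightarrow> z + u 0 x"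
      by (intro tendsto_intros)
    then show "convergent (\<lambda>n. u n x)"
      by (auto intro: convergentI)
  qed
qed

text \<open>The limit is found pointwise along a rapidly converging subsequence.\<close>

theorem L2_complete:
  fixes u :: "nat \<Rightarrow> real \<Rightarrow> complex"
  assumes u: "\<And>n. u n \<in> L2_space"
    and cauchy: "\<And>e. e > 0 \<Longrightarrow> \<exists>N. \<forall>m\<ge>N. \<forall>n\<ge>N. sqnorm (\<lambda>x. u m x - u n x) < e"
  obtains g where "g \<in> L2_space" and "(\<lambda>n. sqnorm (\<lambda>x. u n x - g x)) \<longlonglongrightarrow> 0"
proof -
  note [measurable] = L2_space_measurable[OF u]
  have "\<exists>N. \<forall>k. \<forall>m\<ge>N k. \<forall>n\<ge>N k. sqnorm (\<lambda>x. u m x - u n x) < (1/4) ^ k"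
    using cauchy by (intro choice allI) simp
  then obtain N where N: "\<And>k m n. m \<ge> N k \<Longrightarrow> n \<ge> N k \<Longrightarrow> sqnorm (\<lambda>x. u m x - u n x) < (1/4) ^ k"
    by blast
  define r where "r k = (\<Sum>i\<le>k. N i) + k" for k
  have rN: "N k \<le> r k" for k unfolding r_def by (simp add: trans_le_add1 member_le_sum)
  have rS: "r k \<le> r (Suc k)" for k unfolding r_def by simp
  have rk: "k \<le> r k" for k unfolding r_def by simp
  define v where "v k = u (r k)" for k
  have v: "v k \<in> L2_space" for k unfolding v_def by (rule u)
  note [measurable] = L2_space_measurable[OF v]
  have conv: "AE x in lborel. convergent (\<lambda>n. v n x)"
    by (rule fast_Cauchy_AE_convergent[OF v])
      (metis N le_less order_trans rN rS v_def)
  define g where "g x = lim (\<lambda>n. v n x)" for x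
  have gm [measurable]: "g \<in> borel_measurable borel"
    unfolding g_def by (rule borel_measurable_lim_metric) measurable
  have lim: "AE x in lborel. (\<lambda>n. v n x) \<longlonglongrightarrow> g x"
    using conv by eventually_elim (simp add: g_def convergent_LIMSEQ_iff)
  \<comment> \<open>Fatou's lemma turns the Cauchy condition into a bound on the distance to the pointwise limit.\<close>
  have fatou: "(\<integral>\<^sup>+x. ennreal ((cmod (u m x - g x))\<^sup>2) \<partial>lborel) \<le> ennreal e"
    if *: "\<And>n. n \<ge> K \<Longrightarrow> sqnorm (\<lambda>x. u m x - u n x) \<le> e" for m K e
  proof -
    have "(\<integral>\<^sup>+x. ennreal ((cmod (u m x - g x))\<^sup>2) \<partial>lborel) =
        (\<integral>\<^sup>+x. liminf (\<lambda>n. ennreal ((cmod (u m x - v n x))\<^sup>2)) \<partial>lborel)"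
    proof (rule nn_integral_cong_AE, use lim in eventually_elim)
      fix x assume "(\<lambda>n. v n x) \<longlonglongrightarrow> g x"
      then have "(\<lambda>n. ennreal ((cmod (u m x - v n x))\<^sup>2)) \<longlonglongrightarrow> ennreal ((cmod (u m x - g x))\<^sup>2)"
        by (intro tendsto_intros)
      then show "ennreal ((cmod (u m x - g x))\<^sup>2) = liminf (\<lambda>n. ennreal ((cmod (u m x - v n x))\<^sup>2))"
        using lim_imp_Liminf[OF sequentially_bot] by metis
    qed
    also have "\<dots> \<le> liminf (\<lambda>n. \<integral>\<^sup>+x. ennreal ((cmod (u m x - v n x))\<^sup>2) \<partial>lborel)"
      by (rule nn_integral_liminf) simp
    also have "\<dots> \<le> ennreal e"
    proof (rule Liminf_le[OF sequentially_bot], rule eventually_sequentiallyI[of K])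
      fix n assume "K \<le> n"
      then have "K \<le> r n" using rk[of n] by linarith
      then show "(\<integral>\<^sup>+x. ennreal ((cmod (u m x - v n x))\<^sup>2) \<partial>lborel) \<le> ennreal e"
        using *[of "r n"] u unfolding v_def by (simp add: nn_integral_sqnorm L2_space_diff ennreal_leI)
    qed
    finally show ?thesis .
  qed
  have "(\<integral>\<^sup>+x. ennreal ((cmod (u (N 0) x - g x))\<^sup>2) \<partial>lborel) \<le> ennreal 1"
    by (rule fatou[of "N 0"]) (use N[of 0 "N 0"] in \<open>auto intro: less_imp_le\<close>)
  then have "(\<lambda>x. u (N 0) x - g x) \<in> L2_space"
    by (intro L2_space_nn_integralI) (auto intro: le_less_trans)
  then have g: "g \<in> L2_space"
    using L2_space_diff[OF u[of "N 0"]] by fastforce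
  show ?thesis
  proof (rule that[OF g])
    show "(\<lambda>n. sqnorm (\<lambda>x. u n x - g x)) \<longlonglongrightarrow> 0"
    proof (rule LIMSEQ_I)
      fix e :: real assume e: "0 < e"
      obtain K where K: "\<And>m n. m \<ge> K \<Longrightarrow> n \<ge> K \<Longrightarrow> sqnorm (\<lambda>x. u m x - u n x) < e / 2"
        using cauchy[of "e / 2"] e by auto
      have "sqnorm (\<lambda>x. u m x - g x) < e" if "m \<ge> K" for m
      proof -
        have "(\<integral>\<^sup>+x. ennreal ((cmod (u m x - g x))\<^sup>2) \<partial>lborel) \<le> ennreal (e / 2)"
          by (rule fatou[of K]) (use K that in \<open>auto intro: less_imp_le\<close>)
        then show ?thesis
          using u g e by (simp add: nn_integral_sqnorm L2_space_diff ennreal_le_iff)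
      qed
      then show "\<exists>no. \<forall>n\<ge>no. norm (sqnorm (\<lambda>x. u n x - g x) - 0) < e" by auto
    qed
  qed
qed

section \<open>Fourier series of square integrable functions\<close>

subsection \<open>Expansion in an orthogonal family\<close>

lemma L2_inner_sum_right:
  assumes "\<And>i. i \<in> A \<Longrightarrow> f i \<in> L2_space" "k \<in> L2_space"
  shows "L2_inner k (\<lambda>x. \<Sum>i\<in>A. b i * f i x) = (\<Sum>i\<in>A. cnj (b i) * L2_inner k (f i))"
  unfolding L2_inner_commute[of k "\<lambda>x. \<Sum>i\<in>A. b i * f i x"]
  using assms by (subst L2_inner_sum_left)
    (auto simp: L2_inner_scale_left L2_inner_commute[of k] intro!: sum.cong)

lemma sqnorm_diff_orthogonal_sum:
  assumes E: "\<And>i. E i \<in> L2_space"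
    and orth: "\<And>i j. L2_inner (E i) (E j) = (if i = j then complex_of_real L else 0)"
    and L: "L > 0" and F: "F \<in> L2_space" and A: "finite A"
  shows "sqnorm (\<lambda>x. F x - (\<Sum>i\<in>A. b i * E i x)) =
    sqnorm F - (\<Sum>i\<in>A. (cmod (L2_inner F (E i)))\<^sup>2) / L
      + L * (\<Sum>i\<in>A. (cmod (b i - L2_inner F (E i) / complex_of_real L))\<^sup>2)"
proof -
  define c where "c i = L2_inner F (E i)" for i
  have S: "(\<lambda>x. \<Sum>i\<in>A. b i * E i x) \<in> L2_space"
    by (intro L2_space_sum L2_space_scale E)
  have 1: "L2_inner F (\<lambda>x. \<Sum>i\<in>A. b i * E i x) = (\<Sum>i\<in>A. cnj (b i) * c i)"
    unfolding c_def by (rule L2_inner_sum_right) (use E F in auto)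
  have "complex_of_real (sqnorm (\<lambda>x. \<Sum>i\<in>A. b i * E i x)) =
      (\<Sum>i\<in>A. \<Sum>j\<in>A. cnj (b i) * (b j * L2_inner (E j) (E i)))"
    unfolding L2_inner_self[symmetric] using E S
    by (subst L2_inner_sum_right) (auto simp: L2_inner_sum_left L2_inner_scale_left L2_space_scale sum_distrib_left)
  also have "\<dots> = (\<Sum>i\<in>A. cnj (b i) * (b i * complex_of_real L))"
  proof (rule sum.cong[OF refl])
    fix i assume "i \<in> A"
    have "(\<Sum>j\<in>A. cnj (b i) * (b j * L2_inner (E j) (E i))) =
        (\<Sum>j\<in>A. if j = i then cnj (b i) * (b i * complex_of_real L) else 0)"
      by (rule sum.cong) (auto simp: orth)
    then show "(\<Sum>j\<in>A. cnj (b i) * (b j * L2_inner (E j) (E i))) = cnj (b i) * (b i * complex_of_real L)"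
      using A \<open>i \<in> A\<close> by simp
  qed
  also have "\<dots> = complex_of_real (L * (\<Sum>i\<in>A. (cmod (b i))\<^sup>2))"
    by (simp add: sum_distrib_left complex_norm_square mult_ac del: of_real_power)
  finally have 2: "sqnorm (\<lambda>x. \<Sum>i\<in>A. b i * E i x) = L * (\<Sum>i\<in>A. (cmod (b i))\<^sup>2)"
    using of_real_eq_iff by blast
  have 3: "- 2 * Re (cnj z * w) + L * (cmod z)\<^sup>2 =
      - ((cmod w)\<^sup>2 / L) + L * (cmod (z - w / complex_of_real L))\<^sup>2" for z w
    using L by (simp add: cmod_power2) (simp add: power2_eq_square field_simps)
  have "sqnorm (\<lambda>x. F x - (\<Sum>i\<in>A. b i * E i x)) =
      sqnorm F + (\<Sum>i\<in>A. - 2 * Re (cnj (b i) * c i) + L * (cmod (b i))\<^sup>2)"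
    unfolding sqnorm_diff[OF F S] 1 2 by (simp add: sum.distrib sum_distrib_left sum_negf sum_subtractf)
  also have "\<dots> = sqnorm F - (\<Sum>i\<in>A. (cmod (c i))\<^sup>2) / L
      + L * (\<Sum>i\<in>A. (cmod (b i - c i / complex_of_real L))\<^sup>2)"
    unfolding 3 by (simp add: sum.distrib sum_distrib_left sum_negf sum_subtractf sum_divide_distrib)
  finally show ?thesis unfolding c_def .
qed

text \<open>Among all combinations over a finite index set the one with the coefficients
  \<open>\<langle>F, E\<^sub>i\<rangle> / L\<close> is closest to \<open>F\<close>, and enlarging the index set brings it closer.  Hence density of
  the span already gives unconditional convergence and Parseval's identity.\<close>

lemma orthogonal_expansion:
  fixes E :: "'i \<Rightarrow> real \<Rightarrow> complex"
  assumes E: "\<And>i. E i \<in> L2_space"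
    and orth: "\<And>i j. L2_inner (E i) (E j) = (if i = j then complex_of_real L else 0)"
    and L: "L > 0" and F: "F \<in> L2_space"
    and dense: "\<And>e. e > 0 \<Longrightarrow> \<exists>A b. finite A \<and> sqnorm (\<lambda>x. F x - (\<Sum>i\<in>A. b i * E i x)) < e"
  shows "((\<lambda>A. sqnorm (\<lambda>x. F x - (\<Sum>i\<in>A. L2_inner F (E i) / complex_of_real L * E i x))) \<longlongrightarrow> 0)
      (finite_subsets_at_top UNIV)" (is "?conv")
    and "((\<lambda>i. (cmod (L2_inner F (E i)))\<^sup>2) has_sum (L * sqnorm F)) UNIV"
proof -
  let ?d = "\<lambda>A. sqnorm F - (\<Sum>i\<in>A. (cmod (L2_inner F (E i)))\<^sup>2) / L"
  note expand = sqnorm_diff_orthogonal_sum[OF E orth L F]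
  have d: "sqnorm (\<lambda>x. F x - (\<Sum>i\<in>A. L2_inner F (E i) / complex_of_real L * E i x)) = ?d A"
    if "finite A" for A
    unfolding expand[OF that] by simp
  have lim: "(?d \<longlongrightarrow> 0) (finite_subsets_at_top UNIV)"
  proof (rule tendstoI)
    fix e :: real assume "e > 0"
    then obtain A b where A: "finite A" and less: "sqnorm (\<lambda>x. F x - (\<Sum>i\<in>A. b i * E i x)) < e"
      using dense by blast
    have "dist (?d B) 0 < e" if B: "finite B" "A \<subseteq> B" for B
    proof -
      have "?d B \<le> ?d A"
        using L B by (intro diff_left_mono divide_right_mono sum_mono2) auto
      also have "\<dots> \<le> sqnorm (\<lambda>x. F x - (\<Sum>i\<in>A. b i * E i x))"
        unfolding expand[OF A] using L by (simp add: sum_nonneg)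
      finally have "?d B < e" using less by linarith
      moreover have "0 \<le> ?d B" unfolding d[OF B(1), symmetric] by simp
      ultimately show ?thesis by simp
    qed
    then show "\<forall>\<^sub>F B in finite_subsets_at_top UNIV. dist (?d B) 0 < e"
      unfolding eventually_finite_subsets_at_top using A by blast
  qed
  show ?conv
    using lim by (rule Lim_transform_eventually)
      (rule eventually_finite_subsets_at_top_weakI, rule d[symmetric])
  have "((\<lambda>A. L * sqnorm F - L * ?d A) \<longlongrightarrow> L * sqnorm F - L * 0) (finite_subsets_at_top UNIV)"
    by (intro tendsto_intros lim)
  moreover have "L * sqnorm F - L * ?d A = (\<Sum>i\<in>A. (cmod (L2_inner F (E i)))\<^sup>2)" for A
    using L by (simp add: field_simps)
  ultimately show "((\<lambda>i. (cmod (L2_inner F (E i)))\<^sup>2) has_sum (L * sqnorm F)) UNIV"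
    unfolding has_sum_def by simp
qed

subsection \<open>Trigonometric polynomials\<close>

inductive trig_poly :: "(real \<Rightarrow> complex) \<Rightarrow> bool" where
  monomial: "trig_poly (\<lambda>s. z * cis (2 * pi * of_int n * s))"
| add: "trig_poly f \<Longrightarrow> trig_poly g \<Longrightarrow> trig_poly (\<lambda>s. f s + g s)"

lemma trig_poly_mult:
  assumes "trig_poly f" and "trig_poly g"
  shows "trig_poly (\<lambda>s. f s * g s)"
proof -
  have "trig_poly (\<lambda>s. z * cis (2 * pi * of_int n * s) * g s)" for z n
    using assms(2)
  proof (induction rule: trig_poly.induct)
    case (monomial w m)
    have "(\<lambda>s. z * cis (2 * pi * of_int n * s) * (w * cis (2 * pi * of_int m * s))) =
        (\<lambda>s. (z * w) * cis (2 * pi * of_int (n + m) * s))"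
      by (simp add: fun_eq_iff cis_mult[symmetric] algebra_simps)
    then show ?case by (simp only: trig_poly.monomial)
  next
    case (add f g)
    then show ?case using trig_poly.add[OF add.IH] by (simp add: distrib_left)
  qed
  with assms(1) show ?thesis
    by (induction rule: trig_poly.induct) (auto simp: distrib_right intro: trig_poly.add)
qed

lemma trig_poly_const: "trig_poly (\<lambda>s. z)"
  using trig_poly.monomial[of z 0] by simp

lemma trig_poly_real_polynomial_on_circle:
  "real_polynomial_function p \<Longrightarrow> trig_poly (\<lambda>s. complex_of_real (p (cis (2 * pi * s))))"
proof (induction rule: real_polynomial_function.induct)
  case (linear f)
  interpret bounded_linear f by fact
  have "complex_of_real (f (cis (2 * pi * s))) =
      (complex_of_real (f 1) - \<i> * complex_of_real (f \<i>)) / 2 * cis (2 * pi * of_int 1 * s) +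
      (complex_of_real (f 1) + \<i> * complex_of_real (f \<i>)) / 2 * cis (2 * pi * of_int (- 1) * s)" for s
  proof -
    have "cis (2 * pi * s) = cos (2 * pi * s) *\<^sub>R 1 + sin (2 * pi * s) *\<^sub>R \<i>"
      by (simp add: complex_eq_iff)
    then have "f (cis (2 * pi * s)) = cos (2 * pi * s) * f 1 + sin (2 * pi * s) * f \<i>"
      by (simp only: add scale) simp
    then show ?thesis by (simp add: complex_eq_iff field_simps)
  qed
  then show ?case
    using trig_poly.add[OF trig_poly.monomial trig_poly.monomial] by presburger
qed (auto intro: trig_poly.add trig_poly_mult trig_poly_const)

lemma trig_poly_imp_sum:
  "trig_poly f \<Longrightarrow> \<exists>A c. finite A \<and> (\<forall>s. f s = (\<Sum>n\<in>A. c n * cis (2 * pi * of_int n * s)))"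
proof (induction rule: trig_poly.induct)
  case (monomial z n)
  show ?case by (rule exI[of _ "{n}"], rule exI[of _ "\<lambda>_. z"]) simp
next
  case (add f g)
  then obtain A c B d where A: "finite A" "\<And>s. f s = (\<Sum>n\<in>A. c n * cis (2 * pi * of_int n * s))"
    and B: "finite B" "\<And>s. g s = (\<Sum>n\<in>B. d n * cis (2 * pi * of_int n * s))" by blast
  let ?e = "\<lambda>n. (if n \<in> A then c n else 0) + (if n \<in> B then d n else 0)"
  have "f s + g s = (\<Sum>n\<in>A \<union> B. ?e n * cis (2 * pi * of_int n * s))" for s
  proof -
    have "f s = (\<Sum>n\<in>A \<union> B. (if n \<in> A then c n else 0) * cis (2 * pi * of_int n * s))"
      unfolding A using A B by (intro sum.mono_neutral_cong_left) auto
    moreover have "g s = (\<Sum>n\<in>A \<union> B. (if n \<in> B then d n else 0) * cis (2 * pi * of_int n * s))"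
      unfolding B using A B by (intro sum.mono_neutral_cong_left) auto
    ultimately show ?thesis by (simp add: distrib_right sum.distrib)
  qed
  then show ?case using A(1) B(1) by (intro exI[of _ "A \<union> B"] exI[of _ ?e]) auto
qed

text \<open>A loop is a continuous function on the unit circle, where the Stone-Weierstrass theorem
  applies; there polynomials in the real and imaginary part are trigonometric polynomials.\<close>

lemma trig_poly_approximates_loop:
  fixes g :: "real \<Rightarrow> complex"
  assumes g: "continuous_on {0..1} g" "g 0 = g 1" and e: "e > 0"
  shows "\<exists>p. trig_poly p \<and> (\<forall>s\<in>{0..1}. cmod (g s - p s) < e)"
proof -
  let ?G = "g \<circ> (\<lambda>z. Arg2pi z / (2 * pi))"
  have "homotopic_loops UNIV g g"
    using g by (simp add: homotopic_loops_refl path_def pathfinish_def pathstart_def)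
  from homotopic_with_imp_continuous[OF homotopic_loops_imp_homotopic_circlemaps[OF this]]
  have "continuous_on (sphere 0 1) ?G" by (rule conjunct1)
  from Stone_Weierstrass_polynomial_function[OF compact_sphere this e]
  obtain q where q: "polynomial_function q" "\<forall>z\<in>sphere 0 1. cmod (?G z - q z) < e"
    by (elim exE conjE)
  have G: "?G (cis (2 * pi * s)) = g s" if "s \<in> {0..1}" for s
  proof (cases "s = 1")
    case False
    then have "Arg2pi (cis (2 * pi * s)) = 2 * pi * s"
      using that by (intro Arg2pi_unique[of 1]) (auto simp: cis_conv_exp)
    then show ?thesis by simp
  next
    case True
    then show ?thesis using g(2) Arg2pi_of_real[of 1] by simp
  qed
  have "real_polynomial_function (\<lambda>z. Re (q z))" "real_polynomial_function (\<lambda>z. Im (q z))"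
    using q(1) bounded_linear_Re bounded_linear_Im unfolding polynomial_function_def o_def by blast+
  then have "trig_poly (\<lambda>s. complex_of_real (Re (q (cis (2 * pi * s)))) +
      \<i> * complex_of_real (Im (q (cis (2 * pi * s)))))"
    by (intro trig_poly.add trig_poly_mult trig_poly_const trig_poly_real_polynomial_on_circle)
  then have "trig_poly (\<lambda>s. q (cis (2 * pi * s)))"
    by (simp add: complex_eq[symmetric])
  moreover have "cmod (g s - q (cis (2 * pi * s))) < e" if "s \<in> {0..1}" for s
    using bspec[OF q(2), of "cis (2 * pi * s)"] G[OF that] by simp
  ultimately show ?thesis by blast
qed

subsection \<open>Density of the trigonometric polynomials\<close>

lemma borel_measurable_cis [measurable (raw)]:
  "f \<in> borel_measurable M \<Longrightarrow> (\<lambda>x. cis (f x)) \<in> borel_measurable M"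
  by (rule borel_measurable_continuous_on[where f = cis]) (intro continuous_intros)

lemma L2_space_bounded_support:
  assumes [measurable]: "f \<in> borel_measurable borel"
    and b: "\<And>x. cmod (f x) \<le> C" and supp: "\<And>x. x \<notin> {a..b} \<Longrightarrow> f x = 0"
  shows "f \<in> L2_space" and "sqnorm f \<le> C\<^sup>2 * max 0 (b - a)"
proof -
  have int: "integrable lborel (\<lambda>x. indicator {a..b} x * C\<^sup>2)"
    by (rule integrable_mult_left) (auto simp: emeasure_lborel_Icc_eq)
  have le: "(cmod (f x))\<^sup>2 \<le> indicator {a..b} x * C\<^sup>2" for x
    using b[of x] supp[of x] by (auto simp: indicator_def power_mono)
  show *: "f \<in> L2_space"
    by (rule L2_spaceI, simp, rule Bochner_Integration.integrable_bound[OF int])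
      (auto intro!: AE_I2 order_trans[OF le])
  have "sqnorm f \<le> (LINT x|lborel. indicator {a..b} x * C\<^sup>2)"
    unfolding sqnorm_def by (rule integral_mono[OF L2_space_integrable[OF *] int le])
  also have "\<dots> = C\<^sup>2 * max 0 (b - a)"
    by (simp add: max_def)
  finally show "sqnorm f \<le> C\<^sup>2 * max 0 (b - a)" .
qed

lemma sqnorm_tendsto_0_dominated:
  fixes u :: "nat \<Rightarrow> real \<Rightarrow> complex"
  assumes [measurable]: "\<And>n. u n \<in> borel_measurable borel" and w: "integrable lborel w"
    and "AE x in lborel. (\<lambda>n. u n x) \<longlonglongrightarrow> 0"
    and "\<And>n x. (cmod (u n x))\<^sup>2 \<le> w x"
  shows "(\<lambda>n. sqnorm (u n)) \<longlonglongrightarrow> 0"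
proof -
  have "(\<lambda>n. LINT x|lborel. (cmod (u n x))\<^sup>2) \<longlonglongrightarrow> (LINT x::real|lborel. (0::real))"
  proof (rule Bochner_Integration.integral_dominated_convergence[where w = w])
    show "AE x in lborel. (\<lambda>n. (cmod (u n x))\<^sup>2) \<longlonglongrightarrow> 0"
      using assms(3) by eventually_elim (auto intro!: tendsto_eq_intros)
  qed (use assms(4) w in auto)
  then show ?thesis by (simp add: sqnorm_def)
qed

lemma L2_approx_bounded:
  assumes f: "f \<in> L2_space" and e: "e > 0"
  shows "\<exists>C>0. sqnorm (\<lambda>x. f x - (if cmod (f x) \<le> C then f x else 0)) < e"
proof -
  note [measurable] = L2_space_measurable[OF f]
  have "(\<lambda>n. sqnorm (\<lambda>x. f x - (if cmod (f x) \<le> real n then f x else 0))) \<longlonglongrightarrow> 0"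
  proof (rule sqnorm_tendsto_0_dominated[OF _ L2_space_integrable[OF f]])
    have "\<forall>\<^sub>F n in sequentially. f x - (if cmod (f x) \<le> real n then f x else 0) = 0" for x
      using eventually_ge_at_top[of "nat \<lceil>cmod (f x)\<rceil>"] by eventually_elim (simp add: nat_le_iff ceiling_le_iff)
    then show "AE x in lborel. (\<lambda>n. f x - (if cmod (f x) \<le> real n then f x else 0)) \<longlonglongrightarrow> 0"
      by (intro AE_I2 tendsto_eventually)
  qed (auto simp del: of_nat_le_iff)
  then have "\<forall>\<^sub>F n in sequentially. sqnorm (\<lambda>x. f x - (if cmod (f x) \<le> real n then f x else 0)) < e"
    using e by (rule order_tendstoD(2))
  then have "\<forall>\<^sub>F n in sequentially. 0 < n \<and>
      sqnorm (\<lambda>x. f x - (if cmod (f x) \<le> real n then f x else 0)) < e"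
    using eventually_gt_at_top[of 0] by eventually_elim auto
  then obtain n where "0 < n" "sqnorm (\<lambda>x. f x - (if cmod (f x) \<le> real n then f x else 0)) < e"
    unfolding eventually_sequentially by blast
  then show ?thesis by (intro exI[of _ "real n"]) auto
qed

text \<open>A measurable function is an almost everywhere limit of continuous ones.  Radial projection
  to the disc of radius \<open>C\<close> and a cutoff at the end points of the interval keep the sequence
  dominated and make each member vanish at both end points.\<close>

lemma L2_approx_continuous_vanishing_at_ends:
  assumes f [measurable]: "f \<in> borel_measurable borel" and C: "C > 0" "\<And>x. cmod (f x) \<le> C"
    and supp: "\<And>x. x \<notin> {a..b} \<Longrightarrow> f x = 0" and e: "e > 0"
  shows "\<exists>u. continuous_on UNIV u \<and> (\<forall>x. x \<notin> {a<..<b} \<longrightarrow> u x = 0) \<and> sqnorm (\<lambda>x. f x - u x) < e"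
proof -
  have "f measurable_on UNIV"
    by (rule lebesgue_measurable_imp_measurable_on) (auto intro: measurable_completion)
  then obtain N g where N: "negligible N" and g: "\<And>n. continuous_on UNIV (g n)"
    and lim: "\<And>x. x \<notin> N \<Longrightarrow> (\<lambda>n. g n x) \<longlonglongrightarrow> f x"
    unfolding measurable_on_def by auto
  define r where "r z = complex_of_real (C / max C (cmod z)) * z" for z
  have r_cont: "continuous_on UNIV r"
    unfolding r_def using C by (intro continuous_intros) (auto simp: max_def)
  have r_id: "r z = z" if "cmod z \<le> C" for z
    using that C by (simp add: r_def max_def)
  have r_bound: "cmod (r z) \<le> C" for z
  proof -
    have "cmod (r z) = C * (cmod z / max C (cmod z))"
      unfolding r_def norm_mult norm_of_real using C by (simp add: max_def)
    also have "\<dots> \<le> C * 1"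
      using C by (intro mult_left_mono) (auto simp: max_def)
    finally show ?thesis by simp
  qed
  define \<chi> :: "nat \<Rightarrow> real \<Rightarrow> real"
    where "\<chi> n x = max 0 (min 1 (real n * min (x - a) (b - x)))" for n x
  have \<chi>01: "0 \<le> \<chi> n x" "\<chi> n x \<le> 1" for n x unfolding \<chi>_def by auto
  have \<chi>0: "\<chi> n x = 0" if "x \<notin> {a<..<b}" for n x
  proof -
    have "real n * min (x - a) (b - x) \<le> 0"
      using that by (intro mult_nonneg_nonpos) (auto simp: min_def)
    then show ?thesis unfolding \<chi>_def by simp
  qed
  define u where "u n x = complex_of_real (\<chi> n x) * r (g n x)" for n x
  have u_cont: "continuous_on UNIV (u n)" for n
  proof -
    have "continuous_on UNIV (\<lambda>x. r (g n x))"
      using continuous_on_compose2[OF r_cont g] by auto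
    then show ?thesis unfolding u_def \<chi>_def by (intro continuous_intros)
  qed
  then have [measurable]: "u n \<in> borel_measurable borel" for n
    by (rule borel_measurable_continuous_onI)
  have u_bound: "cmod (u n x) \<le> C" for n x
  proof -
    have "cmod (u n x) = \<chi> n x * cmod (r (g n x))"
      unfolding u_def norm_mult norm_of_real using \<chi>01 by simp
    also have "\<dots> \<le> 1 * C" using \<chi>01 r_bound by (intro mult_mono) auto
    finally show ?thesis by simp
  qed
  have u0: "u n x = 0" if "x \<notin> {a<..<b}" for n x
    unfolding u_def using \<chi>0[OF that] by simp
  have pointwise: "(\<lambda>n. f x - u n x) \<longlonglongrightarrow> 0" if x: "x \<notin> N" "x \<noteq> a" "x \<noteq> b" for x
  proof (cases "x \<in> {a<..<b}")
    case True
    have "filterlim (\<lambda>n. real n * min (x - a) (b - x)) at_top sequentially"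
      using True by (intro filterlim_at_top_mult_tendsto_pos[OF tendsto_const _ filterlim_real_sequentially]) auto
    then have "\<forall>\<^sub>F n in sequentially. 1 \<le> real n * min (x - a) (b - x)"
      unfolding filterlim_at_top by blast
    then have "\<forall>\<^sub>F n in sequentially. \<chi> n x = 1"
      by eventually_elim (simp add: \<chi>_def)
    then have "(\<lambda>n. \<chi> n x) \<longlonglongrightarrow> 1" by (rule tendsto_eventually)
    moreover have "(\<lambda>n. r (g n x)) \<longlonglongrightarrow> r (f x)"
      using continuous_on_tendsto_compose[OF r_cont lim[OF x(1)]] by simp
    ultimately have "(\<lambda>n. f x - u n x) \<longlonglongrightarrow> f x - complex_of_real 1 * r (f x)"
      unfolding u_def by (intro tendsto_intros)
    then show ?thesis using r_id[OF C(2)] by simp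
  next
    case False
    then have "x \<notin> {a..b}" using x by auto
    then show ?thesis using u0[OF False] supp by simp
  qed
  have "AE x in lebesgue. x \<notin> N"
    using N by (simp add: AE_not_in negligible_iff_null_sets)
  then have "AE x in lborel. x \<notin> N"
    by (simp add: AE_completion_iff)
  moreover have "AE x in lborel. x \<noteq> a" "AE x in lborel. x \<noteq> b"
    by (rule AE_lborel_singleton)+
  ultimately have AE: "AE x in lborel. (\<lambda>n. f x - u n x) \<longlonglongrightarrow> 0"
    by eventually_elim (rule pointwise)
  have "(\<lambda>n. sqnorm (\<lambda>x. f x - u n x)) \<longlonglongrightarrow> 0"
  proof (rule sqnorm_tendsto_0_dominated[OF _ _ AE])
    show "integrable lborel (\<lambda>x. indicator {a..b} x * (2 * C)\<^sup>2)"
      by (rule integrable_mult_left) (auto simp: emeasure_lborel_Icc_eq)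
    fix n x
    show "(cmod (f x - u n x))\<^sup>2 \<le> indicator {a..b} x * (2 * C)\<^sup>2"
    proof (cases "x \<in> {a..b}")
      case True
      have "cmod (f x - u n x) \<le> 2 * C"
        using norm_triangle_ineq4[of "f x" "u n x"] C(2)[of x] u_bound[of n x] by linarith
      then have "(cmod (f x - u n x))\<^sup>2 \<le> (2 * C)\<^sup>2" by (intro power_mono) auto
      then show ?thesis using True by simp
    qed (use u0[of x n] supp in auto)
  qed measurable
  then have "\<forall>\<^sub>F n in sequentially. sqnorm (\<lambda>x. f x - u n x) < e"
    using e by (rule order_tendstoD(2))
  then obtain n where "sqnorm (\<lambda>x. f x - u n x) < e"
    unfolding eventually_sequentially by blast
  then show ?thesis using u_cont u0 by blast
qed

abbreviation expo :: "real \<Rightarrow> int \<Rightarrow> real \<Rightarrow> complex" where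
  "expo L n x \<equiv> cis (of_int n * (2 * pi / L) * x)"

text \<open>The cutoff to one period makes the exponentials square integrable on the line, so that the
  expansion in an orthogonal family applies to them.\<close>

definition harmonic :: "real \<Rightarrow> real \<Rightarrow> int \<Rightarrow> real \<Rightarrow> complex" where
  "harmonic a L n x = indicator {a..a + L} x * expo L n x"

lemma harmonic_measurable [measurable]: "harmonic a L n \<in> borel_measurable borel"
  unfolding harmonic_def by measurable

lemma harmonic_L2: "harmonic a L n \<in> L2_space"
  by (rule L2_space_bounded_support(1)[of _ 1 a "a + L"]) (auto simp: harmonic_def indicator_def)

lemma harmonic_inner:
  assumes L: "L > 0"
  shows "L2_inner (harmonic a L n) (harmonic a L m) = (if n = m then complex_of_real L else 0)"
proof -
  define k where "k = of_int (n - m) * (2 * pi / L)"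
  have "L2_inner (harmonic a L n) (harmonic a L m) =
      (LINT x|lborel. indicator {a..a + L} x *\<^sub>R cis (k * x))"
    unfolding L2_inner_def
  proof (rule Bochner_Integration.integral_cong[OF refl])
    fix x
    show "harmonic a L n x * cnj (harmonic a L m x) = indicator {a..a + L} x *\<^sub>R cis (k * x)"
      unfolding harmonic_def k_def
      by (simp add: indicator_def cis_cnj cis_mult algebra_simps diff_divide_distrib)
  qed
  also have "\<dots> = (if n = m then complex_of_real L else 0)"
  proof (cases "n = m")
    case True
    then show ?thesis using L by (simp add: k_def scaleR_conv_of_real)
  next
    case False
    then have k: "k \<noteq> 0" using L by (simp add: k_def)
    have "((\<lambda>x. cis (k * x) / (\<i> * complex_of_real k)) has_vector_derivative cis (k * x))
        (at x within {a..a + L})" for x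
    proof -
      have "((\<lambda>z. exp (\<i> * complex_of_real k * z) / (\<i> * complex_of_real k)) has_field_derivative
          exp (\<i> * complex_of_real k * complex_of_real x)) (at (complex_of_real x))"
        using k by (auto intro!: derivative_eq_intros)
      then show ?thesis
        using has_vector_derivative_real_field by (fastforce simp: cis_conv_exp mult.assoc)
    qed
    then have "(LINT x|lborel. indicator {a..a + L} x *\<^sub>R cis (k * x)) =
        cis (k * (a + L)) / (\<i> * complex_of_real k) - cis (k * a) / (\<i> * complex_of_real k)"
      using L by (intro integral_FTC_Icc) (auto intro!: continuous_intros)
    also have "k * (a + L) = k * a + 2 * pi * of_int (n - m)"
      using L by (simp add: k_def field_simps)
    also have "cis (k * a + 2 * pi * of_int (n - m)) = cis (k * a)"
      unfolding cis_mult[symmetric] by (subst cis_multiple_2pi) auto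
    finally show ?thesis using False by simp
  qed
  finally show ?thesis .
qed

text \<open>A function on one period is truncated in size, then approximated by a continuous function
  vanishing at both end points.  The latter closes up to a loop, which is uniformly close to a
  trigonometric polynomial.\<close>

lemma harmonic_dense:
  assumes L: "L > 0" and F: "F \<in> L2_space" and supp: "\<And>x. x \<notin> {a..a + L} \<Longrightarrow> F x = 0"
    and e: "e > 0"
  shows "\<exists>A b. finite A \<and> sqnorm (\<lambda>x. F x - (\<Sum>n\<in>A. b n * harmonic a L n x)) < e"
proof -
  note [measurable] = L2_space_measurable[OF F]
  obtain C where C: "C > 0" and H: "sqnorm (\<lambda>x. F x - (if cmod (F x) \<le> C then F x else 0)) < e / 10"
    using L2_approx_bounded[OF F, of "e / 10"] e by auto
  define H where "H x = (if cmod (F x) \<le> C then F x else 0)" for x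
  have Hm [measurable]: "H \<in> borel_measurable borel" unfolding H_def by measurable
  have HC: "cmod (H x) \<le> C" for x unfolding H_def using C by auto
  have H0: "H x = 0" if "x \<notin> {a..a + L}" for x unfolding H_def using supp[OF that] by simp
  obtain u where u: "continuous_on UNIV u" "\<And>x. x \<notin> {a<..<a + L} \<Longrightarrow> u x = 0"
    and Hu: "sqnorm (\<lambda>x. H x - u x) < e / 10"
    using L2_approx_continuous_vanishing_at_ends[where f = H and a = a and b = "a + L" and e = "e / 10",
        OF Hm C HC] H0 e by auto
  define d where "d = sqrt (e / (10 * L))"
  have d: "d > 0" "d\<^sup>2 * L = e / 10" unfolding d_def using e L by auto
  have "continuous_on {0..1} (\<lambda>s. u (a + s * L))"
    by (rule continuous_on_compose2[OF u(1)]) (auto intro!: continuous_intros)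
  moreover have "u (a + 0 * L) = u (a + 1 * L)" using u(2) by simp
  ultimately obtain p where p: "trig_poly p" "\<And>s. s \<in> {0..1} \<Longrightarrow> cmod (u (a + s * L) - p s) < d"
    using trig_poly_approximates_loop[of "\<lambda>s. u (a + s * L)" d] d by blast
  obtain A c where A: "finite A" "\<And>s. p s = (\<Sum>n\<in>A. c n * cis (2 * pi * of_int n * s))"
    using trig_poly_imp_sum[OF p(1)] by blast
  define b where "b n = c n * cis (- (of_int n * (2 * pi / L) * a))" for n
  define T where "T x = (\<Sum>n\<in>A. b n * harmonic a L n x)" for x
  have T: "T \<in> L2_space" unfolding T_def by (intro L2_space_sum L2_space_scale harmonic_L2)
  have uL2: "u \<in> L2_space" and HL2: "H \<in> L2_space"
  proof -
    show "H \<in> L2_space" by (rule L2_space_bounded_support(1)[OF Hm HC H0])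
    have "compact (u ` {a..a + L})"
      by (rule compact_continuous_image[OF continuous_on_subset[OF u(1)]]) auto
    from compact_imp_bounded[OF this]
    obtain K where K: "\<forall>x\<in>{a..a + L}. cmod (u x) \<le> K"
      unfolding bounded_iff by auto
    then have "cmod (u x) \<le> max 0 K" for x
      using u(2)[of x] by (cases "x \<in> {a..a + L}") (auto simp: le_max_iff_disj)
    then show "u \<in> L2_space"
      using u by (intro L2_space_bounded_support(1)[of _ "max 0 K" a "a + L"] borel_measurable_continuous_onI) auto
  qed
  have "T x = p ((x - a) / L)" if "x \<in> {a..a + L}" for x
    unfolding T_def A(2) b_def harmonic_def using that L
    by (intro sum.cong) (auto simp: mult.assoc cis_mult field_simps)
  then have uT_le: "cmod (u x - T x) \<le> d" for x
    using p(2)[of "(x - a) / L"] L u(2)[of x] d(1)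
    by (cases "x \<in> {a..a + L}") (auto simp: T_def harmonic_def less_imp_le)
  have "sqnorm (\<lambda>x. u x - T x) \<le> d\<^sup>2 * max 0 (a + L - a)"
    using u(2) by (intro L2_space_bounded_support(2)[OF _ uT_le]) (use uL2 T in \<open>auto simp: T_def harmonic_def L2_space_measurable\<close>)
  then have uT: "sqnorm (\<lambda>x. u x - T x) \<le> e / 10" using d L by simp
  have "sqnorm (\<lambda>x. F x - T x) \<le> 2 * sqnorm (\<lambda>x. F x - H x) + 2 * sqnorm (\<lambda>x. H x - T x)"
    by (rule sqnorm_diff_triangle[OF F HL2 T])
  moreover have "sqnorm (\<lambda>x. H x - T x) \<le> 2 * sqnorm (\<lambda>x. H x - u x) + 2 * sqnorm (\<lambda>x. u x - T x)"
    by (rule sqnorm_diff_triangle[OF HL2 uL2 T])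
  ultimately have "sqnorm (\<lambda>x. F x - T x) < e"
    using H[folded H_def] Hu uT by linarith
  then show ?thesis using A(1) unfolding T_def by blast
qed

theorem Fourier_series_Parseval:
  assumes L: "L > 0" and F: "F \<in> L2_space" and supp: "\<And>x. x \<notin> {a..a + L} \<Longrightarrow> F x = 0"
  defines "c \<equiv> \<lambda>n. LINT x|lborel. F x * cis (- (of_int n * (2 * pi / L) * x))"
  shows "((\<lambda>A. sqnorm (\<lambda>x. F x - (\<Sum>n\<in>A. c n / complex_of_real L * harmonic a L n x))) \<longlongrightarrow> 0)
      (finite_subsets_at_top UNIV)"
    and "((\<lambda>n. (cmod (c n))\<^sup>2) has_sum (L * sqnorm F)) UNIV"
proof -
  have c: "c n = L2_inner F (harmonic a L n)" for n
    unfolding c_def L2_inner_def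
  proof (rule Bochner_Integration.integral_cong[OF refl])
    fix x show "F x * cis (- (of_int n * (2 * pi / L) * x)) = F x * cnj (harmonic a L n x)"
      using supp[of x] by (cases "x \<in> {a..a + L}") (auto simp: harmonic_def cis_cnj)
  qed
  note expansion = orthogonal_expansion[OF harmonic_L2 harmonic_inner[OF L] L F harmonic_dense[OF L F supp]]
  show "((\<lambda>A. sqnorm (\<lambda>x. F x - (\<Sum>n\<in>A. c n / complex_of_real L * harmonic a L n x))) \<longlongrightarrow> 0)
      (finite_subsets_at_top UNIV)"
    unfolding c by (rule expansion(1)) 
  show "((\<lambda>n. (cmod (c n))\<^sup>2) has_sum (L * sqnorm F)) UNIV"
    unfolding c by (rule expansion(2)) 
qed

section \<open>The Fourier-Plancherel transform\<close>

subsection \<open>Functions with bounded support\<close>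

definition L2_supported :: "real \<Rightarrow> (real \<Rightarrow> complex) set" where
  "L2_supported a = {f \<in> L2_space. \<forall>x. x \<notin> {-a..a} \<longrightarrow> f x = 0}"

lemma L2_supportedD:
  assumes "f \<in> L2_supported a"
  shows "f \<in> L2_space" and "\<And>x. x \<notin> {-a..a} \<Longrightarrow> f x = 0"
  using assms by (auto simp: L2_supported_def)

lemma L2_supportedI:
  "f \<in> L2_space \<Longrightarrow> (\<And>x. x \<notin> {-a..a} \<Longrightarrow> f x = 0) \<Longrightarrow> f \<in> L2_supported a"
  by (auto simp: L2_supported_def)

lemma L2_supported_mono: "f \<in> L2_supported a \<Longrightarrow> a \<le> b \<Longrightarrow> f \<in> L2_supported b"
  by (auto simp: L2_supported_def)

lemma L2_supported_diff: "f \<in> L2_supported a \<Longrightarrow> g \<in> L2_supported a \<Longrightarrow> (\<lambda>x. f x - g x) \<in> L2_supported a"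
  by (auto simp: L2_supported_def)

lemma L2_supported_scale: "f \<in> L2_supported a \<Longrightarrow> (\<lambda>x. c * f x) \<in> L2_supported a"
  by (auto simp: L2_supported_def)

lemma L2_supported_sum:
  "(\<And>i. i \<in> A \<Longrightarrow> f i \<in> L2_supported a) \<Longrightarrow> (\<lambda>x. \<Sum>i\<in>A. f i x) \<in> L2_supported a"
  by (auto simp: L2_supported_def intro!: sum.neutral)

lemma L2_supported_cis_mult: "f \<in> L2_supported a \<Longrightarrow> (\<lambda>x. cis (s * x) * f x) \<in> L2_supported a"
  by (auto simp: L2_supported_def intro!: L2_space_bounded_mult(1)[where C = 1])

lemma L2_supported_integrable:
  assumes f: "f \<in> L2_supported a"
  shows "integrable lborel f"
proof -
  note [measurable] = L2_space_measurable[OF L2_supportedD(1)[OF f]]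
  have int: "integrable lborel (\<lambda>x. (cmod (f x))\<^sup>2 + indicator {-a..a} x)"
    using L2_space_integrable[OF L2_supportedD(1)[OF f]]
    by (intro Bochner_Integration.integrable_add) (auto simp: emeasure_lborel_Icc_eq)
  have le: "norm (f x) \<le> norm ((cmod (f x))\<^sup>2 + indicator {-a..a} x)" for x
  proof (cases "x \<in> {-a..a}")
    case True
    have "0 \<le> (cmod (f x) - 1)\<^sup>2" by simp
    then have "2 * cmod (f x) \<le> (cmod (f x))\<^sup>2 + 1" by (simp add: power2_diff)
    then have "cmod (f x) \<le> (cmod (f x))\<^sup>2 + 1" using norm_ge_zero[of "f x"] by linarith
    then show ?thesis using True by simp
  qed (use L2_supportedD(2)[OF f] in auto)
  show ?thesis
    by (rule Bochner_Integration.integrable_bound[OF int _ AE_I2[OF le]]) measurable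
qed

definition fourier_integral :: "(real \<Rightarrow> complex) \<Rightarrow> real \<Rightarrow> complex" where
  "fourier_integral f \<xi> = complex_of_real (1 / sqrt (2 * pi)) * (LINT t|lborel. f t * cis (- (t * \<xi>)))"

definition inv_fourier :: "(real \<Rightarrow> complex) \<Rightarrow> real \<Rightarrow> complex" where
  "inv_fourier g x = fourier_integral g (- x)"

lemma fourier_integral_measurable:
  assumes [measurable]: "f \<in> borel_measurable borel"
  shows "fourier_integral f \<in> borel_measurable borel"
  unfolding fourier_integral_def by measurable

lemma integrable_mult_cis:
  assumes "integrable lborel f"
  shows "integrable lborel (\<lambda>t. f t * cis (s * t))"
proof -
  have [measurable]: "f \<in> borel_measurable borel" using borel_measurable_integrable[OF assms] by simp
  show ?thesis
    by (rule Bochner_Integration.integrable_bound[OF assms]) (auto simp: norm_mult)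
qed

lemma fourier_integral_diff:
  assumes "integrable lborel f" "integrable lborel g"
  shows "fourier_integral (\<lambda>x. f x - g x) \<xi> = fourier_integral f \<xi> - fourier_integral g \<xi>"
  using integrable_mult_cis[OF assms(1), of "- \<xi>"] integrable_mult_cis[OF assms(2), of "- \<xi>"]
  unfolding fourier_integral_def by (simp add: left_diff_distrib right_diff_distrib mult.commute)

lemma fourier_integral_scale: "fourier_integral (\<lambda>x. c * f x) \<xi> = c * fourier_integral f \<xi>"
proof -
  have "(LINT t|lborel. c * f t * cis (- (t * \<xi>))) = c * (LINT t|lborel. f t * cis (- (t * \<xi>)))"
    by (simp add: mult.assoc)
  then show ?thesis unfolding fourier_integral_def by simp
qed

lemma fourier_integral_sum:
  assumes "\<And>i. i \<in> A \<Longrightarrow> integrable lborel (f i)"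
  shows "fourier_integral (\<lambda>x. \<Sum>i\<in>A. f i x) \<xi> = (\<Sum>i\<in>A. fourier_integral (f i) \<xi>)"
proof -
  have "integrable lborel (\<lambda>t. f i t * cis (- (t * \<xi>)))" if "i \<in> A" for i
    using integrable_mult_cis[OF assms[OF that], of "- \<xi>"] by (simp add: mult.commute)
  then show ?thesis
    unfolding fourier_integral_def by (simp add: sum_distrib_left sum_distrib_right)
qed

subsection \<open>Isometry on functions with bounded support\<close>

lemma nn_integral_periodic_tiling:
  fixes q :: "real \<Rightarrow> ennreal"
  assumes h: "h > 0" and q [measurable]: "q \<in> borel_measurable borel"
  shows "(\<integral>\<^sup>+x. q x \<partial>lborel) =
    (\<integral>\<^sup>+x. (\<Sum>n. q (x + of_int (int_decode n) * h)) * indicator {0..<h} x \<partial>lborel)"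
proof -
  define B where "B n = {of_int (int_decode n) * h..<of_int (int_decode n) * h + h}" for n
  have mem: "x \<in> B n \<longleftrightarrow> \<lfloor>x / h\<rfloor> = int_decode n" for x n
    using h unfolding B_def floor_eq_iff by (auto simp: field_simps)
  have "disjoint_family B" unfolding disjoint_family_on_def using mem
    by (metis (no_types, lifting) IntE equals0I inj_int_decode injD)
  moreover have "(\<Union>n. B n) = UNIV" using mem surj_int_decode by (auto simp: surj_def)
  ultimately have "(\<integral>\<^sup>+x. q x \<partial>lborel) = (\<Sum>n. \<integral>\<^sup>+x\<in>B n. q x \<partial>lborel)"
    using nn_integral_disjoint_family[of q lborel B] by (simp add: B_def)
  also have "\<dots> = (\<Sum>n. \<integral>\<^sup>+x. q (x + of_int (int_decode n) * h) * indicator {0..<h} x \<partial>lborel)"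
  proof (intro arg_cong[of _ _ suminf] ext)
    fix n
    show "(\<integral>\<^sup>+x\<in>B n. q x \<partial>lborel) =
        (\<integral>\<^sup>+x. q (x + of_int (int_decode n) * h) * indicator {0..<h} x \<partial>lborel)"
      by (subst nn_integral_real_affine[where c = 1 and t = "of_int (int_decode n) * h"])
        (auto simp: B_def indicator_def add.commute intro!: nn_integral_cong)
  qed
  also have "\<dots> = (\<integral>\<^sup>+x. (\<Sum>n. q (x + of_int (int_decode n) * h) * indicator {0..<h} x) \<partial>lborel)"
    by (rule nn_integral_suminf[symmetric]) simp
  finally show ?thesis by simp
qed

text \<open>Let \<open>f\<close> vanish off \<open>[-a, a]\<close>.  For each \<open>\<alpha>\<close> the numbers \<open>fourier_integral f (\<alpha> + n \<pi> / a)\<close>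
  are, up to a factor, the Fourier coefficients on \<open>[-a, a]\<close> of the modulated function
  \<open>t \<mapsto> f t * cis (- \<alpha> t)\<close>, so Parseval's identity gives the sum of their squares.  Integrating over
  \<open>\<alpha> \<in> [0, \<pi> / a)\<close> turns the sum into the integral over the line.\<close>

theorem Plancherel_bounded_support:
  assumes f: "f \<in> L2_supported a" and a: "a > 0"
  shows "fourier_integral f \<in> L2_space" and "sqnorm (fourier_integral f) = sqnorm f"
proof -
  define \<beta> where "\<beta> = pi / a"
  have \<beta>: "\<beta> > 0" unfolding \<beta>_def using a by simp
  note [measurable] = L2_space_measurable[OF L2_supportedD(1)[OF f]]
    fourier_integral_measurable[OF L2_space_measurable[OF L2_supportedD(1)[OF f]]]
  let ?T = "fourier_integral f"
  have parseval: "((\<lambda>n. (cmod (?T (\<alpha> + of_int n * \<beta>)))\<^sup>2) has_sum (sqnorm f / \<beta>)) UNIV" for \<alpha>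
  proof -
    define F where "F t = cis (- \<alpha> * t) * f t" for t
    have F: "F \<in> L2_supported a" unfolding F_def by (rule L2_supported_cis_mult[OF f])
    have sq: "sqnorm F = sqnorm f" unfolding F_def sqnorm_def by (simp add: norm_mult)
    have c: "(LINT x|lborel. F x * cis (- (of_int n * (2 * pi / (2 * a)) * x))) =
        complex_of_real (sqrt (2 * pi)) * ?T (\<alpha> + of_int n * \<beta>)" for n
    proof -
      have "F x * cis (- (of_int n * (2 * pi / (2 * a)) * x)) = f x * cis (- (x * (\<alpha> + of_int n * \<beta>)))" for x
      proof -
        have "cis (- \<alpha> * x) * cis (- (of_int n * (2 * pi / (2 * a)) * x)) = cis (- (x * (\<alpha> + of_int n * \<beta>)))"
          using a by (simp add: cis_mult \<beta>_def algebra_simps)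
        then show ?thesis unfolding F_def by (simp add: mult.assoc mult.left_commute)
      qed
      then show ?thesis
        unfolding fourier_integral_def by simp
    qed
    have "((\<lambda>n. (cmod (complex_of_real (sqrt (2 * pi)) * ?T (\<alpha> + of_int n * \<beta>)))\<^sup>2) has_sum
        (2 * a * sqnorm f)) UNIV"
      using Fourier_series_Parseval(2)[of "2 * a" F "- a"] a L2_supportedD[OF F]
      unfolding c sq by simp
    then have "((\<lambda>n. (1 / (2 * pi)) * (2 * pi * (cmod (?T (\<alpha> + of_int n * \<beta>)))\<^sup>2)) has_sum
        ((1 / (2 * pi)) * (2 * a * sqnorm f))) UNIV"
      by (intro has_sum_cmult_right) (simp add: norm_mult power_mult_distrib)
    then show ?thesis by (simp add: \<beta>_def field_simps)
  qed
  have nat_sum: "(\<Sum>n. ennreal ((cmod (?T (\<alpha> + of_int (int_decode n) * \<beta>)))\<^sup>2)) = ennreal (sqnorm f / \<beta>)" for \<alpha>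
  proof (rule suminf_ennreal_eq)
    have "((\<lambda>n. (cmod (?T (\<alpha> + of_int (int_decode n) * \<beta>)))\<^sup>2) has_sum (sqnorm f / \<beta>)) UNIV"
      using parseval[of \<alpha>]
      by (subst has_sum_reindex_bij_betw[OF bij_int_decode])
    then show "(\<lambda>n. (cmod (?T (\<alpha> + of_int (int_decode n) * \<beta>)))\<^sup>2) sums (sqnorm f / \<beta>)"
      by (rule has_sum_imp_sums)
  qed simp
  have "(\<integral>\<^sup>+\<xi>. ennreal ((cmod (?T \<xi>))\<^sup>2) \<partial>lborel) =
      (\<integral>\<^sup>+\<alpha>. ennreal (sqnorm f / \<beta>) * indicator {0..<\<beta>} \<alpha> \<partial>lborel)"
    by (subst nn_integral_periodic_tiling[OF \<beta>]) (auto simp: nat_sum)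
  also have "\<dots> = ennreal (sqnorm f / \<beta>) * ennreal \<beta>"
    using \<beta> by (subst nn_integral_cmult_indicator) auto
  also have "\<dots> = ennreal (sqnorm f)"
    using \<beta> by (subst ennreal_mult[symmetric]) auto
  finally have *: "(\<integral>\<^sup>+\<xi>. ennreal ((cmod (?T \<xi>))\<^sup>2) \<partial>lborel) = ennreal (sqnorm f)" .
  then show T: "?T \<in> L2_space" by (intro L2_space_nn_integralI) auto
  show "sqnorm ?T = sqnorm f"
    using * nn_integral_sqnorm[OF T] by simp
qed

lemma sqnorm_reflect:
  assumes "f \<in> L2_space"
  shows "(\<lambda>x. f (- x)) \<in> L2_space" and "sqnorm (\<lambda>x. f (- x)) = sqnorm f"
proof -
  note [measurable] = L2_space_measurable[OF assms]
  have eq: "(\<integral>\<^sup>+x. ennreal ((cmod (f (- x)))\<^sup>2) \<partial>lborel) = ennreal (sqnorm f)"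
    using nn_integral_real_affine[where c = "-1" and t = 0 and f = "\<lambda>x. ennreal ((cmod (f x))\<^sup>2)"]
    by (simp add: nn_integral_sqnorm[OF assms])
  then show *: "(\<lambda>x. f (- x)) \<in> L2_space" by (intro L2_space_nn_integralI) auto
  show "sqnorm (\<lambda>x. f (- x)) = sqnorm f"
    using eq nn_integral_sqnorm[OF *] by simp
qed

lemma inv_fourier_L2:
  assumes "g \<in> L2_supported a" and "a > 0"
  shows "inv_fourier g \<in> L2_space" and "sqnorm (inv_fourier g) = sqnorm g"
proof -
  have "inv_fourier g = (\<lambda>x. fourier_integral g (- x))" by (simp add: inv_fourier_def fun_eq_iff)
  then show "inv_fourier g \<in> L2_space" and "sqnorm (inv_fourier g) = sqnorm g"
    using sqnorm_reflect[OF Plancherel_bounded_support(1)[OF assms]]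
      Plancherel_bounded_support(2)[OF assms] by simp_all
qed

lemma inv_fourier_diff:
  assumes "f \<in> L2_supported a" "g \<in> L2_supported a"
  shows "inv_fourier (\<lambda>x. f x - g x) = (\<lambda>x. inv_fourier f x - inv_fourier g x)"
  unfolding inv_fourier_def using assms by (simp add: fourier_integral_diff L2_supported_integrable)

lemma inv_fourier_scale: "inv_fourier (\<lambda>x. c * f x) = (\<lambda>x. c * inv_fourier f x)"
  unfolding inv_fourier_def by (simp add: fourier_integral_scale)

lemma inv_fourier_sum:
  assumes "\<And>i. i \<in> A \<Longrightarrow> f i \<in> L2_supported a"
  shows "inv_fourier (\<lambda>x. \<Sum>i\<in>A. f i x) = (\<lambda>x. \<Sum>i\<in>A. inv_fourier (f i) x)"
  unfolding inv_fourier_def using assms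
  by (intro ext fourier_integral_sum) (blast intro: L2_supported_integrable)

lemma inv_fourier_translate: "translate s (inv_fourier g) = inv_fourier (\<lambda>\<xi>. cis (s * \<xi>) * g \<xi>)"
proof
  fix x
  have "g t * cis (- (t * - (x + s))) = cis (s * t) * g t * cis (- (t * - x))" for t
  proof -
    have "cis (- (t * - (x + s))) = cis (s * t) * cis (- (t * - x))"
      by (simp add: cis_mult algebra_simps)
    then show ?thesis by (simp only: mult_ac)
  qed
  then show "translate s (inv_fourier g) x = inv_fourier (\<lambda>\<xi>. cis (s * \<xi>) * g \<xi>) x"
    by (simp only: translate_def inv_fourier_def fourier_integral_def)
qed

text \<open>Polarization: the real part of the inner product is determined by the norms, and the imaginary
  part is the real part after multiplication by \<open>\<i>\<close>.\<close>

lemma inv_fourier_inner: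
  assumes f: "f \<in> L2_supported a" and g: "g \<in> L2_supported a" and a: "a > 0"
  shows "L2_inner (inv_fourier f) (inv_fourier g) = L2_inner f g"
proof -
  have re: "Re (L2_inner (inv_fourier u) (inv_fourier g)) = Re (L2_inner u g)"
    if u: "u \<in> L2_supported a" for u
  proof -
    have "sqnorm (\<lambda>x. inv_fourier u x - inv_fourier g x) = sqnorm (\<lambda>x. u x - g x)"
      using inv_fourier_L2(2)[OF L2_supported_diff[OF u g] a] inv_fourier_diff[OF u g] by simp
    then show ?thesis
      using inv_fourier_L2[OF u a] inv_fourier_L2[OF g a] L2_supportedD(1)[OF u] L2_supportedD(1)[OF g]
      by (simp add: sqnorm_diff)
  qed
  have "Re (\<i> * L2_inner (inv_fourier f) (inv_fourier g)) = Re (\<i> * L2_inner f g)"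
    using re[OF L2_supported_scale[OF f, of \<i>]] unfolding inv_fourier_scale L2_inner_scale_left .
  then show ?thesis using re[OF f] by (simp add: complex_eq_iff)
qed

lemma inv_fourier_AE_cong:
  assumes [measurable]: "f \<in> borel_measurable borel" "g \<in> borel_measurable borel"
    and "AE x in lborel. f x = g x"
  shows "inv_fourier f = inv_fourier g"
proof
  fix x
  have "(LINT t|lborel. f t * cis (- (t * - x))) = (LINT t|lborel. g t * cis (- (t * - x)))"
    using assms(3) by (intro integral_cong_AE) auto
  then show "inv_fourier f x = inv_fourier g x" by (simp add: inv_fourier_def fourier_integral_def)
qed

lemma inv_fourier_AE_inj:
  assumes f: "f \<in> L2_supported a" and g: "g \<in> L2_supported a" and a: "a > 0"
    and "AE x in lborel. inv_fourier f x = inv_fourier g x"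
  shows "AE x in lborel. f x = g x"
proof (rule sqnorm_diff_eq_0_imp_AE)
  note d = L2_supported_diff[OF f g]
  have "sqnorm (\<lambda>x. f x - g x) = sqnorm (\<lambda>x. inv_fourier f x - inv_fourier g x)"
    using inv_fourier_L2(2)[OF d a] unfolding inv_fourier_diff[OF f g] by simp
  also have "\<dots> = sqnorm (\<lambda>x. 0)"
    using assms(4) inv_fourier_L2(1)[OF f a] inv_fourier_L2(1)[OF g a]
    by (intro sqnorm_cong_AE) (auto dest: L2_space_measurable)
  finally show "sqnorm (\<lambda>x. f x - g x) = 0" by (simp add: sqnorm_def)
qed (use f g in \<open>auto dest: L2_supportedD\<close>)

subsection \<open>The transform on all square integrable functions\<close>

definition cutoff :: "real \<Rightarrow> (real \<Rightarrow> complex) \<Rightarrow> real \<Rightarrow> complex" where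
  "cutoff R f x = indicator {-R..R} x * f x"

lemma cutoff_supported:
  assumes "f \<in> L2_space"
  shows "cutoff R f \<in> L2_supported (max R 1)"
  unfolding cutoff_def using assms
  by (intro L2_supportedI L2_space_bounded_mult(1)[where C = 1]) (auto simp: indicator_def)

lemma fourier_truncated_eq_cutoff: "fourier_truncated f R = fourier_integral (cutoff R f)"
proof
  fix \<xi>
  have "indicator {-R..R} t *\<^sub>R (f t * exp (- \<i> * complex_of_real (t * \<xi>))) =
      cutoff R f t * cis (- (t * \<xi>))" for t
    by (cases "t \<in> {-R..R}") (auto simp: cutoff_def cis_conv_exp)
  then show "fourier_truncated f R \<xi> = fourier_integral (cutoff R f) \<xi>"
    unfolding fourier_truncated_def fourier_integral_def set_lebesgue_integral_def by simp
qed

lemma fourier_truncated_L2: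
  assumes "f \<in> L2_space"
  shows "fourier_truncated f R \<in> L2_space"
  unfolding fourier_truncated_eq_cutoff
  by (rule Plancherel_bounded_support(1)[OF cutoff_supported[OF assms]]) auto

lemma fourier_truncated_diff_sqnorm:
  assumes f: "f \<in> L2_space"
  shows "sqnorm (\<lambda>\<xi>. fourier_truncated f R \<xi> - fourier_truncated f S \<xi>) =
    sqnorm (\<lambda>x. cutoff R f x - cutoff S f x)"
proof -
  define M where "M = max (max R 1) (max S 1)"
  have M: "cutoff R f \<in> L2_supported M" "cutoff S f \<in> L2_supported M" "M > 0"
    unfolding M_def by (auto intro: L2_supported_mono[OF cutoff_supported[OF f]])
  have "fourier_integral (\<lambda>x. cutoff R f x - cutoff S f x) =
      (\<lambda>\<xi>. fourier_truncated f R \<xi> - fourier_truncated f S \<xi>)"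
    unfolding fourier_truncated_eq_cutoff
    by (intro ext fourier_integral_diff L2_supported_integrable[OF M(1)] L2_supported_integrable[OF M(2)])
  then show ?thesis
    using Plancherel_bounded_support(2)[OF L2_supported_diff[OF M(1,2)] M(3)] by simp
qed

lemma cutoff_tendsto:
  assumes f: "f \<in> L2_space"
  shows "((\<lambda>R. sqnorm (\<lambda>x. cutoff R f x - f x)) \<longlongrightarrow> 0) at_top"
proof -
  note [measurable] = L2_space_measurable[OF f]
  have "((\<lambda>R. LINT x|lborel. (cmod (cutoff R f x - f x))\<^sup>2) \<longlongrightarrow> (LINT x::real|lborel. (0::real))) at_top"
  proof (rule integral_dominated_convergence_at_top[OF _ _ L2_space_integrable[OF f]])
    have "\<forall>\<^sub>F R in at_top. (cmod (cutoff R f x - f x))\<^sup>2 = 0" for x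
      using eventually_ge_at_top[of "\<bar>x\<bar>"] by eventually_elim (auto simp: cutoff_def indicator_def)
    then show "AE x in lborel. ((\<lambda>R. (cmod (cutoff R f x - f x))\<^sup>2) \<longlongrightarrow> 0) at_top"
      by (intro AE_I2 tendsto_eventually)
    show "\<forall>\<^sub>F R in at_top. AE x in lborel. norm ((cmod (cutoff R f x - f x))\<^sup>2) \<le> (cmod (f x))\<^sup>2"
      by (intro always_eventually allI AE_I2) (auto simp: cutoff_def indicator_def)
  qed (auto simp: cutoff_def)
  then show ?thesis unfolding sqnorm_def by simp
qed

text \<open>By Plancherel's identity for bounded support the distance between two truncated transforms is
  the distance between the truncations of \<open>f\<close>, so the truncated transforms form a Cauchy family.\<close>

lemma fourier_exists:
  assumes f: "f \<in> L2_space"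
  shows "\<exists>g. g \<in> L2_space \<and> L2_tendsto (fourier_truncated f) g at_top"
proof -
  have cL2: "cutoff R f \<in> L2_space" for R using cutoff_supported[OF f] L2_supportedD(1) by blast
  have cauchy: "\<exists>N. \<forall>R\<ge>N. \<forall>S\<ge>N. sqnorm (\<lambda>\<xi>. fourier_truncated f R \<xi> - fourier_truncated f S \<xi>) < e"
    if e: "e > 0" for e
  proof -
    have "\<forall>\<^sub>F R in at_top. sqnorm (\<lambda>x. cutoff R f x - f x) < e / 4"
      by (rule order_tendstoD(2)[OF cutoff_tendsto[OF f]]) (use e in simp)
    then obtain N where N: "\<And>R. R \<ge> N \<Longrightarrow> sqnorm (\<lambda>x. cutoff R f x - f x) < e / 4"
      unfolding eventually_at_top_linorder by blast
    have "sqnorm (\<lambda>\<xi>. fourier_truncated f R \<xi> - fourier_truncated f S \<xi>) < e" if "R \<ge> N" "S \<ge> N" for R S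
      using sqnorm_diff_triangle[OF cL2[of R] f cL2[of S]] N[OF that(1)] N[OF that(2)]
      by (simp add: fourier_truncated_diff_sqnorm[OF f] sqnorm_minus[of f])
    then show ?thesis by blast
  qed
  have "\<exists>N. \<forall>m\<ge>N. \<forall>n\<ge>N. sqnorm (\<lambda>\<xi>. fourier_truncated f (real m) \<xi> - fourier_truncated f (real n) \<xi>) < e"
    if e: "e > 0" for e
  proof -
    obtain N where N: "\<And>R S. R \<ge> N \<Longrightarrow> S \<ge> N \<Longrightarrow>
        sqnorm (\<lambda>\<xi>. fourier_truncated f R \<xi> - fourier_truncated f S \<xi>) < e"
      using cauchy[OF e] by blast
    have "N \<le> real m" if "m \<ge> nat \<lceil>N\<rceil>" for m using that by linarith
    then show ?thesis using N by (intro exI[of _ "nat \<lceil>N\<rceil>"]) blast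
  qed
  from L2_complete[OF fourier_truncated_L2[OF f] this]
  obtain g where g: "g \<in> L2_space"
    and lim: "(\<lambda>n. sqnorm (\<lambda>\<xi>. fourier_truncated f (real n) \<xi> - g \<xi>)) \<longlonglongrightarrow> 0" by blast
  have "((\<lambda>R. sqnorm (\<lambda>\<xi>. fourier_truncated f R \<xi> - g \<xi>)) \<longlongrightarrow> 0) at_top"
  proof (rule tendstoI)
    fix e :: real assume e: "e > 0"
    obtain N where N: "\<And>R S. R \<ge> N \<Longrightarrow> S \<ge> N \<Longrightarrow>
        sqnorm (\<lambda>\<xi>. fourier_truncated f R \<xi> - fourier_truncated f S \<xi>) < e / 4"
      using cauchy[of "e / 4"] e by auto
    have "\<forall>\<^sub>F n in sequentially. sqnorm (\<lambda>\<xi>. fourier_truncated f (real n) \<xi> - g \<xi>) < e / 4"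
      by (rule order_tendstoD(2)[OF lim]) (use e in simp)
    moreover have "\<forall>\<^sub>F n in sequentially. N \<le> real n"
      using filterlim_real_sequentially unfolding filterlim_at_top by blast
    ultimately have "\<forall>\<^sub>F n in sequentially. N \<le> real n \<and>
        sqnorm (\<lambda>\<xi>. fourier_truncated f (real n) \<xi> - g \<xi>) < e / 4"
      by eventually_elim blast
    then obtain n where n: "N \<le> real n" "sqnorm (\<lambda>\<xi>. fourier_truncated f (real n) \<xi> - g \<xi>) < e / 4"
      unfolding eventually_sequentially by blast
    have "sqnorm (\<lambda>\<xi>. fourier_truncated f R \<xi> - g \<xi>) < e" if "R \<ge> N" for R
      using sqnorm_diff_triangle[OF fourier_truncated_L2[OF f, of R] fourier_truncated_L2[OF f, of "real n"] g]
        N[OF that n(1)] n(2) by linarith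
    then show "\<forall>\<^sub>F R in at_top. dist (sqnorm (\<lambda>\<xi>. fourier_truncated f R \<xi> - g \<xi>)) 0 < e"
      unfolding eventually_at_top_linorder by auto
  qed
  then show ?thesis
    by (intro exI[of _ g] conjI g iffD2[OF L2_tendsto_iff_sqnorm[OF always_eventually[OF allI[OF fourier_truncated_L2[OF f]]] g]])
qed

lemma fourier_L2_tendsto:
  assumes f: "f \<in> L2_space"
  shows "fourier f \<in> L2_space"
    and "((\<lambda>R. sqnorm (\<lambda>\<xi>. fourier_truncated f R \<xi> - fourier f \<xi>)) \<longlongrightarrow> 0) at_top"
proof -
  have *: "fourier f \<in> L2_space \<and> L2_tendsto (fourier_truncated f) (fourier f) at_top"
    unfolding fourier_def by (rule someI_ex[OF fourier_exists[OF f]])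
  then show F: "fourier f \<in> L2_space" by (rule conjunct1)
  show "((\<lambda>R. sqnorm (\<lambda>\<xi>. fourier_truncated f R \<xi> - fourier f \<xi>)) \<longlongrightarrow> 0) at_top"
    by (rule iffD1[OF L2_tendsto_iff_sqnorm[OF always_eventually[OF allI[OF fourier_truncated_L2[OF f]]] F] conjunct2[OF *]])
qed

theorem Plancherel:
  assumes f: "f \<in> L2_space"
  shows "sqnorm (fourier f) = sqnorm f"
proof -
  have cL2: "cutoff R f \<in> L2_space" for R using cutoff_supported[OF f] L2_supportedD(1) by blast
  have "sqnorm (fourier_truncated f R) = sqnorm (cutoff R f)" for R
    unfolding fourier_truncated_eq_cutoff
    by (rule Plancherel_bounded_support(2)[OF cutoff_supported[OF f]]) auto
  then have "((\<lambda>R. sqnorm (cutoff R f)) \<longlongrightarrow> sqnorm (fourier f)) at_top"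
    using sqnorm_tendsto[OF fourier_truncated_L2[OF f] fourier_L2_tendsto[OF f]] by simp
  moreover have "((\<lambda>R. sqnorm (cutoff R f)) \<longlongrightarrow> sqnorm f) at_top"
    by (rule sqnorm_tendsto[OF cL2 f cutoff_tendsto[OF f]])
  ultimately show ?thesis using tendsto_unique trivial_limit_at_top_linorder by blast
qed

text \<open>Fubini's theorem applies because square integrable functions of bounded support are integrable.\<close>

lemma inv_fourier_adjoint:
  assumes f: "f \<in> L2_supported b" and g: "g \<in> L2_supported a"
  shows "L2_inner f (inv_fourier g) = L2_inner (fourier_integral f) g"
proof -
  note [measurable] = L2_space_measurable[OF L2_supportedD(1)[OF f]]
    L2_space_measurable[OF L2_supportedD(1)[OF g]]
  let ?k = "complex_of_real (1 / sqrt (2 * pi))"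
  let ?q = "\<lambda>t \<xi>. f t * cnj (g \<xi>) * cis (- (t * \<xi>))"
  have int: "integrable (lborel \<Otimes>\<^sub>M lborel) (case_prod ?q)"
  proof (rule lborel_pair.Fubini_integrable)
    have "integrable lborel (\<lambda>t. cmod (f t) * (LINT \<xi>|lborel. cmod (g \<xi>)))"
      using L2_supported_integrable[OF f] by simp
    then show "integrable lborel (\<lambda>t. LINT \<xi>|lborel. norm (case (t, \<xi>) of (t, \<xi>) \<Rightarrow> ?q t \<xi>))"
      by (simp add: norm_mult)
    have "integrable lborel (\<lambda>\<xi>. ?q t \<xi>)" for t
    proof -
      have "integrable lborel (\<lambda>\<xi>. cnj (g \<xi>))" using L2_supported_integrable[OF g] by simp
      from integrable_mult_right[OF integrable_mult_cis[OF this, of "- t"], of "f t"]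
      show ?thesis by (simp add: mult.assoc)
    qed
    then show "AE t in lborel. integrable lborel (\<lambda>\<xi>. case (t, \<xi>) of (t, \<xi>) \<Rightarrow> ?q t \<xi>)"
      by simp
  qed measurable
  have "L2_inner f (inv_fourier g) = (LINT t|lborel. ?k * (LINT \<xi>|lborel. ?q t \<xi>))"
    unfolding L2_inner_def
  proof (rule Bochner_Integration.integral_cong[OF refl])
    fix t
    have "cnj (inv_fourier g t) = ?k * (LINT \<xi>|lborel. cnj (g \<xi>) * cis (- (t * \<xi>)))"
      unfolding inv_fourier_def fourier_integral_def complex_cnj_mult Bochner_Integration.integral_cnj[symmetric]
      by (simp add: cis_cnj mult.commute)
    then show "f t * cnj (inv_fourier g t) = ?k * (LINT \<xi>|lborel. ?q t \<xi>)"
      by (simp add: mult.assoc)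
  qed
  also have "\<dots> = ?k * (LINT t|lborel. LINT \<xi>|lborel. ?q t \<xi>)" by simp
  also have "(LINT t|lborel. LINT \<xi>|lborel. ?q t \<xi>) = (LINT \<xi>|lborel. LINT t|lborel. ?q t \<xi>)"
    by (rule lborel_pair.Fubini_integral[OF int, symmetric])
  also have "?k * \<dots> = (LINT \<xi>|lborel. ?k * (LINT t|lborel. ?q t \<xi>))" by simp
  also have "\<dots> = L2_inner (fourier_integral f) g"
    unfolding L2_inner_def
  proof (rule Bochner_Integration.integral_cong[OF refl])
    fix \<xi>
    have "(LINT t|lborel. ?q t \<xi>) = (LINT t|lborel. f t * cis (- (t * \<xi>))) * cnj (g \<xi>)"
      unfolding Bochner_Integration.integral_mult_left_zero[symmetric]
      by (rule Bochner_Integration.integral_cong) (simp_all only: mult_ac)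
    then show "?k * (LINT t|lborel. ?q t \<xi>) = fourier_integral f \<xi> * cnj (g \<xi>)"
      unfolding fourier_integral_def by simp
  qed
  finally show ?thesis .
qed

lemma fourier_adjoint:
  assumes f: "f \<in> L2_space" and g: "g \<in> L2_supported a" and a: "a > 0"
  shows "L2_inner f (inv_fourier g) = L2_inner (fourier f) g"
proof -
  have cL2: "cutoff R f \<in> L2_space" for R using cutoff_supported[OF f] L2_supportedD(1) by blast
  have gL2: "g \<in> L2_space" by (rule L2_supportedD(1)[OF g])
  have const: "((\<lambda>R. sqnorm (\<lambda>x. u x - u x)) \<longlongrightarrow> 0) at_top" for u :: "real \<Rightarrow> complex"
    by (simp add: sqnorm_def)
  have "L2_inner (cutoff R f) (inv_fourier g) = L2_inner (fourier_truncated f R) g" for R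
    unfolding fourier_truncated_eq_cutoff by (rule inv_fourier_adjoint[OF cutoff_supported[OF f] g])
  then have "((\<lambda>R. L2_inner (cutoff R f) (inv_fourier g)) \<longlongrightarrow> L2_inner (fourier f) g) at_top"
    using L2_inner_tendsto[OF fourier_truncated_L2[OF f] fourier_L2_tendsto(1)[OF f] gL2 gL2
        fourier_L2_tendsto(2)[OF f] const] by simp
  moreover have "((\<lambda>R. L2_inner (cutoff R f) (inv_fourier g)) \<longlongrightarrow> L2_inner f (inv_fourier g)) at_top"
    by (rule L2_inner_tendsto[OF cL2 f inv_fourier_L2(1)[OF g a] inv_fourier_L2(1)[OF g a]
          cutoff_tendsto[OF f] const])
  ultimately show ?thesis using tendsto_unique trivial_limit_at_top_linorder by blast
qed

text \<open>Both inversion formulas follow from the adjoint relation and Plancherel's identity through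
  \<open>L2_eq_if_inner_eq\<close>.\<close>

lemma fourier_inv_fourier:
  assumes g: "g \<in> L2_supported a" and a: "a > 0"
  shows "AE \<xi> in lborel. fourier (inv_fourier g) \<xi> = g \<xi>"
proof -
  note P = inv_fourier_L2[OF g a]
  show ?thesis
  proof (rule L2_eq_if_inner_eq[OF fourier_L2_tendsto(1)[OF P(1)] L2_supportedD(1)[OF g]])
    show "L2_inner (fourier (inv_fourier g)) g = complex_of_real (sqnorm g)"
      using fourier_adjoint[OF P(1) g a] by (simp add: L2_inner_self P(2))
    show "sqnorm (fourier (inv_fourier g)) = sqnorm g"
      by (simp add: Plancherel[OF P(1)] P(2))
  qed
qed

lemma inv_fourier_bandlimited:
  assumes g: "g \<in> L2_supported \<omega>" and \<omega>: "\<omega> > 0"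
  shows "inv_fourier g \<in> bandlimited \<omega>"
  unfolding bandlimited_def using inv_fourier_L2(1)[OF g \<omega>] fourier_inv_fourier[OF g \<omega>]
  by (auto elim!: eventually_mono simp: L2_supportedD(2)[OF g])

lemma bandlimited_eq_inv_fourier:
  assumes f: "f \<in> bandlimited \<omega>" and \<omega>: "\<omega> > 0"
  obtains g where "g \<in> L2_supported \<omega>" and "AE \<xi> in lborel. fourier f \<xi> = g \<xi>"
    and "AE x in lborel. f x = inv_fourier g x"
proof -
  have fL2: "f \<in> L2_space" using f unfolding bandlimited_def by blast
  note F = fourier_L2_tendsto(1)[OF fL2]
  note [measurable] = L2_space_measurable[OF F]
  define g where "g = cutoff \<omega> (fourier f)"
  have g: "g \<in> L2_supported \<omega>"
    unfolding g_def cutoff_def using F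
    by (intro L2_supportedI L2_space_bounded_mult(1)[where C = 1]) (auto simp: indicator_def)
  note [measurable] = L2_space_measurable[OF L2_supportedD(1)[OF g]]
  have AE: "AE \<xi> in lborel. fourier f \<xi> = g \<xi>"
    using f unfolding bandlimited_def
    by (auto elim!: eventually_mono simp: g_def cutoff_def indicator_def)
  have "AE x in lborel. f x = inv_fourier g x"
  proof (rule L2_eq_if_inner_eq[OF fL2 inv_fourier_L2(1)[OF g \<omega>]])
    have "L2_inner f (inv_fourier g) = L2_inner g g"
      unfolding fourier_adjoint[OF fL2 g \<omega>] by (rule L2_inner_cong_AE) (use AE in auto)
    then show "L2_inner f (inv_fourier g) = complex_of_real (sqnorm (inv_fourier g))"
      by (simp add: L2_inner_self inv_fourier_L2(2)[OF g \<omega>])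
    show "sqnorm f = sqnorm (inv_fourier g)"
      unfolding inv_fourier_L2(2)[OF g \<omega>] Plancherel[OF fL2, symmetric]
      by (rule sqnorm_cong_AE) (use AE in auto)
  qed
  then show ?thesis using that[OF g AE] by blast
qed

section \<open>Linear algebra\<close>

subsection \<open>Measurable solutions of linear systems\<close>

lemma borel_measurable_det:
  fixes T :: "'a \<Rightarrow> nat \<Rightarrow> nat \<Rightarrow> complex"
  assumes [measurable]: "\<And>i j. (\<lambda>x. T x i j) \<in> borel_measurable M"
  shows "(\<lambda>x. Determinant.det (Matrix.mat n n (\<lambda>(i, j). T x i j))) \<in> borel_measurable M"
proof -
  have "Determinant.det (Matrix.mat n n (\<lambda>(i, j). T x i j)) =
      (\<Sum>p | p permutes {0..<n}. signof p * (\<Prod>i = 0..<n. T x i (p i)))" for x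
  proof -
    have "(\<Prod>i = 0..<n. Matrix.mat n n (\<lambda>(i, j). T x i j) $$ (i, p i)) = (\<Prod>i = 0..<n. T x i (p i))"
      if "p permutes {0..<n}" for p
      by (rule prod.cong) (use permutes_in_image[OF that] in auto)
    then show ?thesis unfolding Determinant.det_def by simp
  qed
  then show ?thesis by simp
qed

text \<open>By Cramer's rule the solution is a quotient of determinants, hence depends measurably on
  the parameter.\<close>

lemma measurable_linear_solve:
  fixes T :: "'a \<Rightarrow> nat \<Rightarrow> nat \<Rightarrow> complex" and v :: "'a \<Rightarrow> nat \<Rightarrow> complex"
  assumes T [measurable]: "\<And>i j. (\<lambda>x. T x i j) \<in> borel_measurable M"
    and v [measurable]: "\<And>i. (\<lambda>x. v x i) \<in> borel_measurable M"
  obtains d where "\<And>i. (\<lambda>x. d x i) \<in> borel_measurable M"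
    and "\<And>x i. \<forall>c. (\<forall>i<n. (\<Sum>j<n. T x i j * c j) = 0) \<longrightarrow> (\<forall>j<n. c j = 0) \<Longrightarrow>
        i < n \<Longrightarrow> (\<Sum>j<n. T x i j * d x j) = v x i"
proof -
  define A where "A x = Matrix.mat n n (\<lambda>(i, j). T x i j)" for x
  define C where "C x i j = (- 1) ^ (i + j) * Determinant.det (Matrix.mat (n - 1) (n - 1)
      (\<lambda>(a, b). T x (if a < i then a else Suc a) (if b < j then b else Suc b)))" for x i j
  have Ac: "A x \<in> carrier_mat n n" for x unfolding A_def by simp
  have adj: "adj_mat (A x) $$ (i, j) = C x j i" if "i < n" "j < n" for x i j
    using that Ac unfolding adj_mat_def cofactor_def C_def
    by (auto simp: mat_delete_def A_def intro!: arg_cong[of _ _ Determinant.det] eq_matI)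
  define d where "d x i = (\<Sum>j<n. C x j i * v x j) / Determinant.det (A x)" for x i
  have "(\<lambda>x. C x i j) \<in> borel_measurable M" for i j
    unfolding C_def by (intro borel_measurable_times borel_measurable_const borel_measurable_det) simp
  moreover have "(\<lambda>x. Determinant.det (A x)) \<in> borel_measurable M"
    unfolding A_def by (rule borel_measurable_det) simp
  ultimately have "(\<lambda>x. d x i) \<in> borel_measurable M" for i
    unfolding d_def by (intro borel_measurable_divide borel_measurable_sum borel_measurable_times) auto
  moreover have "(\<Sum>j<n. T x i j * d x j) = v x i"
    if inj: "\<forall>c. (\<forall>i<n. (\<Sum>j<n. T x i j * c j) = 0) \<longrightarrow> (\<forall>j<n. c j = 0)"
      and i: "i < n" for x i
  proof -
    have mv: "vec_index (A x *\<^sub>v u) i = (\<Sum>j<n. T x i j * vec_index u j)"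
      if "u \<in> carrier_vec n" "i < n" for u i
      using that Ac[of x] by (auto simp: scalar_prod_def A_def atLeast0LessThan)
    have det: "Determinant.det (A x) \<noteq> 0"
    proof
      assume "Determinant.det (A x) = 0"
      then obtain u where u: "u \<in> carrier_vec n" "u \<noteq> 0\<^sub>v n" "A x *\<^sub>v u = 0\<^sub>v n"
        using det_0_iff_vec_prod_zero_field[OF Ac] by blast
      then have "(\<Sum>j<n. T x i j * vec_index u j) = 0" if "i < n" for i
        using mv[OF u(1) that] that by simp
      then have "vec_index u j = 0" if "j < n" for j using inj that by blast
      then have "u = 0\<^sub>v n" using u(1) by (intro eq_vecI) auto
      then show False using u(2) by blast
    qed
    have "(\<Sum>j<n. T x i j * C x k j) = (if i = k then Determinant.det (A x) else 0)" if k: "k < n" for k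
    proof -
      have "(A x * adj_mat (A x)) $$ (i, k) = (\<Sum>j<n. A x $$ (i, j) * adj_mat (A x) $$ (j, k))"
        using i k adj_mat(1)[OF Ac[of x]] Ac[of x] by (simp add: scalar_prod_def atLeast0LessThan)
      also have "\<dots> = (\<Sum>j<n. T x i j * C x k j)"
      proof (rule sum.cong[OF refl])
        fix j assume "j \<in> {..<n}"
        then have "A x $$ (i, j) = T x i j" "adj_mat (A x) $$ (j, k) = C x k j"
          using i adj[OF _ k] by (simp_all add: A_def)
        then show "A x $$ (i, j) * adj_mat (A x) $$ (j, k) = T x i j * C x k j" by simp
      qed
      finally have "(A x * adj_mat (A x)) $$ (i, k) = (\<Sum>j<n. T x i j * C x k j)" .
      then show ?thesis unfolding adj_mat(2)[OF Ac] using i k by (cases "i = k") auto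
    qed
    then have "(\<Sum>k<n. (\<Sum>j<n. T x i j * C x k j) * v x k) = Determinant.det (A x) * v x i"
      using i by (simp add: if_distrib[of "\<lambda>z. z * _"] cong: if_cong)
    moreover have "(\<Sum>j<n. T x i j * d x j) = (\<Sum>k<n. (\<Sum>j<n. T x i j * C x k j) * v x k) / Determinant.det (A x)"
    proof -
      have "(\<Sum>j<n. T x i j * (\<Sum>k<n. C x k j * v x k)) = (\<Sum>k<n. (\<Sum>j<n. T x i j * C x k j) * v x k)"
        unfolding sum_distrib_left sum_distrib_right
        by (subst sum.swap) (simp add: mult.assoc)
      then show ?thesis unfolding d_def by (simp add: sum_divide_distrib[symmetric])
    qed
    ultimately show ?thesis using det by simp
  qed
  ultimately show ?thesis using that by blast
qed

subsection \<open>The kernel of a matrix of corank one\<close>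

definition rows_independent :: "nat \<Rightarrow> nat \<Rightarrow> (nat \<Rightarrow> nat \<Rightarrow> complex) \<Rightarrow> bool" where
  "rows_independent m n r \<longleftrightarrow>
     (\<forall>c. (\<forall>k<n. (\<Sum>i<m. c i * r i k) = 0) \<longrightarrow> (\<forall>i<m. c i = 0))"

lemma mult_mat_vec_sum:
  assumes "A \<in> carrier_mat m n" "u \<in> carrier_vec n" "i < m"
  shows "vec_index (A *\<^sub>v u) i = (\<Sum>j<n. A $$ (i, j) * vec_index u j)"
  using assms by (auto simp: scalar_prod_def atLeast0LessThan)

text \<open>Expanding along the first row shows that the bilinear pairing with the cross product is the
  determinant obtained by putting the vector on top.\<close>

lemma cross_product_eq_det:
  assumes "length rs = m" and "u \<in> carrier_vec (m + 1)"
  shows "(\<Sum>k<m + 1. vec_index u k * vec_index (cross_product rs) k) =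
    Determinant.det (Matrix.mat (m + 1) (m + 1)
      (\<lambda>(i, k). if i = 0 then vec_index u k else vec_index (rs ! (i - 1)) k))" (is "_ = Determinant.det ?A")
proof -
  have A: "?A \<in> carrier_mat (m + 1) (m + 1)" by simp
  have "Determinant.det ?A = (\<Sum>k<m + 1. ?A $$ (0, k) * cofactor ?A 0 k)"
    by (rule laplace_expansion_row[OF A]) simp
  also have "\<dots> = (\<Sum>k<m + 1. vec_index u k * vec_index (cross_product rs) k)"
  proof (rule sum.cong[OF refl])
    fix k assume "k \<in> {..<m + 1}"
    then have k: "k < m + 1" by simp
    have "mat_delete ?A 0 k = Matrix.mat m m (\<lambda>(i, j). vec_index (rs ! i) (if j < k then j else j + 1))"
      unfolding mat_delete_def by (rule eq_matI) auto
    then show "?A $$ (0, k) * cofactor ?A 0 k = vec_index u k * vec_index (cross_product rs) k"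
      using k assms(1) unfolding cofactor_def cross_product_def by (simp add: Let_def)
  qed
  finally show ?thesis ..
qed

lemma cross_product_dim: "dim_vec (cross_product rs) = length rs + 1"
  unfolding cross_product_def by (simp add: Let_def)

lemma cross_product_orthogonal:
  assumes rs: "length rs = m" "\<And>i. i < m \<Longrightarrow> rs ! i \<in> carrier_vec (m + 1)" and i: "i < m"
  shows "(\<Sum>k<m + 1. vec_index (rs ! i) k * vec_index (cross_product rs) k) = 0"
proof -
  let ?A = "Matrix.mat (m + 1) (m + 1)
      (\<lambda>(a, k). if a = 0 then vec_index (rs ! i) k else vec_index (rs ! (a - 1)) k)"
  have "Determinant.det ?A = 0"
    by (rule det_identical_rows[of _ "m + 1" 0 "i + 1"]) (use i in \<open>auto intro!: eq_vecI\<close>)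
  then show ?thesis
    using cross_product_eq_det[OF rs(1) rs(2)[OF i]] by simp
qed

text \<open>If \<open>u\<close> were nonzero, then putting the row \<open>conjugate u\<close>, which is orthogonal to all the others,
  on top of the independent rows would give a nonsingular matrix; but its determinant is the inner
  product of the cross product with \<open>u\<close>.\<close>

lemma kernel_orthogonal_to_cross_product:
  fixes u :: "complex Matrix.vec"
  assumes rs: "length rs = m" "\<And>i. i < m \<Longrightarrow> rs ! i \<in> carrier_vec (m + 1)"
    and indep: "rows_independent m (m + 1) (\<lambda>i. vec_index (rs ! i))"
    and u: "u \<in> carrier_vec (m + 1)" "\<And>i. i < m \<Longrightarrow> (\<Sum>k<m + 1. vec_index (rs ! i) k * vec_index u k) = 0"
    and orth: "(\<Sum>k<m + 1. cnj (vec_index u k) * vec_index (cross_product rs) k) = 0"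
  shows "u = 0\<^sub>v (m + 1)"
proof (rule ccontr)
  assume "u \<noteq> 0\<^sub>v (m + 1)"
  then obtain k0 where k0: "k0 < m + 1" "vec_index u k0 \<noteq> 0"
    using u(1) by (metis carrier_vecD eq_vecI index_zero_vec)
  let ?A = "Matrix.mat (m + 1) (m + 1)
      (\<lambda>(i, k). if i = 0 then vec_index (conjugate u) k else vec_index (rs ! (i - 1)) k)"
  have A: "transpose_mat ?A \<in> carrier_mat (m + 1) (m + 1)" by simp
  have "(\<Sum>k<m + 1. vec_index (conjugate u) k * vec_index (cross_product rs) k) = 0"
    using orth u(1) by simp
  then have "Determinant.det (transpose_mat ?A) = 0"
    using cross_product_eq_det[OF rs(1), of "conjugate u"] u(1)
    by (subst det_transpose[of _ "m + 1"]) auto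
  then obtain w where w: "w \<in> carrier_vec (m + 1)" "w \<noteq> 0\<^sub>v (m + 1)" "transpose_mat ?A *\<^sub>v w = 0\<^sub>v (m + 1)"
    using det_0_iff_vec_prod_zero_field[OF A] by blast
  have comb: "vec_index w 0 * cnj (vec_index u k) + (\<Sum>i<m. vec_index w (Suc i) * vec_index (rs ! i) k) = 0"
    if k: "k < m + 1" for k
  proof -
    have "0 = vec_index (transpose_mat ?A *\<^sub>v w) k" using w(3) k by simp
    also have "\<dots> = (\<Sum>i<Suc m. transpose_mat ?A $$ (k, i) * vec_index w i)"
      using mult_mat_vec_sum[OF A w(1) k] by simp
    also have "\<dots> = vec_index w 0 * cnj (vec_index u k) + (\<Sum>i<m. vec_index w (Suc i) * vec_index (rs ! i) k)"
      unfolding sum.lessThan_Suc_shift using k u(1) by (simp add: mult.commute)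
    finally show ?thesis ..
  qed
  have "0 = (\<Sum>k<m + 1. (vec_index w 0 * cnj (vec_index u k) +
      (\<Sum>i<m. vec_index w (Suc i) * vec_index (rs ! i) k)) * vec_index u k)"
    using comb by (intro sum.neutral[symmetric]) simp
  also have "\<dots> = vec_index w 0 * (\<Sum>k<m + 1. cnj (vec_index u k) * vec_index u k) +
      (\<Sum>k<m + 1. \<Sum>i<m. vec_index w (Suc i) * vec_index (rs ! i) k * vec_index u k)"
    by (simp only: distrib_right sum.distrib sum_distrib_left sum_distrib_right mult.assoc)
  also have "(\<Sum>k<m + 1. \<Sum>i<m. vec_index w (Suc i) * vec_index (rs ! i) k * vec_index u k) =
      (\<Sum>i<m. vec_index w (Suc i) * (\<Sum>k<m + 1. vec_index (rs ! i) k * vec_index u k))"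
    by (subst sum.swap) (simp only: sum_distrib_left mult.assoc)
  also have "\<dots> = 0" using u(2) by (intro sum.neutral) auto
  finally have "vec_index w 0 * (\<Sum>k<m + 1. cnj (vec_index u k) * vec_index u k) = 0" by simp
  moreover have "(\<Sum>k<m + 1. cnj (vec_index u k) * vec_index u k) \<noteq> 0"
  proof -
    have "(\<Sum>k<m + 1. cnj (vec_index u k) * vec_index u k) =
        complex_of_real (\<Sum>k<m + 1. (cmod (vec_index u k))\<^sup>2)"
      by (simp add: complex_norm_square mult.commute del: of_real_power)
    moreover have "0 < (\<Sum>k<m + 1. (cmod (vec_index u k))\<^sup>2)"
      by (rule sum_pos2[of _ k0]) (use k0 in auto)
    ultimately show ?thesis by (metis less_irrefl of_real_eq_0_iff)
  qed
  ultimately have w0: "vec_index w 0 = 0" by simp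
  then have "vec_index w (Suc i) = 0" if "i < m" for i
    using indep[unfolded rows_independent_def, rule_format, of "\<lambda>i. vec_index w (Suc i)"] comb that by simp
  with w0 have "vec_index w i = 0" if "i < m + 1" for i
    using that by (cases i) auto
  then have "w = 0\<^sub>v (m + 1)" using w(1) by (intro eq_vecI) auto
  then show False using w(2) by blast
qed

text \<open>The matrix has one more column than rows, so its kernel contains a nonzero vector.  If the cross
  product were zero, it would be orthogonal to that vector.\<close>

lemma cross_product_nonzero:
  assumes rs: "length rs = m" "\<And>i. i < m \<Longrightarrow> rs ! i \<in> carrier_vec (m + 1)"
    and indep: "rows_independent m (m + 1) (\<lambda>i. vec_index (rs ! i))"
  shows "cross_product rs \<noteq> 0\<^sub>v (m + 1)"
proof
  assume W: "cross_product rs = 0\<^sub>v (m + 1)"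
  let ?A = "Matrix.mat (m + 1) (m + 1)
      (\<lambda>(i, k). if i = 0 then vec_index (0\<^sub>v (m + 1)) k else vec_index (rs ! (i - 1)) k)"
  have A: "?A \<in> carrier_mat (m + 1) (m + 1)" by simp
  have "Determinant.det ?A = 0"
    unfolding cross_product_eq_det[OF rs(1) zero_carrier_vec, symmetric] by simp
  then obtain u where u: "u \<in> carrier_vec (m + 1)" "u \<noteq> 0\<^sub>v (m + 1)" "?A *\<^sub>v u = 0\<^sub>v (m + 1)"
    using det_0_iff_vec_prod_zero_field[OF A] by blast
  have "(\<Sum>k<m + 1. vec_index (rs ! i) k * vec_index u k) = 0" if i: "i < m" for i
  proof -
    have "0 = vec_index (?A *\<^sub>v u) (Suc i)" using u(3) i by simp
    also have "\<dots> = (\<Sum>k<m + 1. ?A $$ (Suc i, k) * vec_index u k)"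
      by (rule mult_mat_vec_sum[OF A u(1)]) (use i in simp)
    also have "\<dots> = (\<Sum>k<m + 1. vec_index (rs ! i) k * vec_index u k)"
      by (rule sum.cong) (use i in auto)
    finally show ?thesis ..
  qed
  then have "u = 0\<^sub>v (m + 1)"
    using W by (intro kernel_orthogonal_to_cross_product[OF rs indep u(1)]) auto
  then show False using u(2) by blast
qed

text \<open>With \<open>V\<close> the matrix of rows and \<open>W\<close> their cross product, \<open>V G = V\<close> puts the range of \<open>1 - G\<close>
  into the kernel of \<open>V\<close>, which is the line through \<open>W\<close>, and \<open>W\<^sup>* G = 0\<close> makes \<open>u - (1 - G) u\<close>
  orthogonal to \<open>W\<close>.  These are the defining properties of the projection onto \<open>W\<close>.\<close>

lemma orth_projection_onto_corank_one_kernel: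
  fixes G :: "complex Matrix.mat"
  assumes rs: "length rs = m" "\<And>i. i < m \<Longrightarrow> rs ! i \<in> carrier_vec (m + 1)"
    and indep: "rows_independent m (m + 1) (\<lambda>i. vec_index (rs ! i))"
    and G: "G \<in> carrier_mat (m + 1) (m + 1)"
    and fix_mod: "\<And>i k. i < m \<Longrightarrow> k < m + 1 \<Longrightarrow> (\<Sum>j<m + 1. vec_index (rs ! i) j * G $$ (j, k)) = vec_index (rs ! i) k"
    and range: "\<And>k. k < m + 1 \<Longrightarrow> (\<Sum>j<m + 1. G $$ (j, k) * cnj (vec_index (cross_product rs) j)) = 0"
  shows "G = 1\<^sub>m (m + 1) - orth_projection (cross_product rs)"
proof -
  define W where "W = cross_product rs"
  have W: "W \<in> carrier_vec (m + 1)"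
    unfolding W_def by (rule carrier_vecI) (simp add: cross_product_dim rs(1))
  have dimW: "dim_vec W = m + 1" using W by simp
  have cprod: "u \<bullet>c W = (\<Sum>k<m + 1. vec_index u k * cnj (vec_index W k))" for u
    using W by (simp add: scalar_prod_def atLeast0LessThan)
  have "W \<bullet>c W \<noteq> 0"
    unfolding conjugate_square_eq_0_vec[OF W] unfolding W_def by (rule cross_product_nonzero[OF rs indep])
  have P: "is_orth_projection W (1\<^sub>m (m + 1) - G)"
    unfolding is_orth_projection_def dimW
  proof (intro conjI ballI)
    show "1\<^sub>m (m + 1) - G \<in> carrier_mat (m + 1) (m + 1)" by (rule minus_carrier_mat[OF G])
    fix u :: "complex Matrix.vec" assume u: "u \<in> carrier_vec (m + 1)"
    define y where "y = (1\<^sub>m (m + 1) - G) *\<^sub>v u"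
    have y: "y \<in> carrier_vec (m + 1)" unfolding y_def by (rule mult_mat_vec_carrier[OF minus_carrier_mat[OF G] u])
    have yk: "vec_index y k = vec_index u k - (\<Sum>j<m + 1. G $$ (k, j) * vec_index u j)" if k: "k < m + 1" for k
    proof -
      have "y = 1\<^sub>m (m + 1) *\<^sub>v u - G *\<^sub>v u"
        unfolding y_def by (rule minus_mult_distrib_mat_vec[OF one_carrier_mat G u])
      then have "vec_index y k = vec_index u k - vec_index (G *\<^sub>v u) k"
        using k u G by simp
      then show ?thesis using mult_mat_vec_sum[OF G u k] by simp
    qed
    have ker_y: "(\<Sum>k<m + 1. vec_index (rs ! i) k * vec_index y k) = 0" if i: "i < m" for i
    proof -
      have "(\<Sum>k<m + 1. vec_index (rs ! i) k * (\<Sum>j<m + 1. G $$ (k, j) * vec_index u j)) =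
          (\<Sum>j<m + 1. (\<Sum>k<m + 1. vec_index (rs ! i) k * G $$ (k, j)) * vec_index u j)"
        unfolding sum_distrib_left sum_distrib_right by (subst sum.swap) (simp only: mult.assoc)
      also have "\<dots> = (\<Sum>j<m + 1. vec_index (rs ! i) j * vec_index u j)"
        by (rule sum.cong) (use fix_mod[OF i] in auto)
      finally show ?thesis
        using yk by (simp add: right_diff_distrib sum_subtractf del: sum.lessThan_Suc)
    qed
    have ker_W: "(\<Sum>k<m + 1. vec_index (rs ! i) k * vec_index W k) = 0" if "i < m" for i
      unfolding W_def by (rule cross_product_orthogonal[OF rs that])
    define c where "c = (y \<bullet>c W) / (W \<bullet>c W)"
    have "y - c \<cdot>\<^sub>v W = 0\<^sub>v (m + 1)"
    proof (rule kernel_orthogonal_to_cross_product[OF rs indep])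
      show "y - c \<cdot>\<^sub>v W \<in> carrier_vec (m + 1)" using y W by simp
      fix i assume i: "i < m"
      have "(\<Sum>k<m + 1. vec_index (rs ! i) k * vec_index (y - c \<cdot>\<^sub>v W) k) =
          (\<Sum>k<m + 1. vec_index (rs ! i) k * vec_index y k) - c * (\<Sum>k<m + 1. vec_index (rs ! i) k * vec_index W k)"
        using y W by (simp add: right_diff_distrib sum_subtractf sum_distrib_left mult.left_commute del: sum.lessThan_Suc)
      then show "(\<Sum>k<m + 1. vec_index (rs ! i) k * vec_index (y - c \<cdot>\<^sub>v W) k) = 0"
        by (simp only: ker_y[OF i] ker_W[OF i] mult_zero_right diff_0_right)
    next
      have "(y - c \<cdot>\<^sub>v W) \<bullet>c W = 0"
        unfolding cscalar_prod_minus_smult[OF y W] c_def using \<open>W \<bullet>c W \<noteq> 0\<close>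
        by (simp del: conjugate_square_eq_0_vec)
      then have "cnj (\<Sum>k<m + 1. vec_index (y - c \<cdot>\<^sub>v W) k * cnj (vec_index W k)) = 0"
        unfolding cprod by simp
      then show "(\<Sum>k<m + 1. cnj (vec_index (y - c \<cdot>\<^sub>v W) k) * vec_index (cross_product rs) k) = 0"
        unfolding W_def[symmetric] by (simp del: sum.lessThan_Suc)
    qed auto
    then have "y = c \<cdot>\<^sub>v W"
    proof -
      have "vec_index y k = vec_index (c \<cdot>\<^sub>v W) k" if "k < m + 1" for k
      proof -
        have "vec_index (y - c \<cdot>\<^sub>v W) k = 0" using \<open>y - c \<cdot>\<^sub>v W = 0\<^sub>v (m + 1)\<close> that by simp
        then show ?thesis using that y W by simp
      qed
      then show ?thesis using y W by (intro eq_vecI) auto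
    qed
    then show "\<exists>c. (1\<^sub>m (m + 1) - G) *\<^sub>v u = c \<cdot>\<^sub>v W" unfolding y_def by blast
    have "(u - y) \<bullet>c W = (\<Sum>k<m + 1. (\<Sum>j<m + 1. G $$ (k, j) * vec_index u j) * cnj (vec_index W k))"
      unfolding cprod using yk u y by (intro sum.cong) auto
    also have "\<dots> = (\<Sum>j<m + 1. (\<Sum>k<m + 1. G $$ (k, j) * cnj (vec_index W k)) * vec_index u j)"
      unfolding sum_distrib_right by (subst sum.swap) (simp only: mult_ac)
    also have "\<dots> = 0"
      using range unfolding W_def by (intro sum.neutral) auto
    finally show "(u - (1\<^sub>m (m + 1) - G) *\<^sub>v u) \<bullet>c W = 0" unfolding y_def .
  qed
  have "orth_projection W = 1\<^sub>m (m + 1) - G"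
    by (rule is_orth_projection_unique[OF is_orth_projection_orth_projection P])
  then have "1\<^sub>m (m + 1) - orth_projection W = 1\<^sub>m (m + 1) - (1\<^sub>m (m + 1) - G)" by simp
  also have "\<dots> = G" using G by (intro eq_matI) auto
  finally show ?thesis unfolding W_def ..
qed

lemma one_mat_if_acts_trivially:
  fixes G :: "complex Matrix.mat" and r :: "nat \<Rightarrow> nat \<Rightarrow> complex"
  assumes indep: "rows_independent n n r"
    and G: "G \<in> carrier_mat n n"
    and fix_mod: "\<And>i k. i < n \<Longrightarrow> k < n \<Longrightarrow> (\<Sum>j<n. r i j * G $$ (j, k)) = r i k"
  shows "G = 1\<^sub>m n"
proof -
  define V where "V = Matrix.mat n n (\<lambda>(i, k). r i k)"
  have V: "V \<in> carrier_mat n n" unfolding V_def by simp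
  have "Determinant.det (transpose_mat V) \<noteq> 0"
  proof
    assume "Determinant.det (transpose_mat V) = 0"
    then obtain w where w: "w \<in> carrier_vec n" "w \<noteq> 0\<^sub>v n" "transpose_mat V *\<^sub>v w = 0\<^sub>v n"
      using det_0_iff_vec_prod_zero_field[of "transpose_mat V" n] V by auto
    have "(\<Sum>i<n. vec_index w i * r i k) = 0" if k: "k < n" for k
    proof -
      have "(\<Sum>i<n. transpose_mat V $$ (k, i) * vec_index w i) = 0"
        using mult_mat_vec_sum[of "transpose_mat V" n n w k] V w k by simp
      then show ?thesis using k by (simp add: V_def mult.commute)
    qed
    then have "vec_index w i = 0" if "i < n" for i
      using indep that unfolding rows_independent_def by blast
    then have "w = 0\<^sub>v n" using w(1) by (intro eq_vecI) auto
    then show False using w(2) by blast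
  qed
  then have det: "Determinant.det V \<noteq> 0" using det_transpose[OF V] by simp
  have "V * G = V"
    using V G fix_mod by (intro eq_matI) (auto simp: V_def scalar_prod_def atLeast0LessThan)
  obtain U where U: "U \<in> carrier_mat n n" "U * V = 1\<^sub>m n"
    using det_non_zero_imp_unit[OF V det] unfolding Units_def ring_mat_def by auto
  have "G = U * V * G" using U G by simp
  also have "\<dots> = U * (V * G)" by (rule assoc_mult_mat[OF U(1) V G])
  also have "\<dots> = 1\<^sub>m n" unfolding \<open>V * G = V\<close> by (rule U(2))
  finally show ?thesis .
qed

section \<open>Fibers over one period\<close>

lemma AE_lborel_translate:
  fixes Q :: "real \<Rightarrow> bool"
  assumes "AE x in lborel. Q x"
  shows "AE x in lborel. Q (x + s)"
proof -
  from AE_E[OF assms] obtain N where N: "{x \<in> space lborel. \<not> Q x} \<subseteq> N"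
    and null: "emeasure lborel N = 0" and N_sets: "N \<in> sets lborel" .
  have [measurable]: "N \<in> sets borel" using N_sets by simp
  have "AE x in lborel. x \<notin> N" by (intro AE_not_in null_setsI null N_sets)
  then have "AE x in lborel. s + 1 * x \<notin> N"
    by (intro AE_borel_affine) auto
  then show ?thesis by eventually_elim (use N in \<open>auto simp: add.commute\<close>)
qed

text \<open>Functions vanishing off \<open>[-\<omega>, \<omega>]\<close> are cut into \<open>2 l\<close> pieces of length \<open>h\<close>: for \<open>x \<in> [0, h)\<close> the
  points \<open>x + (i - l) h\<close> with \<open>i < 2 l\<close> include all points of \<open>[-\<omega>, \<omega>]\<close> congruent to \<open>x\<close> modulo \<open>h\<close>.\<close>

locale fibers =
  fixes \<omega> h :: real and l :: nat
  assumes \<omega>_pos: "\<omega> > 0" and h_pos: "h > 0" and \<omega>_less: "\<omega> < real l * h"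
begin

definition node :: "nat \<Rightarrow> real \<Rightarrow> real" where
  "node i x = x + (real i - real l) * h"

definition cell :: "real \<Rightarrow> nat" where
  "cell \<xi> = nat (\<lfloor>\<xi> / h\<rfloor> + int l)"

lemma node_measurable [measurable]: "node i \<in> borel_measurable borel"
  unfolding node_def by measurable

lemma in_cell_iff:
  assumes "\<xi> \<in> {-\<omega>..\<omega>}"
  shows "cell \<xi> < 2 * l" and "\<xi> - (real i - real l) * h \<in> {0..<h} \<longleftrightarrow> i = cell \<xi>"
proof -
  have "- real l * h < \<xi>" "\<xi> < real l * h" using assms \<omega>_less by auto
  then have "- real l < \<xi> / h" "\<xi> / h < real l" using h_pos by (simp_all add: field_simps)
  then have b: "- int l \<le> \<lfloor>\<xi> / h\<rfloor>" "\<lfloor>\<xi> / h\<rfloor> < int l" by linarith+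
  then show "cell \<xi> < 2 * l" unfolding cell_def by linarith
  have "\<xi> - (real i - real l) * h \<in> {0..<h} \<longleftrightarrow> \<lfloor>\<xi> / h\<rfloor> = int i - int l"
    using h_pos unfolding floor_eq_iff by (auto simp: field_simps)
  also have "\<dots> \<longleftrightarrow> i = cell \<xi>" using b(1) unfolding cell_def by linarith
  finally show "\<xi> - (real i - real l) * h \<in> {0..<h} \<longleftrightarrow> i = cell \<xi>" .
qed

lemma integral_fibers:
  fixes q :: "real \<Rightarrow> 'b::{banach, second_countable_topology}"
  assumes q: "integrable lborel q" and supp: "\<And>\<xi>. \<xi> \<notin> {-\<omega>..\<omega>} \<Longrightarrow> q \<xi> = 0"
  shows "integrable lborel (\<lambda>x. indicator {0..<h} x *\<^sub>R (\<Sum>i<2 * l. q (node i x)))"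
    and "(LINT \<xi>|lborel. q \<xi>) = (LINT x|lborel. indicator {0..<h} x *\<^sub>R (\<Sum>i<2 * l. q (node i x)))"
proof -
  let ?s = "\<lambda>i. (real i - real l) * h"
  let ?q = "\<lambda>i \<xi>. indicator {0..<h} (\<xi> - ?s i) *\<^sub>R q \<xi>"
  have q_eq: "q \<xi> = (\<Sum>i<2 * l. ?q i \<xi>)" for \<xi>
  proof (cases "\<xi> \<in> {-\<omega>..\<omega>}")
    case True
    have "(\<Sum>i<2 * l. ?q i \<xi>) = (\<Sum>i<2 * l. if i = cell \<xi> then q \<xi> else 0)"
      using in_cell_iff(2)[OF True] by (intro sum.cong) (auto simp: indicator_def)
    then show ?thesis using in_cell_iff(1)[OF True] by simp
  qed (use supp in simp)
  have [measurable]: "q \<in> borel_measurable borel" using borel_measurable_integrable[OF q] by simp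
  have int: "integrable lborel (?q i)" for i :: nat
    by (rule Bochner_Integration.integrable_bound[OF q]) (auto simp: indicator_def)
  have shift: "?q i (?s i + 1 * x) = indicator {0..<h} x *\<^sub>R q (node i x)" for i :: nat and x
    by (simp add: node_def add.commute)
  have int': "integrable lborel (\<lambda>x. indicator {0..<h} x *\<^sub>R q (node i x))" for i :: nat
    using lborel_integrable_real_affine[OF int, where i1 = i and c = 1 and t = "?s i"] unfolding shift by simp
  show "integrable lborel (\<lambda>x. indicator {0..<h} x *\<^sub>R (\<Sum>i<2 * l. q (node i x)))"
    unfolding scaleR_sum_right by (intro Bochner_Integration.integrable_sum int')
  have "(LINT \<xi>|lborel. q \<xi>) = (LINT \<xi>|lborel. (\<Sum>i<2 * l. ?q i \<xi>))"
    by (rule Bochner_Integration.integral_cong[OF refl q_eq])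
  also have "\<dots> = (\<Sum>i<2 * l. LINT \<xi>|lborel. ?q i \<xi>)"
    by (intro Bochner_Integration.integral_sum int)
  also have "\<dots> = (\<Sum>i<2 * l. LINT x|lborel. indicator {0..<h} x *\<^sub>R q (node i x))"
  proof (rule sum.cong[OF refl])
    fix i :: nat
    show "(LINT \<xi>|lborel. ?q i \<xi>) = (LINT x|lborel. indicator {0..<h} x *\<^sub>R q (node i x))"
      by (subst lborel_integral_real_affine[where c = 1 and t = "?s i"]) (simp_all only: shift, simp_all)
  qed
  also have "\<dots> = (LINT x|lborel. indicator {0..<h} x *\<^sub>R (\<Sum>i<2 * l. q (node i x)))"
    unfolding scaleR_sum_right by (intro Bochner_Integration.integral_sum[symmetric] int')
  finally show "(LINT \<xi>|lborel. q \<xi>) = (LINT x|lborel. indicator {0..<h} x *\<^sub>R (\<Sum>i<2 * l. q (node i x)))" .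
qed

lemma sqnorm_fibers:
  assumes g: "g \<in> L2_supported \<omega>"
  shows "integrable lborel (\<lambda>x. indicator {0..<h} x * (\<Sum>i<2 * l. (cmod (g (node i x)))\<^sup>2))"
    and "sqnorm g = (LINT x|lborel. indicator {0..<h} x * (\<Sum>i<2 * l. (cmod (g (node i x)))\<^sup>2))"
  using integral_fibers[OF L2_space_integrable[OF L2_supportedD(1)[OF g]]] L2_supportedD(2)[OF g]
  unfolding sqnorm_def by auto

lemma AE_fibers_imp_AE:
  assumes f: "f \<in> L2_supported \<omega>" and g: "g \<in> L2_supported \<omega>"
    and "AE x in lborel. x \<in> {0..<h} \<longrightarrow> (\<forall>i<2 * l. f (node i x) = g (node i x))"
  shows "AE \<xi> in lborel. f \<xi> = g \<xi>"
proof (rule sqnorm_diff_eq_0_imp_AE[OF L2_supportedD(1)[OF f] L2_supportedD(1)[OF g]])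
  note [measurable] = L2_space_measurable[OF L2_supportedD(1)[OF f]] L2_space_measurable[OF L2_supportedD(1)[OF g]]
  have "(LINT x|lborel. indicator {0..<h} x * (\<Sum>i<2 * l. (cmod (f (node i x) - g (node i x)))\<^sup>2)) =
      (LINT x::real|lborel. (0::real))"
  proof (rule integral_cong_AE)
    show "AE x in lborel. indicator {0..<h} x * (\<Sum>i<2 * l. (cmod (f (node i x) - g (node i x)))\<^sup>2) = 0"
      using assms(3) by eventually_elim (auto simp: indicator_def)
  qed measurable
  then show "sqnorm (\<lambda>\<xi>. f \<xi> - g \<xi>) = 0"
    unfolding sqnorm_fibers(2)[OF L2_supported_diff[OF f g]] by simp
qed

lemma AE_imp_AE_fibers:
  assumes "AE \<xi> in lborel. Q \<xi>"
  shows "AE x in lborel. \<forall>i<2 * l. Q (node i x)"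
proof -
  have "AE x in lborel. \<forall>i\<in>{..<2 * l}. Q (node i x)"
    unfolding node_def by (intro AE_finite_allI AE_lborel_translate assms) auto
  then show ?thesis by eventually_elim auto
qed

text \<open>Gluing inverts the passage to fibers for families that vanish at the nodes outside
  \<open>[-\<omega>, \<omega>]\<close>; the first indicator enforces this.\<close>

definition glue :: "(nat \<Rightarrow> real \<Rightarrow> complex) \<Rightarrow> real \<Rightarrow> complex" where
  "glue u \<xi> = indicator {-\<omega>..\<omega>} \<xi> *
     (\<Sum>i<2 * l. indicator {0..<h} (\<xi> - (real i - real l) * h) * u i (\<xi> - (real i - real l) * h))"

lemma glue_node:
  assumes x: "x \<in> {0..<h}" and i: "i < 2 * l"
  shows "glue u (node i x) = (if node i x \<in> {-\<omega>..\<omega>} then u i x else 0)"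
proof (cases "node i x \<in> {-\<omega>..\<omega>}")
  case True
  have c: "cell (node i x) = i"
    using in_cell_iff(2)[OF True, of i] x by (simp add: node_def)
  have "glue u (node i x) = (\<Sum>j<2 * l. if j = i then u j (node i x - (real j - real l) * h) else 0)"
    unfolding glue_def using True in_cell_iff(2)[OF True] c
    by (auto simp: indicator_def intro!: sum.cong)
  also have "\<dots> = u i (node i x - (real i - real l) * h)" using i by simp
  finally show ?thesis using True by (simp add: node_def)
qed (auto simp: glue_def)

lemma glue_supported:
  assumes [measurable]: "\<And>i. u i \<in> borel_measurable borel"
    and bound: "\<And>i x. i < 2 * l \<Longrightarrow> cmod (u i x) \<le> K"
  shows "glue u \<in> L2_supported \<omega>"
proof (rule L2_supportedI)
  have "cmod (glue u \<xi>) \<le> (\<Sum>i<2 * l. K)" for \<xi>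
  proof -
    have "cmod (glue u \<xi>) \<le>
        cmod (\<Sum>i<2 * l. indicator {0..<h} (\<xi> - (real i - real l) * h) * u i (\<xi> - (real i - real l) * h))"
      unfolding glue_def by (simp add: norm_mult indicator_def)
    also have "\<dots> \<le> (\<Sum>i<2 * l. K)"
    proof (rule sum_norm_le)
      fix i assume "i \<in> {..<2 * l}"
      then have "cmod (u i (\<xi> - (real i - real l) * h)) \<le> K" using bound by simp
      moreover have "0 \<le> K" using calculation norm_ge_zero order_trans by blast
      ultimately show "cmod (indicator {0..<h} (\<xi> - (real i - real l) * h) * u i (\<xi> - (real i - real l) * h)) \<le> K"
        by (simp add: indicator_def)
    qed
    finally show ?thesis .
  qed
  moreover have "glue u \<in> borel_measurable borel" unfolding glue_def by measurable
  ultimately show "glue u \<in> L2_space"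
    by (intro L2_space_bounded_support(1)[of "glue u" _ "-\<omega>" \<omega>]) (auto simp: glue_def)
qed (simp add: glue_def)

end

section \<open>The frame operator on the Fourier side\<close>

text \<open>The functions \<open>p j\<close> stand for the Fourier transforms of the generators.  Their boundedness will
  come from the upper frame inequality; it keeps all products with them square integrable.\<close>

locale generator_fibers = fibers +
  fixes N :: nat and p :: "nat \<Rightarrow> real \<Rightarrow> complex" and C :: real
  assumes p_supported: "j \<in> {1..N} \<Longrightarrow> p j \<in> L2_supported \<omega>"
    and p_bound: "j \<in> {1..N} \<Longrightarrow> cmod (p j \<xi>) \<le> C"
begin

lemma p_measurable: "j \<in> {1..N} \<Longrightarrow> p j \<in> borel_measurable borel"
  using p_supported L2_supportedD(1) L2_space_measurable by blast

lemma p_zero: "j \<in> {1..N} \<Longrightarrow> \<xi> \<notin> {-\<omega>..\<omega>} \<Longrightarrow> p j \<xi> = 0"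
  using L2_supportedD(2)[OF p_supported] by blast

text \<open>The bracket product of \<open>g\<close> and \<open>p j\<close>: one period of the periodization of \<open>g * cnj (p j)\<close>.\<close>

definition bracket :: "nat \<Rightarrow> (real \<Rightarrow> complex) \<Rightarrow> real \<Rightarrow> complex" where
  "bracket j g x = indicator {0..<h} x * (\<Sum>i<2 * l. g (node i x) * cnj (p j (node i x)))"

text \<open>The inner product of the function with transform \<open>g\<close> and the \<open>n\<close>-th translate of the \<open>j\<close>-th
  generator, computed on the Fourier side.\<close>

definition coeff :: "nat \<Rightarrow> (real \<Rightarrow> complex) \<Rightarrow> int \<Rightarrow> complex" where
  "coeff j g n = L2_inner g (\<lambda>\<xi>. expo h n \<xi> * p j \<xi>)"

lemma bracket_L2:
  assumes j: "j \<in> {1..N}" and g: "g \<in> L2_supported \<omega>"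
  shows "bracket j g \<in> L2_space"
proof (rule L2_spaceI)
  note [measurable] = p_measurable[OF j] L2_space_measurable[OF L2_supportedD(1)[OF g]]
  show m [measurable]: "bracket j g \<in> borel_measurable borel" unfolding bracket_def by measurable
  have int: "integrable lborel (\<lambda>x. (real (2 * l) * C\<^sup>2) *
      (indicator {0..<h} x * (\<Sum>i<2 * l. (cmod (g (node i x)))\<^sup>2)))"
    using sqnorm_fibers(1)[OF g] by (rule integrable_mult_right)
  have le: "(cmod (bracket j g x))\<^sup>2 \<le>
      (real (2 * l) * C\<^sup>2) * (indicator {0..<h} x * (\<Sum>i<2 * l. (cmod (g (node i x)))\<^sup>2))" for x
  proof -
    have "(cmod (\<Sum>i<2 * l. g (node i x) * cnj (p j (node i x))))\<^sup>2 \<le>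
        real (2 * l) * (\<Sum>i<2 * l. (cmod (g (node i x) * cnj (p j (node i x))))\<^sup>2)"
      using cmod_sum_power2_le[of "{..<2 * l}" "\<lambda>i. g (node i x) * cnj (p j (node i x))"] by simp
    also have "\<dots> \<le> real (2 * l) * (\<Sum>i<2 * l. C\<^sup>2 * (cmod (g (node i x)))\<^sup>2)"
    proof (intro mult_left_mono sum_mono)
      fix i
      have "(cmod (p j (node i x)))\<^sup>2 * (cmod (g (node i x)))\<^sup>2 \<le> C\<^sup>2 * (cmod (g (node i x)))\<^sup>2"
        by (intro mult_right_mono power_mono p_bound[OF j]) auto
      then show "(cmod (g (node i x) * cnj (p j (node i x))))\<^sup>2 \<le> C\<^sup>2 * (cmod (g (node i x)))\<^sup>2"
        by (simp add: norm_mult power_mult_distrib mult.commute)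
    qed simp
    finally show ?thesis
      by (cases "x \<in> {0..<h}") (auto simp: bracket_def sum_distrib_left mult.assoc)
  qed
  show "integrable lborel (\<lambda>x. (cmod (bracket j g x))\<^sup>2)"
    by (rule Bochner_Integration.integrable_bound[OF int]) (auto intro!: AE_I2 order_trans[OF le])
qed

lemma bracket_zero: "x \<notin> {0..0 + h} \<Longrightarrow> bracket j g x = 0"
  by (auto simp: bracket_def)

lemma cis_node: "expo h n (node i x) = expo h n x"
proof -
  have "of_int n * (2 * pi / h) * node i x =
      of_int n * (2 * pi / h) * x + 2 * pi * of_int (n * (int i - int l))"
    using h_pos by (simp add: node_def field_simps)
  then show ?thesis
    by (metis Ints_of_int cis_mult cis_multiple_2pi mult.right_neutral)
qed

text \<open>Because the exponentials of the translation lattice are \<open>h\<close>-periodic, the inner products with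
  the translates are the Fourier coefficients of the bracket.\<close>

lemma coeff_eq_bracket:
  assumes j: "j \<in> {1..N}" and g: "g \<in> L2_supported \<omega>"
  shows "coeff j g n = (LINT x|lborel. bracket j g x * cis (- (of_int n * (2 * pi / h) * x)))"
proof -
  let ?q = "\<lambda>\<xi>. g \<xi> * cnj (expo h n \<xi> * p j \<xi>)"
  have int: "integrable lborel ?q"
    by (rule L2_inner_integrable)
      (use g p_supported[OF j] L2_supported_cis_mult[OF p_supported[OF j]] L2_supportedD(1) in blast)+
  have "coeff j g n = (LINT x|lborel. indicator {0..<h} x *\<^sub>R (\<Sum>i<2 * l. ?q (node i x)))"
    unfolding coeff_def L2_inner_def
    by (rule integral_fibers(2)[OF int]) (use L2_supportedD(2)[OF g] in auto)
  also have "\<dots> = (LINT x|lborel. bracket j g x * cis (- (of_int n * (2 * pi / h) * x)))"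
  proof (rule Bochner_Integration.integral_cong[OF refl])
    fix x
    have "(\<Sum>i<2 * l. ?q (node i x)) =
        (\<Sum>i<2 * l. g (node i x) * cnj (p j (node i x))) * cis (- (of_int n * (2 * pi / h) * x))"
      unfolding sum_distrib_right complex_cnj_mult cis_cnj cis_node[of n, unfolded] 
      by (intro sum.cong refl) (simp add: cis_cnj[symmetric] cis_node)
    then show "indicator {0..<h} x *\<^sub>R (\<Sum>i<2 * l. ?q (node i x)) =
        bracket j g x * cis (- (of_int n * (2 * pi / h) * x))"
      unfolding bracket_def by (simp add: indicator_def)
  qed
  finally show ?thesis .
qed

lemma coeff_has_sum:
  assumes j: "j \<in> {1..N}" and g: "g \<in> L2_supported \<omega>"
  shows "((\<lambda>n. (cmod (coeff j g n))\<^sup>2) has_sum (h * sqnorm (bracket j g))) UNIV"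
  using Fourier_series_Parseval(2)[OF h_pos bracket_L2[OF j g], of 0] bracket_zero
  unfolding coeff_eq_bracket[OF j g] by blast

text \<open>On each fiber the frame operator is \<open>h\<close> times that of the vectors
  \<open>(p j (node i x))\<^sub>i\<close>.\<close>

definition fiber_frame_op :: "(real \<Rightarrow> complex) \<Rightarrow> real \<Rightarrow> complex" where
  "fiber_frame_op g \<xi> = (\<Sum>j\<in>{1..N}.
     p j \<xi> * (\<Sum>i<2 * l. complex_of_real h * bracket j g (\<xi> - (real i - real l) * h)))"

lemma p_mult_shifted_bracket_supported:
  assumes j: "j \<in> {1..N}" and g: "g \<in> L2_supported \<omega>"
  shows "(\<lambda>\<xi>. p j \<xi> * (\<Sum>i<2 * l. complex_of_real h * bracket j g (\<xi> - (real i - real l) * h))) \<in> L2_supported \<omega>"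
proof (rule L2_supportedI)
  have shift: "(\<lambda>\<xi>. f (\<xi> - s)) \<in> L2_space" if f: "f \<in> L2_space" for f s
  proof -
    note [measurable] = L2_space_measurable[OF f]
    have "integrable lborel (\<lambda>\<xi>. (cmod (f (- s + 1 * \<xi>)))\<^sup>2)"
      by (rule lborel_integrable_real_affine[OF L2_space_integrable[OF f]]) simp
    then show ?thesis by (intro L2_spaceI) (auto simp: add.commute)
  qed
  have "(\<lambda>\<xi>. \<Sum>i<2 * l. complex_of_real h * bracket j g (\<xi> - (real i - real l) * h)) \<in> L2_space"
    by (intro L2_space_sum L2_space_scale shift bracket_L2[OF j g])
  then show "(\<lambda>\<xi>. p j \<xi> * (\<Sum>i<2 * l. complex_of_real h * bracket j g (\<xi> - (real i - real l) * h))) \<in> L2_space"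
    by (rule L2_space_bounded_mult(1)[OF _ p_measurable[OF j] p_bound[OF j]])
qed (use p_zero[OF j] in simp)

lemma fiber_frame_op_supported:
  "g \<in> L2_supported \<omega> \<Longrightarrow> fiber_frame_op g \<in> L2_supported \<omega>"
  unfolding fiber_frame_op_def by (intro L2_supported_sum p_mult_shifted_bracket_supported)

lemma shifted_bracket_node:
  assumes x: "x \<in> {0..<h}" and i: "i < 2 * l"
  shows "(\<Sum>i'<2 * l. complex_of_real h * bracket j g (node i x - (real i' - real l) * h)) =
    complex_of_real h * bracket j g x"
proof -
  have "node i x - (real i' - real l) * h \<notin> {0..<h}" if "i' \<noteq> i" for i'
  proof
    assume "node i x - (real i' - real l) * h \<in> {0..<h}"
    then have "\<lfloor>(node i x - (real i' - real l) * h) / h\<rfloor> = 0" "\<lfloor>x / h\<rfloor> = 0"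
      using x h_pos by (auto simp: floor_eq_iff)
    moreover have "(node i x - (real i' - real l) * h) / h = x / h + of_int (int i - int i')"
      using h_pos by (simp add: node_def field_simps)
    then have "\<lfloor>(node i x - (real i' - real l) * h) / h\<rfloor> = \<lfloor>x / h\<rfloor> + (int i - int i')"
      by (simp only: floor_add_int[symmetric])
    ultimately show False using that by simp
  qed
  then have "(\<Sum>i'<2 * l. complex_of_real h * bracket j g (node i x - (real i' - real l) * h)) =
      (\<Sum>i'<2 * l. if i' = i then complex_of_real h * bracket j g x else 0)"
    by (intro sum.cong) (auto simp: bracket_def node_def)
  then show ?thesis using i by simp
qed

lemma fiber_frame_op_node:
  assumes "x \<in> {0..<h}" and "i < 2 * l"
  shows "fiber_frame_op g (node i x) =
    complex_of_real h * (\<Sum>j\<in>{1..N}. p j (node i x) * bracket j g x)"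
  unfolding fiber_frame_op_def shifted_bracket_node[OF assms] sum_distrib_left
  by (intro sum.cong) auto

text \<open>The expansion converges because \<open>p j\<close> is bounded and the Fourier series of the bracket
  converges in the square mean over one period.\<close>

lemma fiber_frame_op_expansion:
  assumes g: "g \<in> L2_supported \<omega>"
  shows "((\<lambda>Q. sqnorm (\<lambda>\<xi>. (\<Sum>(j, n)\<in>Q. coeff j g n * (expo h n \<xi> * p j \<xi>)) -
      fiber_frame_op g \<xi>)) \<longlongrightarrow> 0) (finite_subsets_at_top ({1..N} \<times> UNIV))"
proof -
  define T where "T j A \<xi> = (\<Sum>n\<in>A. coeff j g n * (expo h n \<xi> * p j \<xi>))" for j A \<xi>
  define D where "D j A \<xi> = T j A \<xi> -
      p j \<xi> * (\<Sum>i<2 * l. complex_of_real h * bracket j g (\<xi> - (real i - real l) * h))" for j A \<xi>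
  define R where "R j A = sqnorm (\<lambda>x. bracket j g x -
      (\<Sum>n\<in>A. coeff j g n / complex_of_real h * harmonic 0 h n x))" for j A
  have R: "((\<lambda>A. R j A) \<longlongrightarrow> 0) (finite_subsets_at_top UNIV)" if j: "j \<in> {1..N}" for j
    using Fourier_series_Parseval(1)[OF h_pos bracket_L2[OF j g], of 0] bracket_zero
    unfolding R_def coeff_eq_bracket[OF j g] by blast
  have T: "T j A \<in> L2_supported \<omega>" if j: "j \<in> {1..N}" for j A
    unfolding T_def by (intro L2_supported_sum L2_supported_scale L2_supported_cis_mult p_supported[OF j])
  have D: "D j A \<in> L2_supported \<omega>" if j: "j \<in> {1..N}" for j A
    unfolding D_def by (rule L2_supported_diff[OF T[OF j] p_mult_shifted_bracket_supported[OF j g]])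
  have DR: "sqnorm (D j A) \<le> real (2 * l) * (C * h)\<^sup>2 * R j A" if j: "j \<in> {1..N}" for j A
  proof -
    let ?r = "\<lambda>x. bracket j g x - (\<Sum>n\<in>A. coeff j g n / complex_of_real h * harmonic 0 h n x)"
    have r: "?r \<in> L2_space"
      by (intro L2_space_diff L2_space_sum L2_space_scale bracket_L2[OF j g] harmonic_L2)
    have le: "indicator {0..<h} x * (\<Sum>i<2 * l. (cmod (D j A (node i x)))\<^sup>2) \<le>
        real (2 * l) * (C * h)\<^sup>2 * (cmod (?r x))\<^sup>2" for x
    proof (cases "x \<in> {0..<h}")
      case True
      have "(cmod (D j A (node i x)))\<^sup>2 \<le> (C * h)\<^sup>2 * (cmod (?r x))\<^sup>2" if i: "i \<in> {..<2 * l}" for i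
      proof -
        have "T j A (node i x) = p j (node i x) * (complex_of_real h *
            (\<Sum>n\<in>A. coeff j g n / complex_of_real h * harmonic 0 h n x))"
          unfolding T_def cis_node harmonic_def sum_distrib_left using h_pos True
          by (intro sum.cong) auto
        then have "D j A (node i x) = - (p j (node i x) * complex_of_real h * ?r x)"
          unfolding D_def shifted_bracket_node[OF True, of i, simplified, OF i[simplified]]
          by (simp add: algebra_simps)
        then have "(cmod (D j A (node i x)))\<^sup>2 = (cmod (p j (node i x)) * h * cmod (?r x))\<^sup>2"
          using h_pos by (simp add: norm_mult)
        also have "\<dots> \<le> (C * h * cmod (?r x))\<^sup>2"
          using h_pos by (intro power_mono mult_right_mono p_bound[OF j]) auto
        finally show ?thesis by (simp add: power_mult_distrib)
      qed
      then have "(\<Sum>i<2 * l. (cmod (D j A (node i x)))\<^sup>2) \<le> (\<Sum>i<2 * l. (C * h)\<^sup>2 * (cmod (?r x))\<^sup>2)"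
        by (rule sum_mono)
      then show ?thesis using True by simp
    qed simp
    have "sqnorm (D j A) \<le> (LINT x|lborel. real (2 * l) * (C * h)\<^sup>2 * (cmod (?r x))\<^sup>2)"
      unfolding sqnorm_fibers(2)[OF D[OF j]]
      using L2_space_integrable[OF r] by (intro integral_mono sqnorm_fibers(1)[OF D[OF j]] le) simp
    then show ?thesis unfolding R_def by (simp add: sqnorm_def)
  qed
  let ?F = "finite_subsets_at_top ({1..N} \<times> (UNIV :: int set))"
  let ?sec = "\<lambda>j Q. {n. (j, n) \<in> Q}"
  have sec: "filterlim (?sec j) (finite_subsets_at_top UNIV) ?F" if j: "j \<in> {1..N}" for j
    unfolding filterlim_iff
  proof (intro allI impI)
    fix P assume "eventually P (finite_subsets_at_top (UNIV :: int set))"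
    then obtain X where X: "finite X" "\<And>Y. finite Y \<Longrightarrow> X \<subseteq> Y \<Longrightarrow> P Y"
      unfolding eventually_finite_subsets_at_top by auto
    have "P (?sec j Q)" if Q: "finite Q" "{j} \<times> X \<subseteq> Q" for Q
    proof (rule X(2))
      show "finite (?sec j Q)"
        by (rule finite_subset[OF _ finite_imageI[OF Q(1), of snd]]) force
      show "X \<subseteq> ?sec j Q" using Q(2) by auto
    qed
    then show "\<forall>\<^sub>F Q in ?F. P (?sec j Q)"
      unfolding eventually_finite_subsets_at_top using X(1) j
      by (intro exI[of _ "{j} \<times> X"]) auto
  qed
  have "((\<lambda>Q. real N * (\<Sum>j\<in>{1..N}. real (2 * l) * (C * h)\<^sup>2 * R j (?sec j Q))) \<longlongrightarrow>
      real N * (\<Sum>j\<in>{1..N}. real (2 * l) * (C * h)\<^sup>2 * 0)) ?F"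
    by (intro tendsto_intros filterlim_compose[OF R sec])
  then have lim: "((\<lambda>Q. real N * (\<Sum>j\<in>{1..N}. real (2 * l) * (C * h)\<^sup>2 * R j (?sec j Q))) \<longlongrightarrow> 0) ?F"
    by simp
  have bound: "sqnorm (\<lambda>\<xi>. (\<Sum>(j, n)\<in>Q. coeff j g n * (expo h n \<xi> * p j \<xi>)) -
        fiber_frame_op g \<xi>) \<le> real N * (\<Sum>j\<in>{1..N}. real (2 * l) * (C * h)\<^sup>2 * R j (?sec j Q))"
    if Q: "finite Q" "Q \<subseteq> {1..N} \<times> UNIV" for Q
  proof -
    have fin: "finite (?sec j Q)" for j
      by (rule finite_subset[OF _ finite_imageI[OF Q(1), of snd]]) force
    have Q_eq: "Q = (SIGMA j:{1..N}. ?sec j Q)" using Q(2) by auto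
    have "(\<Sum>(j, n)\<in>Q. coeff j g n * (expo h n \<xi> * p j \<xi>)) =
        (\<Sum>j\<in>{1..N}. T j (?sec j Q) \<xi>)" for \<xi>
      unfolding T_def by (subst Q_eq, rule sum.Sigma[symmetric]) (simp_all add: fin)
    then have "sqnorm (\<lambda>\<xi>. (\<Sum>(j, n)\<in>Q. coeff j g n * (expo h n \<xi> * p j \<xi>)) -
        fiber_frame_op g \<xi>) = sqnorm (\<lambda>\<xi>. \<Sum>j\<in>{1..N}. D j (?sec j Q) \<xi>)"
      unfolding D_def fiber_frame_op_def by (simp add: sum_subtractf)
    also have "\<dots> \<le> real (card {1..N}) * (\<Sum>j\<in>{1..N}. sqnorm (D j (?sec j Q)))"
      by (rule sqnorm_sum_le) (use D L2_supportedD(1) in auto)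
    also have "\<dots> \<le> real N * (\<Sum>j\<in>{1..N}. real (2 * l) * (C * h)\<^sup>2 * R j (?sec j Q))"
      by (simp only: card_atLeastAtMost diff_Suc_1 Suc_eq_plus1[symmetric]) (intro mult_left_mono sum_mono DR; simp)
    finally show ?thesis .
  qed
  show ?thesis
  proof (rule Lim_null_comparison[OF _ lim], rule eventually_finite_subsets_at_top_weakI)
    fix Q :: "(nat \<times> int) set" assume "finite Q" "Q \<subseteq> {1..N} \<times> UNIV"
    from bound[OF this]
    show "norm (sqnorm (\<lambda>\<xi>. (\<Sum>(j, n)\<in>Q. coeff j g n * (expo h n \<xi> * p j \<xi>)) -
        fiber_frame_op g \<xi>)) \<le> real N * (\<Sum>j\<in>{1..N}. real (2 * l) * (C * h)\<^sup>2 * R j (?sec j Q))"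
      by simp
  qed
qed

end

locale generator_frame = generator_fibers +
  fixes A :: real
  assumes A_pos: "A > 0"
    and lower: "g \<in> L2_supported \<omega> \<Longrightarrow> A * sqnorm g \<le> (\<Sum>j\<in>{1..N}. h * sqnorm (bracket j g))"
begin

text \<open>Nonnegativity of the defect is the lower frame inequality on the fiber over \<open>x\<close>.  Vectors are
  indexed by all \<open>2 l\<close> nodes, so that the index set does not depend on \<open>x\<close>; \<open>of_bool\<close> discards the
  nodes outside \<open>[-\<omega>, \<omega>]\<close>, where the transforms vanish.\<close>

definition defect :: "real \<Rightarrow> (nat \<Rightarrow> complex) \<Rightarrow> real" where
  "defect x c = h * (\<Sum>j\<in>{1..N}. (cmod (\<Sum>i<2 * l. c i * cnj (p j (node i x))))\<^sup>2) -
     A * (\<Sum>i<2 * l. of_bool (node i x \<in> {-\<omega>..\<omega>}) * (cmod (c i))\<^sup>2)"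

lemma defect_measurable [measurable]: "(\<lambda>x. defect x c) \<in> borel_measurable borel"
proof -
  have [measurable]: "(\<lambda>x. p j (node i x)) \<in> borel_measurable borel" if "j \<in> {1..N}" for i j
    using measurable_compose[OF node_measurable p_measurable[OF that]] .
  show ?thesis unfolding defect_def by measurable
qed

text \<open>Testing the lower frame bound on the function whose fibers are \<open>c\<close> exactly where \<open>defect\<close> is
  negative shows that this set is null.\<close>

lemma defect_nonneg_AE: "AE x in lborel. x \<in> {0..<h} \<longrightarrow> 0 \<le> defect x c"
proof -
  define E where "E = {x \<in> {0..<h}. defect x c < 0}"
  have [measurable]: "E \<in> sets borel" unfolding E_def by measurable
  define g where "g = glue (\<lambda>i x. indicator E x * c i)"
  have g: "g \<in> L2_supported \<omega>"
    unfolding g_def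
  proof (rule glue_supported[where K = "\<Sum>i<2 * l. cmod (c i)"])
    fix i x assume "i < 2 * l"
    then have "cmod (c i) \<le> (\<Sum>i<2 * l. cmod (c i))" by (intro member_le_sum) auto
    then show "cmod (indicator E x * c i) \<le> (\<Sum>i<2 * l. cmod (c i))"
      by (auto simp: indicator_def sum_nonneg)
  qed measurable
  have gn: "g (node i x) = indicator E x * (of_bool (node i x \<in> {-\<omega>..\<omega>}) * c i)"
    if "x \<in> {0..<h}" "i < 2 * l" for i x
    using glue_node[OF that] unfolding g_def by simp
  define F where "F x = h * (\<Sum>j\<in>{1..N}. (cmod (bracket j g x))\<^sup>2) -
      A * (indicator {0..<h} x * (\<Sum>i<2 * l. (cmod (g (node i x)))\<^sup>2))" for x
  have F: "F x = indicator E x * defect x c" for x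
  proof (cases "x \<in> {0..<h}")
    case True
    have "(\<Sum>i<2 * l. g (node i x) * cnj (p j (node i x))) =
        indicator E x * (\<Sum>i<2 * l. c i * cnj (p j (node i x)))" if j: "j \<in> {1..N}" for j
      unfolding sum_distrib_left using gn[OF True] p_zero[OF j]
      by (intro sum.cong) (auto simp del: atLeastAtMost_iff)
    then have "(\<Sum>j\<in>{1..N}. (cmod (bracket j g x))\<^sup>2) =
        indicator E x * (\<Sum>j\<in>{1..N}. (cmod (\<Sum>i<2 * l. c i * cnj (p j (node i x))))\<^sup>2)"
      unfolding sum_distrib_left bracket_def using True
      by (intro sum.cong) (auto simp: indicator_def)
    moreover have "(\<Sum>i<2 * l. (cmod (g (node i x)))\<^sup>2) =
        indicator E x * (\<Sum>i<2 * l. of_bool (node i x \<in> {-\<omega>..\<omega>}) * (cmod (c i))\<^sup>2)"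
      unfolding sum_distrib_left using gn[OF True]
      by (intro sum.cong) (auto simp: indicator_def)
    ultimately show ?thesis
      unfolding F_def defect_def using True by (simp add: right_diff_distrib mult.left_commute del: of_bool_eq_1_iff)
  qed (auto simp: F_def E_def bracket_def indicator_def)
  have bint: "integrable lborel (\<lambda>x. (cmod (bracket j g x))\<^sup>2)" if "j \<in> {1..N}" for j
    by (rule L2_space_integrable[OF bracket_L2[OF that g]])
  have int1: "integrable lborel (\<lambda>x. h * (\<Sum>j\<in>{1..N}. (cmod (bracket j g x))\<^sup>2))"
    by (intro integrable_mult_right Bochner_Integration.integrable_sum bint)
  have int2: "integrable lborel (\<lambda>x. A * (indicator {0..<h} x * (\<Sum>i<2 * l. (cmod (g (node i x)))\<^sup>2)))"
    by (intro integrable_mult_right sqnorm_fibers(1)[OF g])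
  have int: "integrable lborel F"
    unfolding F_def by (rule Bochner_Integration.integrable_diff[OF int1 int2])
  have "(LINT x|lborel. F x) = (\<Sum>j\<in>{1..N}. h * sqnorm (bracket j g)) - A * sqnorm g"
    unfolding F_def Bochner_Integration.integral_diff[OF int1 int2]
    by (simp only: Bochner_Integration.integral_mult_right_zero Bochner_Integration.integral_sum[OF bint]
        sqnorm_fibers(2)[OF g] sqnorm_def[of "bracket j g" for j] sum_distrib_left[symmetric])
  then have pos: "0 \<le> (LINT x|lborel. F x)" using lower[OF g] by simp
  have F_neg: "F x \<le> 0" for x unfolding F by (auto simp: E_def indicator_def)
  then have "(LINT x|lborel. - F x) = 0"
    using pos integral_nonneg_AE[where M = lborel and f = "\<lambda>x. - F x"] by simp
  then have "AE x in lborel. - F x = 0"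
    using integral_nonneg_eq_0_iff_AE[of lborel "\<lambda>x. - F x"] int F_neg by simp
  then show ?thesis
    by eventually_elim (auto simp: F E_def indicator_def split: if_splits)
qed

text \<open>A countable dense set of vectors \<open>c\<close> makes the exceptional null set independent of \<open>c\<close>.\<close>

lemma fiberwise_lower_bound:
  "AE x in lborel. x \<in> {0..<h} \<longrightarrow> (\<forall>c. 0 \<le> defect x c)"
proof -
  obtain D :: "complex set" where D: "countable D" "\<And>X. open X \<Longrightarrow> X \<noteq> {} \<Longrightarrow> \<exists>d\<in>D. d \<in> X"
    using countable_dense_exists[where 'a = complex] by blast
  have "countable (Pi\<^sub>E {..<2 * l} (\<lambda>_. D))"
    by (intro countable_PiE) (auto simp: D)
  then have "AE x in lborel. \<forall>c\<in>Pi\<^sub>E {..<2 * l} (\<lambda>_. D). x \<in> {0..<h} \<longrightarrow> 0 \<le> defect x c"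
    using defect_nonneg_AE by (subst AE_ball_countable) auto
  then show ?thesis
  proof (rule AE_mp, intro AE_I2 impI allI)
    fix x :: real and c :: "nat \<Rightarrow> complex"
    assume *: "\<forall>c\<in>Pi\<^sub>E {..<2 * l} (\<lambda>_. D). x \<in> {0..<h} \<longrightarrow> 0 \<le> defect x c"
      and x: "x \<in> {0..<h}"
    define d where "d m i = (SOME z. z \<in> D \<and> dist z (c i) < inverse (real (Suc m)))" for m i
    have "\<exists>z. z \<in> D \<and> dist z (c i) < inverse (real (Suc m))" for m i
      using D(2)[of "ball (c i) (inverse (real (Suc m)))"] by (auto simp: dist_commute)
    from someI_ex[OF this]
    have d: "d m i \<in> D" "dist (d m i) (c i) < inverse (real (Suc m))" for m i
      unfolding d_def by blast+
    have lim: "(\<lambda>m. d m i) \<longlonglongrightarrow> c i" for i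
    proof (rule metric_tendsto_imp_tendsto[OF LIMSEQ_inverse_real_of_nat], intro always_eventually allI)
      show "dist (d m i) (c i) \<le> dist (inverse (real (Suc m))) 0" for m
        using less_imp_le[OF d(2)[of m i]] by simp
    qed
    have "0 \<le> defect x (restrict (d m) {..<2 * l})" for m
      using * x d(1) by auto
    moreover have "defect x (restrict (d m) {..<2 * l}) = defect x (d m)" for m
    proof -
      have r: "restrict (d m) {..<2 * l} i = d m i" if "i \<in> {..<2 * l}" for i using that by simp
      show ?thesis unfolding defect_def by (simp only: r cong: sum.cong)
    qed
    ultimately have "0 \<le> defect x (d m)" for m by simp
    moreover have "(\<lambda>m. defect x (d m)) \<longlonglongrightarrow> defect x c"
      unfolding defect_def by (intro tendsto_intros lim)
    ultimately show "0 \<le> defect x c"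
      by (intro LIMSEQ_le_const) auto
  qed
qed

text \<open>To invert the frame operators of all fibers on one index set, the identity is added at the
  points outside \<open>[-\<omega>, \<omega>]\<close>; the solution then vanishes there.  The lower bound makes the solution
  bounded, so that its fibers glue to a square integrable function.\<close>

lemma fiber_frame_op_preimage:
  assumes k: "k \<in> {1..N}"
  shows "\<exists>g\<in>L2_supported \<omega>. AE \<xi> in lborel. fiber_frame_op g \<xi> = p k \<xi>"
proof -
  have [measurable]: "(\<lambda>x. p j (node i x)) \<in> borel_measurable borel" if "j \<in> {1..N}" for i j
    using measurable_compose[OF node_measurable p_measurable[OF that]] .
  define T where "T x i i' = complex_of_real h * (\<Sum>j\<in>{1..N}. p j (node i x) * cnj (p j (node i' x))) +
      of_bool (i = i' \<and> node i x \<notin> {-\<omega>..\<omega>})" for x i i'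
  obtain d where dm: "\<And>i. (\<lambda>x. d x i) \<in> borel_measurable borel"
    and d: "\<And>x i. \<forall>c. (\<forall>i<2 * l. (\<Sum>j<2 * l. T x i j * c j) = 0) \<longrightarrow> (\<forall>j<2 * l. c j = 0) \<Longrightarrow>
        i < 2 * l \<Longrightarrow> (\<Sum>j<2 * l. T x i j * d x j) = p k (node i x)"
  proof (rule measurable_linear_solve[of T borel "\<lambda>x i. p k (node i x)" "2 * l"])
    show "(\<lambda>x. T x i j) \<in> borel_measurable borel" for i j unfolding T_def by measurable
    show "(\<lambda>x. p k (node i x)) \<in> borel_measurable borel" for i using k by measurable
  qed blast
  \<comment> \<open>The estimate below shows that \<open>K\<close> bounds the solution, so the clipping in \<open>u\<close> has no effect on
    almost every fiber; it makes \<open>u\<close> bounded everywhere.\<close>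
  define K where "K = sqrt (2 * real l * C\<^sup>2 / A\<^sup>2)"
  define u where "u i x = (if cmod (d x i) \<le> K then d x i else 0)" for i x
  have K: "0 \<le> K" unfolding K_def by simp
  have g: "glue u \<in> L2_supported \<omega>"
  proof (rule glue_supported)
    show "u i \<in> borel_measurable borel" for i
      using dm[of i] unfolding u_def by measurable
    show "cmod (u i x) \<le> K" for i x unfolding u_def using K by simp
  qed
  have main: "fiber_frame_op (glue u) (node i x) = p k (node i x)"
    if x: "x \<in> {0..<h}" and i: "i < 2 * l"
      and nonneg: "\<And>c. 0 \<le> defect x c" for x i
  proof -
    define s where "s c j = (\<Sum>i<2 * l. c i * cnj (p j (node i x)))" for c j
    have low: "A * (\<Sum>i<2 * l. of_bool (node i x \<in> {-\<omega>..\<omega>}) * (cmod (c i))\<^sup>2) \<le>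
        h * (\<Sum>j\<in>{1..N}. (cmod (s c j))\<^sup>2)" for c
      using nonneg[of c] unfolding defect_def s_def by simp
    have T_apply: "(\<Sum>i'<2 * l. T x i i' * c i') =
        complex_of_real h * (\<Sum>j\<in>{1..N}. p j (node i x) * s c j) + of_bool (node i x \<notin> {-\<omega>..\<omega>}) * c i"
      if i: "i < 2 * l" for i c
    proof -
      have "(\<Sum>i'<2 * l. T x i i' * c i') =
          (\<Sum>i'<2 * l. \<Sum>j\<in>{1..N}. complex_of_real h * (p j (node i x) * (c i' * cnj (p j (node i' x))))) +
          (\<Sum>i'<2 * l. if i' = i then of_bool (node i x \<notin> {-\<omega>..\<omega>}) * c i else 0)"
        unfolding T_def sum.distrib[symmetric] distrib_right sum_distrib_left sum_distrib_right
        by (intro sum.cong arg_cong2[of _ _ _ _ "(+)"]) (auto simp: mult_ac)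
      also have "(\<Sum>i'<2 * l. if i' = i then of_bool (node i x \<notin> {-\<omega>..\<omega>}) * c i else 0) =
          of_bool (node i x \<notin> {-\<omega>..\<omega>}) * c i" using i by simp
      also have "(\<Sum>i'<2 * l. \<Sum>j\<in>{1..N}. complex_of_real h * (p j (node i x) * (c i' * cnj (p j (node i' x))))) =
          complex_of_real h * (\<Sum>j\<in>{1..N}. p j (node i x) * s c j)"
        unfolding s_def sum_distrib_left by (rule sum.swap)
      finally show ?thesis .
    qed
    have pair: "(\<Sum>i<2 * l. cnj (c i) * (complex_of_real h * (\<Sum>j\<in>{1..N}. p j (node i x) * s c j))) =
        complex_of_real (h * (\<Sum>j\<in>{1..N}. (cmod (s c j))\<^sup>2))" for c
    proof -
      have "(\<Sum>i<2 * l. cnj (c i) * (complex_of_real h * (\<Sum>j\<in>{1..N}. p j (node i x) * s c j))) =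
          (\<Sum>i<2 * l. \<Sum>j\<in>{1..N}. complex_of_real h * (s c j * cnj (c i * cnj (p j (node i x)))))"
        unfolding sum_distrib_left by (intro sum.cong) (auto simp: mult_ac)
      also have "\<dots> = (\<Sum>j\<in>{1..N}. complex_of_real h * (s c j * cnj (s c j)))"
        unfolding s_def[of c] cnj_sum sum_distrib_left by (rule sum.swap)
      also have "\<dots> = complex_of_real (h * (\<Sum>j\<in>{1..N}. (cmod (s c j))\<^sup>2))"
        by (simp add: complex_norm_square sum_distrib_left del: of_real_power)
      finally show ?thesis .
    qed
    have inj: "c i = 0"
      if T0: "\<And>i. i < 2 * l \<Longrightarrow> (\<Sum>j<2 * l. T x i j * c j) = 0" and i: "i < 2 * l" for c i
    proof -
      have off: "c i = 0" if "i < 2 * l" "node i x \<notin> {-\<omega>..\<omega>}" for i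
        using T0[OF that(1)] T_apply[OF that(1), of c] that(2) p_zero by simp
      have "complex_of_real h * (\<Sum>j\<in>{1..N}. p j (node i x) * s c j) = 0" if "i < 2 * l" for i
        using T0[OF that] T_apply[OF that, of c] off[OF that] by (cases "node i x \<in> {-\<omega>..\<omega>}") auto
      then have "complex_of_real (h * (\<Sum>j\<in>{1..N}. (cmod (s c j))\<^sup>2)) = 0"
        unfolding pair[symmetric] by (intro sum.neutral) auto
      then have h0: "h * (\<Sum>j\<in>{1..N}. (cmod (s c j))\<^sup>2) = 0" using of_real_eq_0_iff by blast
      have "A * (\<Sum>i<2 * l. of_bool (node i x \<in> {-\<omega>..\<omega>}) * (cmod (c i))\<^sup>2) \<le> 0"
        using low[of c] unfolding h0 .
      then have "(\<Sum>i<2 * l. of_bool (node i x \<in> {-\<omega>..\<omega>}) * (cmod (c i))\<^sup>2) \<le> 0"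
        using A_pos by (simp add: mult_le_0_iff)
      then have "(\<Sum>i<2 * l. of_bool (node i x \<in> {-\<omega>..\<omega>}) * (cmod (c i))\<^sup>2) = 0"
        by (intro order_antisym sum_nonneg) auto
      then have "of_bool (node i x \<in> {-\<omega>..\<omega>}) * (cmod (c i))\<^sup>2 = 0"
        using i by (subst (asm) sum_nonneg_eq_0_iff) auto
      then show ?thesis using off[OF i] by (cases "node i x \<in> {-\<omega>..\<omega>}") auto
    qed
    have solve: "(\<Sum>j<2 * l. T x i j * d x j) = p k (node i x)" if "i < 2 * l" for i
      by (rule d[OF _ that]) (use inj in blast)
    have off: "d x i = 0" if "i < 2 * l" "node i x \<notin> {-\<omega>..\<omega>}" for i
      using solve[OF that(1)] T_apply[OF that(1), of "d x"] that(2) p_zero k by simp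
    have fiber: "complex_of_real h * (\<Sum>j\<in>{1..N}. p j (node i x) * s (d x) j) = p k (node i x)"
      if "i < 2 * l" for i
      using solve[OF that] T_apply[OF that, of "d x"] off[OF that] by (cases "node i x \<in> {-\<omega>..\<omega>}") auto
    \<comment> \<open>\<open>C \<bar>d\<bar> \<le> (A / 2) \<bar>d\<bar>\<^sup>2 + C\<^sup>2 / (2 A)\<close> lets half of the lower bound absorb the right-hand side.\<close>
    have "A * (\<Sum>i<2 * l. (cmod (d x i))\<^sup>2) =
        A * (\<Sum>i<2 * l. of_bool (node i x \<in> {-\<omega>..\<omega>}) * (cmod (d x i))\<^sup>2)"
      using off by (intro arg_cong[of _ _ "(*) A"] sum.cong) (auto simp del: atLeastAtMost_iff)
    also have "\<dots> \<le> h * (\<Sum>j\<in>{1..N}. (cmod (s (d x) j))\<^sup>2)"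
      by (rule low)
    also have "\<dots> = Re (\<Sum>i<2 * l. cnj (d x i) * p k (node i x))"
      using pair[of "d x"] fiber by simp
    also have "\<dots> \<le> (\<Sum>i<2 * l. cmod (d x i) * C)"
    proof -
      have "Re (\<Sum>i<2 * l. cnj (d x i) * p k (node i x)) \<le> cmod (\<Sum>i<2 * l. cnj (d x i) * p k (node i x))"
        by (rule complex_Re_le_cmod)
      also have "\<dots> \<le> (\<Sum>i<2 * l. cmod (d x i) * C)"
        by (intro sum_norm_le) (auto simp: norm_mult intro!: mult_left_mono p_bound[OF k])
      finally show ?thesis .
    qed
    also have "\<dots> \<le> (\<Sum>i<2 * l. A / 2 * (cmod (d x i))\<^sup>2 + C\<^sup>2 / (2 * A))"
    proof (rule sum_mono)
      fix i
      have "A / 2 * (cmod (d x i))\<^sup>2 + C\<^sup>2 / (2 * A) - cmod (d x i) * C = (A * cmod (d x i) - C)\<^sup>2 / (2 * A)"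
        using A_pos by (simp add: field_simps power2_eq_square)
      also have "\<dots> \<ge> 0" using A_pos by simp
      finally show "cmod (d x i) * C \<le> A / 2 * (cmod (d x i))\<^sup>2 + C\<^sup>2 / (2 * A)" by simp
    qed
    also have "\<dots> = A / 2 * (\<Sum>i<2 * l. (cmod (d x i))\<^sup>2) + 2 * real l * (C\<^sup>2 / (2 * A))"
      by (simp add: sum.distrib sum_distrib_left)
    finally have "A * (\<Sum>i<2 * l. (cmod (d x i))\<^sup>2) \<le> 2 * real l * C\<^sup>2 / A" by simp
    then have "(\<Sum>i<2 * l. (cmod (d x i))\<^sup>2) \<le> 2 * real l * C\<^sup>2 / A\<^sup>2"
      using A_pos by (simp add: field_simps power2_eq_square)
    moreover have "(cmod (d x i))\<^sup>2 \<le> (\<Sum>i<2 * l. (cmod (d x i))\<^sup>2)" if "i < 2 * l" for i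
      using that by (intro member_le_sum) auto
    ultimately have "cmod (d x i) \<le> K" if "i < 2 * l" for i
      unfolding K_def using that by (intro real_le_rsqrt) (meson order_trans)
    then have "glue u (node i x) = d x i" if "i < 2 * l" for i
      using glue_node[OF x that] off[OF that] that by (auto simp: u_def)
    then have "bracket j (glue u) x = s (d x) j" for j
      unfolding bracket_def s_def using x by simp
    then show ?thesis using fiber_frame_op_node[OF x i] fiber[OF i] by simp
  qed
  have "AE \<xi> in lborel. fiber_frame_op (glue u) \<xi> = p k \<xi>"
  proof (rule AE_fibers_imp_AE[OF fiber_frame_op_supported[OF g] p_supported[OF k]])
    show "AE x in lborel. x \<in> {0..<h} \<longrightarrow>
        (\<forall>i<2 * l. fiber_frame_op (glue u) (node i x) = p k (node i x))"
      using fiberwise_lower_bound by eventually_elim (use main in blast)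
  qed
  with g show ?thesis by blast
qed

end

lemma (in fibers) infsum_lattice_eq_sum_nodes:
  fixes a :: "real \<Rightarrow> complex"
  assumes x: "x \<in> {0..<h}" and supp: "\<And>\<xi>. \<xi> \<notin> {-\<omega>..\<omega>} \<Longrightarrow> a \<xi> = 0"
  shows "(\<Sum>\<^sub>\<infinity>m\<in>(UNIV :: int set). a (x + of_int m * h)) = (\<Sum>i<2 * l. a (node i x))"
proof -
  have x': "0 \<le> x" "x < h" using x by auto
  have out: "a (x + of_int m * h) = 0" if "m \<notin> {- int l..<int l}" for m :: int
  proof (rule supp)
    show "x + of_int m * h \<notin> {-\<omega>..\<omega>}"
    proof (cases "int l \<le> m")
      case True
      then have "real l \<le> of_int m" by linarith
      then have "real l * h \<le> of_int m * h" using h_pos by (intro mult_right_mono) auto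
      then have "\<omega> < x + of_int m * h" using x' \<omega>_less by linarith
      then show ?thesis by simp
    next
      case False
      then have "of_int m \<le> - real l - 1" using that by auto
      then have "of_int m * h \<le> (- real l - 1) * h" using h_pos by (intro mult_right_mono) auto
      then have "of_int m * h \<le> - (real l * h) - h" by (simp add: left_diff_distrib)
      then have "x + of_int m * h < - \<omega>" using x' \<omega>_less by linarith
      then show ?thesis by simp
    qed
  qed
  have "(\<Sum>\<^sub>\<infinity>m\<in>(UNIV :: int set). a (x + of_int m * h)) = (\<Sum>\<^sub>\<infinity>m\<in>{- int l..<int l}. a (x + of_int m * h))"
    by (rule infsum_cong_neutral) (use out in auto)
  also have "\<dots> = (\<Sum>m\<in>{- int l..<int l}. a (x + of_int m * h))" by simp
  also have "\<dots> = (\<Sum>i<2 * l. a (node i x))"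
    by (rule sum.reindex_bij_witness[of _ "\<lambda>i. int i - int l" "\<lambda>m. nat (m + int l)"])
      (auto simp: node_def)
  finally show ?thesis .
qed

section \<open>Frames of translates\<close>

lemma bandlimited_L2: "f \<in> bandlimited \<omega> \<Longrightarrow> f \<in> L2_space"
  unfolding bandlimited_def by blast

text \<open>Testing the upper frame bound on indicator functions of sets where \<open>\<bar>p\<bar>\<^sup>2\<close> exceeds \<open>B / h\<close>,
  inside one period so that Parseval's identity applies, shows that these sets are null.\<close>

lemma generator_transform_bounded:
  assumes h: "h > 0" and B: "B \<ge> 0" and p: "p \<in> L2_supported \<omega>"
    and upper: "\<And>g. g \<in> L2_supported \<omega> \<Longrightarrow>
      (\<Sum>\<^sub>\<infinity>n\<in>UNIV. (cmod (L2_inner g (\<lambda>\<xi>. expo h n \<xi> * p \<xi>)))\<^sup>2) \<le> B * sqnorm g"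
  shows "AE \<xi> in lborel. (cmod (p \<xi>))\<^sup>2 \<le> B / h"
proof -
  note [measurable] = L2_space_measurable[OF L2_supportedD(1)[OF p]]
  define E where "E k r = {\<xi> \<in> {-\<omega>..\<omega>}. \<xi> \<in> {of_int k * h..<of_int k * h + h} \<and> cmod (p \<xi>) \<le> real r \<and>
      B / h < (cmod (p \<xi>))\<^sup>2}" for k :: int and r :: nat
  have null: "AE \<xi> in lborel. \<xi> \<notin> E k r" for k r
  proof -
    have [measurable]: "E k r \<in> sets borel" unfolding E_def by measurable
    define g :: "real \<Rightarrow> complex" where "g = indicator (E k r)"
    have g: "g \<in> L2_supported \<omega>"
      unfolding g_def
      by (intro L2_supportedI L2_space_bounded_support(1)[where C = 1 and a = "-\<omega>" and b = \<omega>])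
        (auto simp: indicator_def E_def)
    define q where "q \<xi> = g \<xi> * cnj (p \<xi>)" for \<xi>
    have qb: "cmod (q \<xi>) \<le> real r" for \<xi>
      unfolding q_def g_def by (auto simp: indicator_def E_def)
    have q0: "q \<xi> = 0" if "\<xi> \<notin> {of_int k * h..of_int k * h + h}" for \<xi>
      using that unfolding q_def g_def by (auto simp: indicator_def E_def)
    have q: "q \<in> L2_space"
    proof (rule L2_space_bounded_support(1)[OF _ qb q0])
      show "q \<in> borel_measurable borel" unfolding q_def g_def by measurable
    qed
    have "(LINT x|lborel. q x * cis (- (of_int n * (2 * pi / h) * x))) =
        L2_inner g (\<lambda>\<xi>. expo h n \<xi> * p \<xi>)" for n
      unfolding L2_inner_def q_def by (simp add: cis_cnj mult_ac)
    then have "((\<lambda>n. (cmod (L2_inner g (\<lambda>\<xi>. expo h n \<xi> * p \<xi>)))\<^sup>2) has_sum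
        (h * sqnorm q)) UNIV"
      using Fourier_series_Parseval(2)[OF h q q0] by simp
    then have le: "h * sqnorm q \<le> B * sqnorm g"
      using upper[OF g] by (simp add: infsumI)
    define D where "D \<xi> = h * (cmod (q \<xi>))\<^sup>2 - B * (cmod (g \<xi>))\<^sup>2" for \<xi>
    have int: "integrable lborel D"
      unfolding D_def using L2_space_integrable[OF q] L2_space_integrable[OF L2_supportedD(1)[OF g]] by simp
    have D_pos: "0 < D \<xi>" if "\<xi> \<in> E k r" for \<xi>
      using that h unfolding D_def q_def g_def by (simp add: E_def field_simps)
    have D_zero: "D \<xi> = 0" if "\<xi> \<notin> E k r" for \<xi>
      using that unfolding D_def q_def g_def by simp
    have D_nonneg: "0 \<le> D \<xi>" for \<xi> using D_pos[of \<xi>] D_zero[of \<xi>] by fastforce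
    have "(LINT \<xi>|lborel. D \<xi>) = h * sqnorm q - B * sqnorm g"
      unfolding D_def sqnorm_def
      using L2_space_integrable[OF q] L2_space_integrable[OF L2_supportedD(1)[OF g]] by simp
    then have "(LINT \<xi>|lborel. D \<xi>) = 0"
      using le integral_nonneg_AE[where M = lborel and f = D] D_nonneg by simp
    then have "AE \<xi> in lborel. D \<xi> = 0"
      using integral_nonneg_eq_0_iff_AE[OF int] D_nonneg by simp
    then show ?thesis
      by eventually_elim (use D_pos in force)
  qed
  have "AE \<xi> in lborel. \<forall>k r. \<xi> \<notin> E k r"
    unfolding AE_all_countable using null by blast
  then show ?thesis
  proof (rule AE_mp, intro AE_I2 impI)
    fix \<xi> assume *: "\<forall>k r. \<xi> \<notin> E k r"
    show "(cmod (p \<xi>))\<^sup>2 \<le> B / h"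
    proof (cases "\<xi> \<in> {-\<omega>..\<omega>}")
      case True
      have "\<xi> \<in> {of_int \<lfloor>\<xi> / h\<rfloor> * h..<of_int \<lfloor>\<xi> / h\<rfloor> * h + h}"
        using floor_divide_lower[OF h, of \<xi>] floor_divide_upper[OF h, of \<xi>] by (simp add: distrib_right)
      moreover have "cmod (p \<xi>) \<le> real (nat \<lceil>cmod (p \<xi>)\<rceil>)" by linarith
      ultimately show ?thesis
        using *[rule_format, of "\<lfloor>\<xi> / h\<rfloor>" "nat \<lceil>cmod (p \<xi>)\<rceil>"] True unfolding E_def by fastforce
    qed (use L2_supportedD(2)[OF p] B h in simp)
  qed
qed

lemma shift_system_eq_inv_fourier:
  assumes t: "t > 0" and h: "h = 2 * pi / t"
    and AE: "AE x in lborel. \<Phi> j x = inv_fourier p x"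
  shows "AE x in lborel. shift_system t \<Phi> (j, n) x =
    inv_fourier (\<lambda>\<xi>. expo h n \<xi> * p \<xi>) x"
proof -
  have "2 * pi / h = t" using t h by simp
  then have "inv_fourier (\<lambda>\<xi>. expo h n \<xi> * p \<xi>) =
      translate (of_int n * t) (inv_fourier p)"
    by (simp add: inv_fourier_translate)
  then show ?thesis
    using AE_lborel_translate[OF AE, of "of_int n * t"] by (simp add: shift_system_def translate_def)
qed

lemma shift_system_L2:
  assumes \<Phi>: "\<Phi> j \<in> L2_space"
  shows "shift_system t \<Phi> (j, n) \<in> L2_space"
proof -
  note [measurable] = L2_space_measurable[OF \<Phi>]
  have "integrable lborel (\<lambda>x. (cmod (\<Phi> j (of_int n * t + 1 * x)))\<^sup>2)"
    by (rule lborel_integrable_real_affine[OF L2_space_integrable[OF \<Phi>]]) simp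
  then show ?thesis
    unfolding shift_system_def translate_def by (intro L2_spaceI) (auto simp: add.commute)
qed

lemma inner_shift_system:
  assumes \<omega>: "\<omega> > 0" and t: "t > 0" and h: "h = 2 * pi / t"
    and \<Phi>: "\<Phi> j \<in> L2_space" "AE x in lborel. \<Phi> j x = inv_fourier p x" and p: "p \<in> L2_supported \<omega>"
    and f: "f \<in> L2_space" "AE x in lborel. f x = inv_fourier g x" and g: "g \<in> L2_supported \<omega>"
  shows "L2_inner f (shift_system t \<Phi> (j, n)) =
    L2_inner g (\<lambda>\<xi>. expo h n \<xi> * p \<xi>)"
proof -
  have e: "(\<lambda>\<xi>. expo h n \<xi> * p \<xi>) \<in> L2_supported \<omega>"
    by (rule L2_supported_cis_mult[OF p])
  have "L2_inner f (shift_system t \<Phi> (j, n)) =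
      L2_inner (inv_fourier g) (inv_fourier (\<lambda>\<xi>. expo h n \<xi> * p \<xi>))"
    by (intro L2_inner_cong_AE L2_space_measurable f shift_system_L2 \<Phi>(1) inv_fourier_L2(1)[OF g \<omega>]
        inv_fourier_L2(1)[OF e \<omega>] shift_system_eq_inv_fourier[where \<Phi> = \<Phi> and j = j, OF t h \<Phi>(2)])
  also have "\<dots> = L2_inner g (\<lambda>\<xi>. expo h n \<xi> * p \<xi>)"
    by (rule inv_fourier_inner[OF g e \<omega>])
  finally show ?thesis .
qed

text \<open>The upper frame inequality bounds the transforms of the generators, and Parseval's identity
  rewrites the lower one in terms of brackets.\<close>

lemma frame_of_translates_fibers:
  assumes \<omega>: "\<omega> > 0" and t: "t > 0" and h: "h = 2 * pi / t" and l: "\<omega> < real l * h"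
    and \<Phi>: "\<And>j. j \<in> {1..N} \<Longrightarrow> \<Phi> j \<in> bandlimited \<omega>"
    and frame: "is_frame (bandlimited \<omega>) (shift_index N) (shift_system t \<Phi>)"
  obtains p C A where "generator_frame \<omega> h l N p C A"
    and "\<And>j. j \<in> {1..N} \<Longrightarrow> AE \<xi> in lborel. fourier (\<Phi> j) \<xi> = p j \<xi>"
    and "\<And>j. j \<in> {1..N} \<Longrightarrow> AE x in lborel. \<Phi> j x = inv_fourier (p j) x"
proof -
  have h_pos: "h > 0" using h t by simp
  have "\<exists>q. j \<in> {1..N} \<longrightarrow> q \<in> L2_supported \<omega> \<and> (AE \<xi> in lborel. fourier (\<Phi> j) \<xi> = q \<xi>) \<and>
      (AE x in lborel. \<Phi> j x = inv_fourier q x)" for j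
    using bandlimited_eq_inv_fourier[OF \<Phi> \<omega>, of j] by metis
  then obtain q where q: "\<And>j. j \<in> {1..N} \<Longrightarrow> q j \<in> L2_supported \<omega>"
    and qF: "\<And>j. j \<in> {1..N} \<Longrightarrow> AE \<xi> in lborel. fourier (\<Phi> j) \<xi> = q j \<xi>"
    and q\<Phi>: "\<And>j. j \<in> {1..N} \<Longrightarrow> AE x in lborel. \<Phi> j x = inv_fourier (q j) x"
    by metis
  obtain A B where A: "0 < A" "A \<le> B"
    and fr: "\<And>f. f \<in> bandlimited \<omega> \<Longrightarrow>
        (\<lambda>i. (cmod (L2_inner f (shift_system t \<Phi> i)))\<^sup>2) summable_on shift_index N \<and>
        A * (L2_norm f)\<^sup>2 \<le> (\<Sum>\<^sub>\<infinity>i\<in>shift_index N. (cmod (L2_inner f (shift_system t \<Phi> i)))\<^sup>2) \<and>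
        (\<Sum>\<^sub>\<infinity>i\<in>shift_index N. (cmod (L2_inner f (shift_system t \<Phi> i)))\<^sup>2) \<le> B * (L2_norm f)\<^sup>2"
    using frame unfolding is_frame_def by blast
  define c where "c g q n = L2_inner g (\<lambda>\<xi>. expo h n \<xi> * q \<xi>)"
    for g q and n :: int
  have inner: "L2_inner (inv_fourier g) (shift_system t \<Phi> (j, n)) = c g (q j) n"
    if g: "g \<in> L2_supported \<omega>" and j: "j \<in> {1..N}" for g j n
    unfolding c_def
    by (rule inner_shift_system[where \<Phi> = \<Phi> and j = j,
          OF \<omega> t h bandlimited_L2[OF \<Phi>[OF j]] q\<Phi>[OF j] q[OF j] inv_fourier_L2(1)[OF g \<omega>] AE_I2[OF refl] g])
  have fr': "(\<lambda>i. (cmod (c g (q (fst i)) (snd i)))\<^sup>2) summable_on shift_index N"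
    "A * sqnorm g \<le> (\<Sum>\<^sub>\<infinity>i\<in>shift_index N. (cmod (c g (q (fst i)) (snd i)))\<^sup>2)"
    "(\<Sum>\<^sub>\<infinity>i\<in>shift_index N. (cmod (c g (q (fst i)) (snd i)))\<^sup>2) \<le> B * sqnorm g"
    if g: "g \<in> L2_supported \<omega>" for g
  proof -
    have eq: "(cmod (L2_inner (inv_fourier g) (shift_system t \<Phi> i)))\<^sup>2 = (cmod (c g (q (fst i)) (snd i)))\<^sup>2"
      if "i \<in> shift_index N" for i
      using that inner[OF g, of "fst i" "snd i"] by (auto simp: shift_index_def)
    show "(\<lambda>i. (cmod (c g (q (fst i)) (snd i)))\<^sup>2) summable_on shift_index N"
      "A * sqnorm g \<le> (\<Sum>\<^sub>\<infinity>i\<in>shift_index N. (cmod (c g (q (fst i)) (snd i)))\<^sup>2)"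
      "(\<Sum>\<^sub>\<infinity>i\<in>shift_index N. (cmod (c g (q (fst i)) (snd i)))\<^sup>2) \<le> B * sqnorm g"
      using fr[OF inv_fourier_bandlimited[OF g \<omega>]]
      by (simp_all add: eq L2_norm_power2 inv_fourier_L2(2)[OF g \<omega>] cong: summable_on_cong infsum_cong)
  qed
  have upper: "(\<Sum>\<^sub>\<infinity>n\<in>UNIV. (cmod (c g (q j) n))\<^sup>2) \<le> B * sqnorm g"
    if g: "g \<in> L2_supported \<omega>" and j: "j \<in> {1..N}" for g j
  proof -
    have sub: "Pair j ` UNIV \<subseteq> shift_index N" using j by (auto simp: shift_index_def)
    have "(\<Sum>\<^sub>\<infinity>n\<in>UNIV. (cmod (c g (q j) n))\<^sup>2) =
        (\<Sum>\<^sub>\<infinity>i\<in>Pair j ` UNIV. (cmod (c g (q (fst i)) (snd i)))\<^sup>2)"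
      by (subst infsum_reindex) (auto simp: inj_on_def o_def)
    also have "\<dots> \<le> (\<Sum>\<^sub>\<infinity>i\<in>shift_index N. (cmod (c g (q (fst i)) (snd i)))\<^sup>2)"
      by (rule infsum_mono2[OF summable_on_subset_banach[OF fr'(1)[OF g] sub] fr'(1)[OF g] sub]) simp
    also have "\<dots> \<le> B * sqnorm g" by (rule fr'(3)[OF g])
    finally show ?thesis .
  qed
  define C where "C = sqrt (B / h)"
  \<comment> \<open>Modifying the transforms on a null set makes the bound hold everywhere.\<close>
  define p where "p j \<xi> = (if cmod (q j \<xi>) \<le> C then q j \<xi> else 0)" for j \<xi>
  have pq: "AE \<xi> in lborel. q j \<xi> = p j \<xi>" if j: "j \<in> {1..N}" for j
  proof -
    have "AE \<xi> in lborel. (cmod (q j \<xi>))\<^sup>2 \<le> B / h"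
      by (rule generator_transform_bounded[OF h_pos _ q[OF j] upper[OF _ j, unfolded c_def]]) (use A in auto)
    then show ?thesis by eventually_elim (simp add: p_def C_def real_le_rsqrt)
  qed
  have p: "p j \<in> L2_supported \<omega>" if j: "j \<in> {1..N}" for j
  proof (rule L2_supportedI)
    note [measurable] = L2_space_measurable[OF L2_supportedD(1)[OF q[OF j]]]
    have "p j = (\<lambda>\<xi>. (if cmod (q j \<xi>) \<le> C then 1 else 0) * q j \<xi>)" by (auto simp: p_def)
    also have "\<dots> \<in> L2_space"
      by (rule L2_space_bounded_mult(1)[OF L2_supportedD(1)[OF q[OF j]], where C = 1]) auto
    finally show "p j \<in> L2_space" .
  qed (use L2_supportedD(2)[OF q[OF j]] in \<open>simp add: p_def\<close>)
  have C_nonneg: "0 \<le> C" unfolding C_def using A h_pos by simp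
  interpret generator_fibers \<omega> h l N p C
    by unfold_locales (use \<omega> h_pos l p C_nonneg in \<open>auto simp: p_def\<close>)
  have cc: "c g (q j) n = coeff j g n" if g: "g \<in> L2_supported \<omega>" and j: "j \<in> {1..N}" for g j n
    unfolding c_def coeff_def using pq[OF j]
    by (intro L2_inner_cong_AE L2_space_measurable L2_supportedD(1)[OF g]
        L2_supportedD(1)[OF L2_supported_cis_mult[OF q[OF j]]] L2_supportedD(1)[OF L2_supported_cis_mult[OF p[OF j]]]) auto
  have "generator_frame \<omega> h l N p C A"
  proof unfold_locales
    fix g assume g: "g \<in> L2_supported \<omega>"
    have "((\<lambda>i. (cmod (c g (q (fst i)) (snd i)))\<^sup>2) has_sum (\<Sum>j\<in>{1..N}. h * sqnorm (bracket j g)))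
        (\<Union>j\<in>{1..N}. Pair j ` UNIV)"
    proof (rule sum_has_sum)
      fix j assume j: "j \<in> {1..N}"
      show "((\<lambda>i. (cmod (c g (q (fst i)) (snd i)))\<^sup>2) has_sum (h * sqnorm (bracket j g))) (Pair j ` UNIV)"
        using coeff_has_sum[OF j g] by (subst has_sum_reindex) (auto simp: inj_on_def o_def cc[OF g j])
    qed auto
    moreover have "(\<Union>j\<in>{1..N}. Pair j ` UNIV) = shift_index N" by (auto simp: shift_index_def)
    ultimately show "A * sqnorm g \<le> (\<Sum>j\<in>{1..N}. h * sqnorm (bracket j g))"
      using fr'(2)[OF g] by (simp add: infsumI)
  qed (rule A(1))
  moreover have "AE \<xi> in lborel. fourier (\<Phi> j) \<xi> = p j \<xi>" if "j \<in> {1..N}" for j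
    using qF[OF that] pq[OF that] by eventually_elim simp
  moreover have "AE x in lborel. \<Phi> j x = inv_fourier (p j) x" if "j \<in> {1..N}" for j
    using q\<Phi>[OF that] inv_fourier_AE_cong[OF _ _ pq[OF that]] p[OF that] q[OF that]
    by (simp add: L2_supportedD(1) L2_space_measurable)
  ultimately show ?thesis using that by blast
qed

text \<open>The partial sums of the frame expansion are the inverse transforms of those treated in
  \<open>fiber_frame_op_expansion\<close>.  Their convergence shows that the defining description of
  \<open>frame_operator\<close> is met by some function, and uniqueness of the limit identifies it.\<close>

lemma (in generator_fibers) frame_operator_eq_inv_fourier:
  assumes t: "t > 0" and h: "h = 2 * pi / t"
    and \<Phi>: "\<And>j. j \<in> {1..N} \<Longrightarrow> \<Phi> j \<in> L2_space"
    and \<Phi>p: "\<And>j. j \<in> {1..N} \<Longrightarrow> AE x in lborel. \<Phi> j x = inv_fourier (p j) x"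
    and f: "f \<in> L2_space" "AE x in lborel. f x = inv_fourier g x" and g: "g \<in> L2_supported \<omega>"
  shows "AE x in lborel. frame_operator (shift_index N) (shift_system t \<Phi>) f x =
    inv_fourier (fiber_frame_op g) x"
proof -
  let ?F = "finite_subsets_at_top (shift_index N)"
  let ?S = "\<lambda>Q x. \<Sum>i\<in>Q. L2_inner f (shift_system t \<Phi> i) * shift_system t \<Phi> i x"
  let ?T = "\<lambda>Q \<xi>. \<Sum>(j, n)\<in>Q. coeff j g n * (expo h n \<xi> * p j \<xi>)"
  have inner: "L2_inner f (shift_system t \<Phi> (j, n)) = coeff j g n" if j: "j \<in> {1..N}" for j n
    unfolding coeff_def by (rule inner_shift_system[where \<Phi> = \<Phi> and j = j, OF \<omega>_pos t h \<Phi>[OF j] \<Phi>p[OF j] p_supported[OF j] f g])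
  have SL2: "?S Q \<in> L2_space" if "Q \<subseteq> shift_index N" for Q
    using that by (intro L2_space_sum L2_space_scale) (auto simp: shift_index_def intro!: shift_system_L2 \<Phi>)
  have TL2: "?T Q \<in> L2_supported \<omega>" if "Q \<subseteq> shift_index N" for Q
    using that unfolding case_prod_unfold
    by (intro L2_supported_sum L2_supported_scale L2_supported_cis_mult p_supported) (auto simp: shift_index_def)
  have ST: "AE x in lborel. ?S Q x = inv_fourier (?T Q) x" if Q: "finite Q" "Q \<subseteq> shift_index N" for Q
  proof -
    have AE: "AE x in lborel. \<forall>i\<in>Q. shift_system t \<Phi> i x =
        inv_fourier (\<lambda>\<xi>. expo h (snd i) \<xi> * p (fst i) \<xi>) x"
    proof (rule AE_finite_allI[OF Q(1)])
      fix i assume "i \<in> Q"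
      then have "fst i \<in> {1..N}" using Q(2) by (auto simp: shift_index_def)
      from shift_system_eq_inv_fourier[where \<Phi> = \<Phi> and j = "fst i", OF t h \<Phi>p[OF this], of "snd i"]
      show "AE x in lborel. shift_system t \<Phi> i x =
          inv_fourier (\<lambda>\<xi>. expo h (snd i) \<xi> * p (fst i) \<xi>) x"
        by simp
    qed
    have T_eq: "inv_fourier (?T Q) = (\<lambda>x. \<Sum>i\<in>Q. coeff (fst i) g (snd i) *
        inv_fourier (\<lambda>\<xi>. expo h (snd i) \<xi> * p (fst i) \<xi>) x)"
    proof -
      have "inv_fourier (?T Q) = (\<lambda>x. \<Sum>i\<in>Q. inv_fourier (\<lambda>\<xi>. coeff (fst i) g (snd i) *
          (expo h (snd i) \<xi> * p (fst i) \<xi>)) x)"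
        using Q unfolding case_prod_unfold
        by (intro inv_fourier_sum[where a = \<omega>] L2_supported_scale L2_supported_cis_mult p_supported)
          (auto simp: shift_index_def)
      then show ?thesis unfolding inv_fourier_scale .
    qed
    from AE show ?thesis
    proof eventually_elim
      case (elim x)
      have "?S Q x = (\<Sum>i\<in>Q. coeff (fst i) g (snd i) *
          inv_fourier (\<lambda>\<xi>. expo h (snd i) \<xi> * p (fst i) \<xi>) x)"
        using Q(2) elim inner by (intro sum.cong refl) (force simp: shift_index_def)
      then show ?case unfolding T_eq .
    qed
  qed
  have G: "inv_fourier (fiber_frame_op g) \<in> L2_space"
    by (rule inv_fourier_L2(1)[OF fiber_frame_op_supported[OF g] \<omega>_pos])
  have ev: "\<forall>\<^sub>F Q in ?F. ?S Q \<in> L2_space"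
    by (rule eventually_finite_subsets_at_top_weakI) (rule SL2)
  have "\<forall>\<^sub>F Q in ?F. sqnorm (\<lambda>\<xi>. ?T Q \<xi> - fiber_frame_op g \<xi>) =
      sqnorm (\<lambda>x. ?S Q x - inv_fourier (fiber_frame_op g) x)"
  proof (rule eventually_finite_subsets_at_top_weakI)
    fix Q assume Q: "finite Q" "Q \<subseteq> shift_index N"
    note d = L2_supported_diff[OF TL2[OF Q(2)] fiber_frame_op_supported[OF g]]
    have "sqnorm (\<lambda>\<xi>. ?T Q \<xi> - fiber_frame_op g \<xi>) =
        sqnorm (\<lambda>x. inv_fourier (?T Q) x - inv_fourier (fiber_frame_op g) x)"
      using inv_fourier_L2(2)[OF d \<omega>_pos]
      unfolding inv_fourier_diff[OF TL2[OF Q(2)] fiber_frame_op_supported[OF g]] by simp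
    also have "\<dots> = sqnorm (\<lambda>x. ?S Q x - inv_fourier (fiber_frame_op g) x)"
      using ST[OF Q]
      by (intro sqnorm_cong_AE L2_space_measurable L2_space_diff G SL2[OF Q(2)]
          inv_fourier_L2(1)[OF TL2[OF Q(2)] \<omega>_pos]) auto
    finally show "sqnorm (\<lambda>\<xi>. ?T Q \<xi> - fiber_frame_op g \<xi>) =
        sqnorm (\<lambda>x. ?S Q x - inv_fourier (fiber_frame_op g) x)" .
  qed
  then have "((\<lambda>Q. sqnorm (\<lambda>x. ?S Q x - inv_fourier (fiber_frame_op g) x)) \<longlongrightarrow> 0) ?F"
    using fiber_frame_op_expansion[OF g] unfolding shift_index_def
    by (rule Lim_transform_eventually[rotated])
  then have conv: "L2_tendsto ?S (inv_fourier (fiber_frame_op g)) ?F"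
    by (rule iffD2[OF L2_tendsto_iff_sqnorm[OF ev G]])
  have "\<exists>G. G \<in> L2_space \<and> L2_tendsto ?S G ?F"
    by (intro exI[of _ "inv_fourier (fiber_frame_op g)"] conjI G conv)
  from someI_ex[OF this]
  have some: "frame_operator (shift_index N) (shift_system t \<Phi>) f \<in> L2_space"
    "L2_tendsto ?S (frame_operator (shift_index N) (shift_system t \<Phi>) f) ?F"
    unfolding frame_operator_def by (rule conjunct1, rule conjunct2)
  show ?thesis
    by (rule L2_limit_unique[OF ev some(1) G finite_subsets_at_top_neq_bot some(2) conv])
qed

text \<open>A preimage of \<open>\<Phi> k\<close> under the frame operator exists by \<open>fiber_frame_op_preimage\<close>, so the chosen
  dual generator is one; its transform then solves the fiberwise equation.\<close>

lemma (in generator_frame) dual_generator_transform: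
  assumes t: "t > 0" and h: "h = 2 * pi / t"
    and \<Phi>: "\<And>j. j \<in> {1..N} \<Longrightarrow> \<Phi> j \<in> L2_space"
    and \<Phi>p: "\<And>j. j \<in> {1..N} \<Longrightarrow> AE x in lborel. \<Phi> j x = inv_fourier (p j) x"
    and k: "k \<in> {1..N}"
  obtains q where "q \<in> L2_supported \<omega>"
    and "AE \<xi> in lborel. fourier (dual_generator \<omega> t N \<Phi> k) \<xi> = q \<xi>"
    and "AE \<xi> in lborel. fiber_frame_op q \<xi> = p k \<xi>"
proof -
  let ?S = "frame_operator (shift_index N) (shift_system t \<Phi>)"
  note op = frame_operator_eq_inv_fourier[OF t h \<Phi> \<Phi>p]
  obtain g where g: "g \<in> L2_supported \<omega>" "AE \<xi> in lborel. fiber_frame_op g \<xi> = p k \<xi>"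
    using fiber_frame_op_preimage[OF k] by blast
  have "inv_fourier (fiber_frame_op g) = inv_fourier (p k)"
    by (rule inv_fourier_AE_cong[OF _ _ g(2)])
      (use fiber_frame_op_supported[OF g(1)] p_measurable[OF k] L2_supportedD(1) L2_space_measurable in blast)+
  moreover have "AE x in lborel. ?S (inv_fourier g) x = inv_fourier (fiber_frame_op g) x"
    by (rule op[OF _ _ inv_fourier_L2(1)[OF g(1) \<omega>_pos] _ g(1)]) auto
  ultimately have "AE x in lborel. ?S (inv_fourier g) x = \<Phi> k x"
    using \<Phi>p[OF k] by auto
  then have "\<exists>f. f \<in> bandlimited \<omega> \<and> (AE x in lborel. ?S f x = \<Phi> k x)"
    using inv_fourier_bandlimited[OF g(1) \<omega>_pos] by blast
  from someI_ex[OF this]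
  have band: "dual_generator \<omega> t N \<Phi> k \<in> bandlimited \<omega>"
    and S: "AE x in lborel. ?S (dual_generator \<omega> t N \<Phi> k) x = \<Phi> k x"
    unfolding dual_generator_def frame_operator_inv_def by blast+
  obtain q where q: "q \<in> L2_supported \<omega>"
    "AE \<xi> in lborel. fourier (dual_generator \<omega> t N \<Phi> k) \<xi> = q \<xi>"
    "AE x in lborel. dual_generator \<omega> t N \<Phi> k x = inv_fourier q x"
    using bandlimited_eq_inv_fourier[OF band \<omega>_pos] by blast
  have "AE x in lborel. ?S (dual_generator \<omega> t N \<Phi> k) x = inv_fourier (fiber_frame_op q) x"
    by (rule op[OF _ _ bandlimited_L2[OF band] q(3) q(1)]) auto
  then have "AE x in lborel. inv_fourier (fiber_frame_op q) x = inv_fourier (p k) x"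
    using S \<Phi>p[OF k] by eventually_elim simp
  then have "AE \<xi> in lborel. fiber_frame_op q \<xi> = p k \<xi>"
    by (rule inv_fourier_AE_inj[OF fiber_frame_op_supported[OF q(1)] p_supported[OF k] \<omega>_pos])
  with q(1,2) show ?thesis by (rule that)
qed

section \<open>The mixed Gramian\<close>

context generator_frame
begin

text \<open>When exactly the nodes \<open>s, \<dots>, s + R - 1\<close> lie in \<open>[-\<omega>, \<omega>]\<close>, the lower frame bound says that
  the \<open>R\<close> rows of transform values are linearly independent.\<close>

lemma fiber_rows_independent:
  assumes nonneg: "\<And>c. 0 \<le> defect x c"
    and nodes: "\<And>i. i < 2 * l \<Longrightarrow> node i x \<in> {-\<omega>..\<omega>} \<longleftrightarrow> s \<le> i \<and> i < s + R"
    and R: "s + R \<le> 2 * l"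
  shows "rows_independent R N (\<lambda>r k. p (k + 1) (node (r + s) x))"
  unfolding rows_independent_def
proof (intro allI impI)
  fix c r assume zero': "\<forall>k<N. (\<Sum>r<R. c r * p (k + 1) (node (r + s) x)) = 0" and r: "r < R"
  have zero: "(\<Sum>r<R. c r * p (k + 1) (node (r + s) x)) = 0" if "k < N" for k
    using zero' that by blast
  define d where "d i = (if s \<le> i \<and> i < s + R then cnj (c (i - s)) else 0)" for i
  have d0: "(\<Sum>i<2 * l. d i * cnj (p j (node i x))) = 0" if j: "j \<in> {1..N}" for j
  proof -
    have "(\<Sum>i<2 * l. d i * cnj (p j (node i x))) = (\<Sum>i\<in>{s..<s + R}. d i * cnj (p j (node i x)))"
      using R by (intro sum.mono_neutral_right) (auto simp: d_def)
    also have "\<dots> = (\<Sum>r<R. d (r + s) * cnj (p j (node (r + s) x)))"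
      by (rule sum.reindex_bij_witness[of _ "\<lambda>r. r + s" "\<lambda>i. i - s"]) auto
    also have "\<dots> = cnj (\<Sum>r<R. c r * p j (node (r + s) x))"
      by (simp add: d_def)
    also have "(\<Sum>r<R. c r * p j (node (r + s) x)) = 0" 
    proof -
      have "j - 1 < N" "j - 1 + 1 = j" using j by auto
      then show ?thesis using zero[of "j - 1"] by simp
    qed
    also have "cnj 0 = 0" by simp
    finally show ?thesis .
  qed
  have "A * (\<Sum>i<2 * l. of_bool (node i x \<in> {-\<omega>..\<omega>}) * (cmod (d i))\<^sup>2) \<le> 0"
    using nonneg[of d] unfolding defect_def by (simp add: d0 del: of_bool_eq_1_iff atLeastAtMost_iff)
  then have "(\<Sum>i<2 * l. of_bool (node i x \<in> {-\<omega>..\<omega>}) * (cmod (d i))\<^sup>2) \<le> 0"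
    using A_pos by (simp add: mult_le_0_iff)
  then have "(\<Sum>i<2 * l. of_bool (node i x \<in> {-\<omega>..\<omega>}) * (cmod (d i))\<^sup>2) = 0"
    by (intro order_antisym sum_nonneg) auto
  then have "of_bool (node (r + s) x \<in> {-\<omega>..\<omega>}) * (cmod (d (r + s)))\<^sup>2 = 0"
    using r R by (subst (asm) sum_nonneg_eq_0_iff) auto
  then show "c r = 0" using nodes[of "r + s"] r R by (simp add: d_def)
qed

text \<open>The relation \<open>V G = V\<close>: on each fiber the frame operator maps the dual generator to the
  generator.\<close>

lemma dual_bracket_reproduces:
  assumes "x \<in> {0..<h}" and "i < 2 * l" and "fiber_frame_op g (node i x) = p k (node i x)"
  shows "(\<Sum>j<N. p (j + 1) (node i x) * (complex_of_real h * bracket (j + 1) g x)) = p k (node i x)"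
  using assms(3) unfolding fiber_frame_op_node[OF assms(1,2)] sum_distrib_left
  by (simp add: sum.atLeast1_atMost_eq mult.left_commute)

text \<open>The relation \<open>W\<^sup>* G = 0\<close>: as a vector indexed by \<open>j\<close>, the bracket is a combination of the
  conjugated rows \<open>(cnj (p (j + 1) (node i x)))\<^sub>j\<close>.\<close>

lemma bracket_orthogonal_to_kernel:
  assumes x: "x \<in> {0..<h}"
    and ker: "\<And>i. i < 2 * l \<Longrightarrow> node i x \<in> {-\<omega>..\<omega>} \<Longrightarrow> (\<Sum>j<N. p (j + 1) (node i x) * W j) = 0"
  shows "(\<Sum>j<N. complex_of_real h * bracket (j + 1) g x * cnj (W j)) = 0"
proof -
  have ker': "(\<Sum>j<N. p (j + 1) (node i x) * W j) = 0" if "i < 2 * l" for i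
    using ker[OF that] p_zero by (cases "node i x \<in> {-\<omega>..\<omega>}") auto
  have "(\<Sum>j<N. complex_of_real h * bracket (j + 1) g x * cnj (W j)) =
      (\<Sum>j<N. \<Sum>i<2 * l. complex_of_real h * g (node i x) * cnj (p (j + 1) (node i x) * W j))"
    unfolding bracket_def using x
    by (simp add: sum_distrib_left sum_distrib_right mult_ac)
  also have "\<dots> = (\<Sum>i<2 * l. complex_of_real h * g (node i x) * cnj (\<Sum>j<N. p (j + 1) (node i x) * W j))"
    unfolding cnj_sum sum_distrib_left by (rule sum.swap)
  also have "\<dots> = 0" using ker' by (intro sum.neutral) auto
  finally show ?thesis .
qed

end

theorem proposition3p1:
  fixes \<omega> t\<^sub>o h :: real and l :: nat and \<Phi> :: "nat \<Rightarrow> real \<Rightarrow> complex"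
  assumes "\<omega> > 0" and "t\<^sub>o > 0" and "h = 2 * pi / t\<^sub>o"
    and "l \<ge> 2" and "\<omega> / (real l - 1 / 2) < h" and "h < \<omega> / (real l - 1)"
    and "\<forall>j\<in>{1..2 * l - 1}. \<Phi> j \<in> bandlimited \<omega>"
    and "is_frame (bandlimited \<omega>) (shift_index (2 * l - 1)) (shift_system t\<^sub>o \<Phi>)"
  shows "(AE x in lborel.
           x \<in> {0<..<\<omega> - (real l - 1) * h} \<union> {- \<omega> + real l * h<..<h} \<longrightarrow>
           mixed_gramian (2 * l - 1) t\<^sub>o \<Phi> (dual_generator \<omega> t\<^sub>o (2 * l - 1) \<Phi>) x =
             1\<^sub>m (2 * l - 1)) \<and>
         (AE x in lborel.
           x \<in> {\<omega> - (real l - 1) * h<..<- \<omega> + real l * h} \<longrightarrow>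
           mixed_gramian (2 * l - 1) t\<^sub>o \<Phi> (dual_generator \<omega> t\<^sub>o (2 * l - 1) \<Phi>) x =
             1\<^sub>m (2 * l - 1) -
             orth_projection (cross_product
               (map (\<lambda>j. fourier_vec (2 * l - 1) \<Phi> (x + of_int j * h))
                  [- int l + 1..int l - 2])))"
proof -
  define N where "N = 2 * l - 1"
  define \<Psi> where "\<Psi> = dual_generator \<omega> t\<^sub>o N \<Phi>"
  have lh: "(real l - 1) * h < \<omega>" "2 * \<omega> < 2 * (real l * h) - h"
    using assms(4,5,6) by (simp_all add: field_simps)
  have h_pos: "h > 0" using assms(2,3) by simp
  have \<omega>_less: "\<omega> < real l * h" using lh h_pos by simp
  have \<Phi>: "\<Phi> j \<in> bandlimited \<omega>" if "j \<in> {1..N}" for j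
    using assms(7) that unfolding N_def by blast
  obtain p C A where gf: "generator_frame \<omega> h l N p C A"
    and \<Phi>F: "\<And>j. j \<in> {1..N} \<Longrightarrow> AE \<xi> in lborel. fourier (\<Phi> j) \<xi> = p j \<xi>"
    and \<Phi>p: "\<And>j. j \<in> {1..N} \<Longrightarrow> AE x in lborel. \<Phi> j x = inv_fourier (p j) x"
    using frame_of_translates_fibers[OF assms(1-3) \<omega>_less \<Phi> assms(8)[folded N_def]] by blast
  interpret generator_frame \<omega> h l N p C A by (rule gf)
  have "\<exists>q. k \<in> {1..N} \<longrightarrow> q \<in> L2_supported \<omega> \<and> (AE \<xi> in lborel. fourier (\<Psi> k) \<xi> = q \<xi>) \<and>
      (AE \<xi> in lborel. fiber_frame_op q \<xi> = p k \<xi>)" for k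
    using dual_generator_transform[OF assms(2,3) bandlimited_L2[OF \<Phi>] \<Phi>p, of k] unfolding \<Psi>_def by metis
  then obtain q where q: "\<And>k. k \<in> {1..N} \<Longrightarrow> q k \<in> L2_supported \<omega>"
    and \<Psi>F: "\<And>k. k \<in> {1..N} \<Longrightarrow> AE \<xi> in lborel. fourier (\<Psi> k) \<xi> = q k \<xi>"
    and Sq: "\<And>k. k \<in> {1..N} \<Longrightarrow> AE \<xi> in lborel. fiber_frame_op (q k) \<xi> = p k \<xi>"
    by metis
  \<comment> \<open>The properties of almost every fiber that the argument uses.\<close>
  define good where "good x \<longleftrightarrow>
      (\<forall>m :: int. \<forall>k\<in>{1..N}. fourier (\<Phi> k) (x + of_int m * h) = p k (x + of_int m * h) \<and>
        fourier (\<Psi> k) (x + of_int m * h) = q k (x + of_int m * h)) \<and>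
      (\<forall>k\<in>{1..N}. \<forall>i<2 * l. fiber_frame_op (q k) (node i x) = p k (node i x)) \<and>
      (x \<in> {0..<h} \<longrightarrow> (\<forall>c. 0 \<le> defect x c))" for x
  have good_low: "0 \<le> defect x c" if "good x" "x \<in> {0..<h}" for x c
    using that unfolding good_def by blast
  have good_op: "fiber_frame_op (q (k + 1)) (node i x) = p (k + 1) (node i x)"
    if "good x" "k < N" "i < 2 * l" for x k i
  proof -
    have "k + 1 \<in> {1..N}" using that(2) by simp
    then show ?thesis using that(1,3) unfolding good_def by blast
  qed
  have good_transform: "fourier (\<Phi> (k + 1)) (x + of_int m * h) = p (k + 1) (x + of_int m * h)"
      "fourier (\<Psi> (k + 1)) (x + of_int m * h) = q (k + 1) (x + of_int m * h)"
    if "good x" "k < N" for x k and m :: int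
  proof -
    have "k + 1 \<in> {1..N}" using that(2) by simp
    then show "fourier (\<Phi> (k + 1)) (x + of_int m * h) = p (k + 1) (x + of_int m * h)"
      "fourier (\<Psi> (k + 1)) (x + of_int m * h) = q (k + 1) (x + of_int m * h)"
      using that(1) unfolding good_def by blast+
  qed
  have AE_good: "AE x in lborel. good x"
  proof -
    have "AE x in lborel. \<forall>m :: int. \<forall>k\<in>{1..N}. fourier (\<Phi> k) (x + of_int m * h) = p k (x + of_int m * h) \<and>
        fourier (\<Psi> k) (x + of_int m * h) = q k (x + of_int m * h)"
    proof (subst AE_all_countable, intro allI AE_finite_allI)
      fix m :: int and k assume k: "k \<in> {1..N}"
      show "AE x in lborel. fourier (\<Phi> k) (x + of_int m * h) = p k (x + of_int m * h) \<and>
          fourier (\<Psi> k) (x + of_int m * h) = q k (x + of_int m * h)"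
        using AE_lborel_translate[OF \<Phi>F[OF k]] AE_lborel_translate[OF \<Psi>F[OF k]] by eventually_elim simp
    qed simp
    moreover have "AE x in lborel. \<forall>k\<in>{1..N}. \<forall>i<2 * l. fiber_frame_op (q k) (node i x) = p k (node i x)"
      by (intro AE_finite_allI AE_imp_AE_fibers Sq) auto
    ultimately show ?thesis
      using fiberwise_lower_bound unfolding good_def by eventually_elim blast
  qed
  have gramian: "mixed_gramian N t\<^sub>o \<Phi> \<Psi> x =
      Matrix.mat N N (\<lambda>(j, k). complex_of_real h * bracket (j + 1) (q (k + 1)) x)"
    if x: "x \<in> {0..<h}" and good: "good x" for x
  proof (rule eq_matI)
    fix j k assume "j < dim_row (Matrix.mat N N (\<lambda>(j, k). complex_of_real h * bracket (j + 1) (q (k + 1)) x))"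
      and "k < dim_col (Matrix.mat N N (\<lambda>(j, k). complex_of_real h * bracket (j + 1) (q (k + 1)) x))"
    then have jk: "j < N" "k < N" by auto
    have "(\<Sum>\<^sub>\<infinity>m\<in>(UNIV :: int set). fourier (\<Psi> (k + 1)) (x + of_int m * h) * cnj (fourier (\<Phi> (j + 1)) (x + of_int m * h))) =
        (\<Sum>\<^sub>\<infinity>m\<in>(UNIV :: int set). q (k + 1) (x + of_int m * h) * cnj (p (j + 1) (x + of_int m * h)))"
      by (simp only: good_transform[OF good jk(1)] good_transform[OF good jk(2)])
    also have "\<dots> = (\<Sum>i<2 * l. q (k + 1) (node i x) * cnj (p (j + 1) (node i x)))"
      by (rule infsum_lattice_eq_sum_nodes[OF x]) (use p_zero jk in auto)
    also have "\<dots> = bracket (j + 1) (q (k + 1)) x" using x by (simp add: bracket_def)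
    finally show "mixed_gramian N t\<^sub>o \<Phi> \<Psi> x $$ (j, k) =
        Matrix.mat N N (\<lambda>(j, k). complex_of_real h * bracket (j + 1) (q (k + 1)) x) $$ (j, k)"
      using jk unfolding mixed_gramian_def Let_def assms(3)[symmetric] by simp
  qed (simp_all add: mixed_gramian_def Let_def)
  have ih: "real i * h \<le> real j * h" if "i \<le> j" for i j
    using that h_pos by (intro mult_right_mono) auto
  have node_eq: "node i x = x + real i * h - real l * h" for i x
    by (simp add: node_def algebra_simps)
  have l1: "real (2 * l - 1) * h = 2 * (real l * h) - h" "real (2 * l - 2) * h = 2 * (real l * h) - 2 * h"
    using assms(4) by (simp_all add: of_nat_diff algebra_simps)
  have lsub: "(real l - 1) * h = real l * h - h" by (simp add: algebra_simps)
  \<comment> \<open>On \<open>K\<^sub>-\<close> the lowest node, on \<open>K\<^sub>+\<close> the highest and on \<open>K\<close> both lie outside \<open>[-\<omega>, \<omega>]\<close>.\<close>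
  have nodes_minus: "node i x \<in> {-\<omega>..\<omega>} \<longleftrightarrow> 1 \<le> i \<and> i < 1 + N"
    if i: "i < 2 * l" and x: "0 < x" "x < \<omega> - (real l - 1) * h" for i x
  proof (cases "i = 0")
    case True
    then have "node i x < - \<omega>" using x lh unfolding node_eq lsub by simp
    then show ?thesis using True by simp
  next
    case False
    have "real 1 * h \<le> real i * h" "real i * h \<le> real (2 * l - 1) * h" using False i by (intro ih; simp)+
    then have "- \<omega> \<le> node i x \<and> node i x \<le> \<omega>"
      using x lh unfolding node_eq lsub l1 of_nat_1 of_nat_0 mult_1 mult_zero_left by linarith
    then show ?thesis using False i unfolding N_def by auto
  qed
  have nodes_plus: "node i x \<in> {-\<omega>..\<omega>} \<longleftrightarrow> 0 \<le> i \<and> i < 0 + N"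
    if i: "i < 2 * l" and x: "- \<omega> + real l * h < x" "x < h" for i x
  proof (cases "i = 2 * l - 1")
    case True
    then have "\<omega> < node i x" using x lh unfolding node_eq True lsub l1 by linarith
    then show ?thesis using True unfolding N_def by simp
  next
    case False
    have "real 0 * h \<le> real i * h" "real i * h \<le> real (2 * l - 2) * h" using False i by (intro ih; simp)+
    then have "- \<omega> \<le> node i x \<and> node i x \<le> \<omega>"
      using x lh unfolding node_eq lsub l1 of_nat_1 of_nat_0 mult_1 mult_zero_left by linarith
    then show ?thesis using False i unfolding N_def by auto
  qed
  have nodes_middle: "node i x \<in> {-\<omega>..\<omega>} \<longleftrightarrow> 1 \<le> i \<and> i < 1 + (2 * l - 2)"
    if i: "i < 2 * l" and x: "\<omega> - (real l - 1) * h < x" "x < - \<omega> + real l * h" for i x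
  proof -
    consider "i = 0" | "i = 2 * l - 1" | "1 \<le> i" "i \<le> 2 * l - 2" using i by linarith
    then show ?thesis
    proof cases
      case 1
      then have "node i x < - \<omega>" using x lh unfolding node_eq lsub by simp
      then show ?thesis using 1 by simp
    next
      case 2
      then have "\<omega> < node i x" using x lh unfolding node_eq 2 lsub l1 by linarith
      moreover have "\<not> i < 1 + (2 * l - 2)" using 2 assms(4) by linarith
      ultimately show ?thesis by simp
    next
      case 3
      have "real 1 * h \<le> real i * h" "real i * h \<le> real (2 * l - 2) * h" using 3 by (intro ih; simp)+
      then have "- \<omega> \<le> node i x \<and> node i x \<le> \<omega>"
      using x lh unfolding node_eq lsub l1 of_nat_1 of_nat_0 mult_1 mult_zero_left by linarith
      then show ?thesis using 3 i by auto
    qed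
  qed
  have square: "mixed_gramian N t\<^sub>o \<Phi> \<Psi> x = 1\<^sub>m N"
    if x: "x \<in> {0..<h}" and good: "good x" and s: "s + N \<le> 2 * l"
      and nodes: "\<And>i. i < 2 * l \<Longrightarrow> node i x \<in> {-\<omega>..\<omega>} \<longleftrightarrow> s \<le> i \<and> i < s + N" for x s
  proof (rule one_mat_if_acts_trivially[where r = "\<lambda>r k. p (k + 1) (node (r + s) x)"])
    show "rows_independent N N (\<lambda>r k. p (k + 1) (node (r + s) x))"
      by (rule fiber_rows_independent[OF good_low[OF good x] nodes s])
  next
    show "mixed_gramian N t\<^sub>o \<Phi> \<Psi> x \<in> carrier_mat N N" unfolding gramian[OF x good] by simp
    fix i k assume ik: "i < N" "k < N"
    have "(\<Sum>j<N. p (j + 1) (node (i + s) x) * mixed_gramian N t\<^sub>o \<Phi> \<Psi> x $$ (j, k)) =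
        (\<Sum>j<N. p (j + 1) (node (i + s) x) * (complex_of_real h * bracket (j + 1) (q (k + 1)) x))"
      using ik unfolding gramian[OF x good] by (intro sum.cong) auto
    also have "\<dots> = p (k + 1) (node (i + s) x)"
      by (rule dual_bracket_reproduces[OF x _ good_op[OF good]]) (use ik s in auto)
    finally show "(\<Sum>j<N. p (j + 1) (node (i + s) x) * mixed_gramian N t\<^sub>o \<Phi> \<Psi> x $$ (j, k)) =
        p (k + 1) (node (i + s) x)" .
  qed
  have corank: "mixed_gramian N t\<^sub>o \<Phi> \<Psi> x = 1\<^sub>m N - orth_projection (cross_product
      (map (\<lambda>j. fourier_vec N \<Phi> (x + of_int j * h)) [- int l + 1..int l - 2]))"
    if x: "x \<in> {0..<h}" and good: "good x"
      and nodes: "\<And>i. i < 2 * l \<Longrightarrow> node i x \<in> {-\<omega>..\<omega>} \<longleftrightarrow> 1 \<le> i \<and> i < 1 + (2 * l - 2)" for x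
  proof -
    define m where "m = 2 * l - 2"
    have Nm: "N = m + 1" using assms(4) unfolding N_def m_def by simp
    define rs where "rs = map (\<lambda>j. fourier_vec N \<Phi> (x + of_int j * h)) [- int l + 1..int l - 2]"
    have len: "length rs = m" unfolding rs_def m_def using assms(4) by simp
    have rs_carrier: "rs ! r \<in> carrier_vec (m + 1)" if "r < m" for r
      using that len unfolding rs_def by (simp add: fourier_vec_def Nm)
    have rs_index: "vec_index (rs ! r) k = p (k + 1) (node (r + 1) x)" if "r < m" "k < m + 1" for r k
    proof -
      have "rs ! r = fourier_vec N \<Phi> (x + of_int (- int l + 1 + int r) * h)"
        using that(1) len unfolding rs_def by (simp add: nth_upto)
      moreover have "x + of_int (- int l + 1 + int r) * h = node (r + 1) x"
        by (simp add: node_def algebra_simps)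
      moreover have "fourier (\<Phi> (k + 1)) (x + of_int (- int l + 1 + int r) * h) =
          p (k + 1) (x + of_int (- int l + 1 + int r) * h)"
        by (rule good_transform(1)[OF good]) (use that(2) Nm in simp)
      ultimately show ?thesis using that(2) Nm by (simp add: fourier_vec_def)
    qed
    have entry: "mixed_gramian N t\<^sub>o \<Phi> \<Psi> x $$ (j, k) = complex_of_real h * bracket (j + 1) (q (k + 1)) x"
      if "j < m + 1" "k < m + 1" for j k
      using that unfolding gramian[OF x good] by (simp add: Nm)
    have "mixed_gramian N t\<^sub>o \<Phi> \<Psi> x = 1\<^sub>m (m + 1) - orth_projection (cross_product rs)"
    proof (rule orth_projection_onto_corank_one_kernel[OF len rs_carrier])
      have "rows_independent m N (\<lambda>r k. p (k + 1) (node (r + 1) x))"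
        by (rule fiber_rows_independent[OF good_low[OF good x] nodes[folded m_def]])
          (use assms(4) in \<open>auto simp: m_def\<close>)
      then show "rows_independent m (m + 1) (\<lambda>i. vec_index (rs ! i))"
        unfolding rows_independent_def Nm by (simp add: rs_index)
    next
      show "mixed_gramian N t\<^sub>o \<Phi> \<Psi> x \<in> carrier_mat (m + 1) (m + 1)"
        unfolding gramian[OF x good] using Nm by simp
      fix i k assume ik: "i < m" "k < m + 1"
      have "(\<Sum>j<m + 1. vec_index (rs ! i) j * mixed_gramian N t\<^sub>o \<Phi> \<Psi> x $$ (j, k)) =
          (\<Sum>j<N. p (j + 1) (node (i + 1) x) * (complex_of_real h * bracket (j + 1) (q (k + 1)) x))"
      proof (rule sum.cong)
        fix j assume "j \<in> {..<N}"
        then show "vec_index (rs ! i) j * mixed_gramian N t\<^sub>o \<Phi> \<Psi> x $$ (j, k) =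
            p (j + 1) (node (i + 1) x) * (complex_of_real h * bracket (j + 1) (q (k + 1)) x)"
          using ik by (simp add: rs_index entry less_Suc_eq_le Nm[THEN arg_cong[where f = "\<lambda>n. j < n"]])
      qed (simp add: Nm)
      also have "\<dots> = p (k + 1) (node (i + 1) x)"
        by (rule dual_bracket_reproduces[OF x _ good_op[OF good]]) (use ik Nm in \<open>auto simp: m_def\<close>)
      finally show "(\<Sum>j<m + 1. vec_index (rs ! i) j * mixed_gramian N t\<^sub>o \<Phi> \<Psi> x $$ (j, k)) =
          vec_index (rs ! i) k"
        using rs_index[OF ik] by simp
    next
      fix k assume k: "k < m + 1"
      have "(\<Sum>j<N. complex_of_real h * bracket (j + 1) (q (k + 1)) x * cnj (vec_index (cross_product rs) j)) = 0"
      proof (rule bracket_orthogonal_to_kernel[OF x])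
        fix i assume i: "i < 2 * l" "node i x \<in> {-\<omega>..\<omega>}"
        then have i': "i - 1 < m" "i - 1 + 1 = i" using nodes[OF i(1)] assms(4) unfolding m_def by auto
        have "(\<Sum>j<N. p (j + 1) (node i x) * vec_index (cross_product rs) j) =
            (\<Sum>j<m + 1. vec_index (rs ! (i - 1)) j * vec_index (cross_product rs) j)"
          using i' unfolding Nm by (intro sum.cong) (auto simp: rs_index)
        also have "\<dots> = 0" by (rule cross_product_orthogonal[OF len rs_carrier i'(1)])
        finally show "(\<Sum>j<N. p (j + 1) (node i x) * vec_index (cross_product rs) j) = 0" .
      qed
      then show "(\<Sum>j<m + 1. mixed_gramian N t\<^sub>o \<Phi> \<Psi> x $$ (j, k) * cnj (vec_index (cross_product rs) j)) = 0"
        using k by (simp add: entry Nm[THEN arg_cong[where f = lessThan]] del: sum.lessThan_Suc)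
    qed
    then show ?thesis unfolding rs_def Nm .
  qed
  have K_subset: "x \<in> {0..<h}" if "x \<in> {\<omega> - (real l - 1) * h<..<- \<omega> + real l * h}" for x
    using that lh unfolding lsub by auto
  show ?thesis
    unfolding N_def[symmetric] \<Psi>_def[symmetric]
  proof (intro conjI)
    show "AE x in lborel. x \<in> {0<..<\<omega> - (real l - 1) * h} \<union> {- \<omega> + real l * h<..<h} \<longrightarrow>
        mixed_gramian N t\<^sub>o \<Phi> \<Psi> x = 1\<^sub>m N"
      using AE_good
    proof (rule AE_mp, intro AE_I2 impI)
      fix x assume good: "good x"
        and "x \<in> {0<..<\<omega> - (real l - 1) * h} \<union> {- \<omega> + real l * h<..<h}"
      then consider "0 < x" "x < \<omega> - (real l - 1) * h" | "- \<omega> + real l * h < x" "x < h" by auto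
      then show "mixed_gramian N t\<^sub>o \<Phi> \<Psi> x = 1\<^sub>m N"
      proof cases
        case 1
        then have "x \<in> {0..<h}" using lh unfolding lsub by auto
        then show ?thesis
          using assms(4) by (intro square[OF _ good, of 1] nodes_minus 1) (auto simp: N_def)
      next
        case 2
        then have "x \<in> {0..<h}" using \<omega>_less by auto
        then show ?thesis
          using assms(4) by (intro square[OF _ good, of 0] nodes_plus 2) (auto simp: N_def)
      qed
    qed
    show "AE x in lborel. x \<in> {\<omega> - (real l - 1) * h<..<- \<omega> + real l * h} \<longrightarrow>
        mixed_gramian N t\<^sub>o \<Phi> \<Psi> x = 1\<^sub>m N - orth_projection (cross_product
          (map (\<lambda>j. fourier_vec N \<Phi> (x + of_int j * h)) [- int l + 1..int l - 2]))"
      using AE_good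
    proof (rule AE_mp, intro AE_I2 impI)
      fix x assume good: "good x" and x: "x \<in> {\<omega> - (real l - 1) * h<..<- \<omega> + real l * h}"
      show "mixed_gramian N t\<^sub>o \<Phi> \<Psi> x = 1\<^sub>m N - orth_projection (cross_product
          (map (\<lambda>j. fourier_vec N \<Phi> (x + of_int j * h)) [- int l + 1..int l - 2]))"
        by (rule corank[OF K_subset[OF x] good], rule nodes_middle) (use x in simp_all)
    qed
  qed
qed

end
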